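(* The functions $\theta_i(X)$ ($i\in[n-1]$), $\varphi_p(X,X)$ ($p\in[N]$), $\psi_q(X,X)$ ($q\in[M]$) on $SL_n$ form a log-canonical family with respect to the Cremmer–Gervais Poisson–Lie bracket, i.e. for any two functions $f,g$ of this family $\{f,g\}=c_{fg}\,fg$ for a constant $c_{fg}$.
   Context: For a matrix $A$, $A_{I}^{J}$ is the submatrix with rows $I$ and columns $J$ (omitted index list = all). For $n\times n$ matrices $X,Y$ let $\mathcal X=[X_{[2,n]}\ 0]$ (rows $2,\dots,n$ of $X$ followed by a zero column) and $\mathcal Y=[0\ Y_{[1,n-1]}]$ (a zero column followed by rows $1,\dots,n-1$ of $Y$), both $(n-1)\times(n+1)$. Let $k=\lfloor (n+1)/2\rfloor$, $N=k(n-1)$, $M=N$ if $n$ is even and $M=N-n+1$ if $n$ is odd. $U(X,Y)$ is the $k(n-1)\times(k+1)(n+1)$ block matrix with $k$ block rows and $k+1$ block columns (each of width $n+1$), whose $i$-th block row has $\mathcal Y$ in block column $i$, $\mathcal X$ in block column $i+1$, zeros elsewhere. Define $\theta_i(X)=\det X_{[n-i+1,n]}^{[n-i+1,n]}$, $\varphi_p(X,Y)=\det U(X,Y)_{[N-p+1,N]}^{[k(n+1)-p+1,\,k(n+1)]}$, $\psi_q(X,Y)=\det U(X,Y)_{[N-q+1,N]}^{[k(n+1)-q+2,\,k(n+1)+1]}$. The Cremmer–Gervais bracket: with simple roots $\alpha_1,\dots,\alpha_{n-1}$ of $SL_n$, the Belavin–Drinfeld triple $\Gamma_1=\{\alpha_2,\dots,\alpha_{n-1}\}$,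 $\Gamma_2=\{\alpha_1,\dots,\alpha_{n-2}\}$, $\gamma(\alpha_i)=\alpha_{i-1}$ determines a unique classical $r$-matrix (its Belavin–Drinfeld class is a single element); the Cremmer–Gervais bracket is the associated Poisson–Lie bracket on $SL_n$. *)

theory Defs
  imports "HOL-Analysis.Analysis" "Jordan_Normal_Form.Determinant"
begin

text \<open>Conventions. Matrices are Jordan_Normal_Form matrices over the complex numbers,
indexed from 0 (the paper indexes from 1).  The trace form is tr(A B).\<close>

definition csub :: "'a mat \<Rightarrow> nat \<Rightarrow> nat \<Rightarrow> nat \<Rightarrow> 'a mat" where
  "csub A r0 c0 p = mat p p (\<lambda>(i,j). A $$ (r0 + i, c0 + j))"

definition kk :: "nat \<Rightarrow> nat" where "kk n = (n + 1) div 2"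
definition NN :: "nat \<Rightarrow> nat" where "NN n = kk n * (n - 1)"
definition MM :: "nat \<Rightarrow> nat" where
  "MM n = (if even n then NN n else NN n - n + 1)"

definition calX :: "nat \<Rightarrow> complex mat \<Rightarrow> complex mat" where
  "calX n X = mat (n - 1) (n + 1) (\<lambda>(r,c). if c < n then X $$ (r + 1, c) else 0)"
definition calY :: "nat \<Rightarrow> complex mat \<Rightarrow> complex mat" where
  "calY n Y = mat (n - 1) (n + 1) (\<lambda>(r,c). if c = 0 then 0 else Y $$ (r, c - 1))"

definition UU :: "nat \<Rightarrow> complex mat \<Rightarrow> complex mat \<Rightarrow> complex mat" where
  "UU n X Y = mat (kk n * (n - 1)) ((kk n + 1) * (n + 1))
     (\<lambda>(a,b). let bi = a div (n - 1); r = a mod (n - 1);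
                 bj = b div (n + 1); c = b mod (n + 1)
             in if bj = bi then calY n Y $$ (r, c)
                else if bj = bi + 1 then calX n X $$ (r, c) else 0)"

definition theta :: "nat \<Rightarrow> nat \<Rightarrow> complex mat \<Rightarrow> complex" where
  "theta n i X = det (csub X (n - i) (n - i) i)"

definition phi :: "nat \<Rightarrow> nat \<Rightarrow> complex mat \<Rightarrow> complex mat \<Rightarrow> complex" where
  "phi n p X Y = det (csub (UU n X Y) (NN n - p) (kk n * (n + 1) - p) p)"

definition psi :: "nat \<Rightarrow> nat \<Rightarrow> complex mat \<Rightarrow> complex mat \<Rightarrow> complex" where
  "psi n q X Y = det (csub (UU n X Y) (NN n - q) (kk n * (n + 1) + 1 - q) q)"

definition mtrace :: "complex mat \<Rightarrow> complex" where
  "mtrace A = (\<Sum>i<dim_row A. A $$ (i,i))"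

definition Eu :: "nat \<Rightarrow> nat \<Rightarrow> nat \<Rightarrow> complex mat" where
  "Eu n i j = mat n n (\<lambda>(a,b). if a = i \<and> b = j then 1 else 0)"

(* gradient w.r.t. the trace form: tr(grad f X * xi) = d/dt f(X + t xi) at t=0 *)
definition grad :: "nat \<Rightarrow> (complex mat \<Rightarrow> complex) \<Rightarrow> complex mat \<Rightarrow> complex mat" where
  "grad n f X = mat n n (\<lambda>(i,j). deriv (\<lambda>t. f (X + t \<cdot>\<^sub>m Eu n j i)) 0)"

definition pr_sl :: "nat \<Rightarrow> complex mat \<Rightarrow> complex mat" where
  "pr_sl n A = A - (mtrace A / of_nat n) \<cdot>\<^sub>m 1\<^sub>m n"

(* right and left gradients on SL_n:
   <gradR f X, xi> = d/dt f(X exp(t xi)),  <gradL f X, xi> = d/dt f(exp(t xi) X) *)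
definition gradR :: "nat \<Rightarrow> (complex mat \<Rightarrow> complex) \<Rightarrow> complex mat \<Rightarrow> complex mat" where
  "gradR n f X = pr_sl n (grad n f X * X)"
definition gradL :: "nat \<Rightarrow> (complex mat \<Rightarrow> complex) \<Rightarrow> complex mat \<Rightarrow> complex mat" where
  "gradL n f X = pr_sl n (X * grad n f X)"

definition upper_part :: "nat \<Rightarrow> complex mat \<Rightarrow> complex mat" where
  "upper_part n A = mat n n (\<lambda>(i,j). if i < j then A $$ (i,j) else 0)"
definition lower_part :: "nat \<Rightarrow> complex mat \<Rightarrow> complex mat" where
  "lower_part n A = mat n n (\<lambda>(i,j). if j < i then A $$ (i,j) else 0)"
definition diag_part :: "nat \<Rightarrow> complex mat \<Rightarrow> complex mat" where
  "diag_part n A = mat n n (\<lambda>(i,j). if i = j then A $$ (i,j) else 0)"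

(* gamma on n_+ : E_{i,j} \<mapsto> E_{i-1,j-1} (1-based, i \<ge> 2), E_{1,j} \<mapsto> 0
   (the Lie algebra map induced by gamma(alpha_i) = alpha_{i-1});
   gammaT is its adjoint gamma^* on n_- : E_{j,i} \<mapsto> E_{j+1,i+1} *)
definition gammaU :: "nat \<Rightarrow> complex mat \<Rightarrow> complex mat" where
  "gammaU n A = mat n n (\<lambda>(i,j). if i + 1 < n \<and> j + 1 < n then A $$ (i+1, j+1) else 0)"
definition gammaT :: "nat \<Rightarrow> complex mat \<Rightarrow> complex mat" where
  "gammaT n A = mat n n (\<lambda>(i,j). if 0 < i \<and> 0 < j then A $$ (i-1, j-1) else 0)"

definition cartan :: "nat \<Rightarrow> complex mat set" where
  "cartan n = {A \<in> carrier_mat n n. diagonal_mat A \<and> mtrace A = 0}"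

(* simple coroot alpha_i^\<or> = E_ii - E_{i+1,i+1}, i = 1..n-1 (1-based) *)
definition coroot :: "nat \<Rightarrow> nat \<Rightarrow> complex mat" where
  "coroot n i = Eu n (i - 1) (i - 1) - Eu n i i"

(* R_0 \<in> End(h) for the Cremmer--Gervais triple:
   R_0 (1 - gamma) h = h for h \<in> h_{Gamma_1} and R_0 + R_0^* = 1_h *)
definition CG_R0 :: "nat \<Rightarrow> (complex mat \<Rightarrow> complex mat) \<Rightarrow> bool" where
  "CG_R0 n R0 \<longleftrightarrow>
     (\<forall>a\<in>cartan n. R0 a \<in> cartan n) \<and>
     (\<forall>a\<in>cartan n. \<forall>b\<in>cartan n. R0 (a + b) = R0 a + R0 b) \<and>
     (\<forall>a\<in>cartan n. \<forall>c. R0 (c \<cdot>\<^sub>m a) = c \<cdot>\<^sub>m R0 a) \<and>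
     (\<forall>a\<in>cartan n. \<forall>b\<in>cartan n. mtrace (R0 a * b) + mtrace (a * R0 b) = mtrace (a * b)) \<and>
     (\<forall>i\<in>{2..n-1}. R0 (coroot n i - coroot n (i - 1)) = coroot n i)"

(* R_+ = 1/(1-gamma) pi_> - gamma^star/(1-gamma^star) pi_< + R_0 pi_0
   (gamma, gamma^* nilpotent, so the geometric series are finite) *)
definition Rplus :: "nat \<Rightarrow> (complex mat \<Rightarrow> complex mat) \<Rightarrow> complex mat \<Rightarrow> complex mat" where
  "Rplus n R0 A =
     mat n n (\<lambda>(i,j). (\<Sum>m\<in>{0..n}. ((gammaU n ^^ m) (upper_part n A)) $$ (i,j))
                     - (\<Sum>m\<in>{1..n}. ((gammaT n ^^ m) (lower_part n A)) $$ (i,j)))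
     + R0 (diag_part n A)"

definition CG_bracket :: "nat \<Rightarrow> (complex mat \<Rightarrow> complex mat) \<Rightarrow>
    (complex mat \<Rightarrow> complex) \<Rightarrow> (complex mat \<Rightarrow> complex) \<Rightarrow> complex mat \<Rightarrow> complex" where
  "CG_bracket n R0 f g X =
     mtrace (Rplus n R0 (gradL n f X) * gradL n g X)
     - mtrace (Rplus n R0 (gradR n f X) * gradR n g X)"

definition CG_family :: "nat \<Rightarrow> (complex mat \<Rightarrow> complex) set" where
  "CG_family n = (\<lambda>i. theta n i) ` {1..n-1}
                 \<union> (\<lambda>p X. phi n p X X) ` {1..NN n}
                 \<union> (\<lambda>q X. psi n q X X) ` {1..MM n}"

end

theory Submission
  imports Defs "HOL-Library.Function_Algebras"
begin

text \<open>Every function of the family is a minor of the periodic staircase matrix \<open>U\<close>, taken in its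
last rows and in consecutive columns. With \<open>H\<close> the adjugate of the corresponding submatrix, \<open>U H\<close>
and \<open>H U\<close> are triangular up to explicit blocks; this encodes the invariance of the function
\<open>F(X,Y)\<close> under unipotent left and right multiplications. Writing \<open>A = X \<nabla>\<^sub>X F\<close>,
\<open>B = Y \<nabla>\<^sub>Y F\<close>, \<open>P = \<nabla>\<^sub>X F X\<close>, \<open>Q = \<nabla>\<^sub>Y F Y\<close> on the diagonal \<open>Y = X\<close>, the invariance makes the
geometric series in \<open>R\<^sub>+\<close> telescope. The off-diagonal part of the bracket then agrees with
a Toeplitz sum, the bracket of the periodic matrix \<open>U\<close> for the trigonometric r-matrix, which for two
minors collapses because the rows of the smaller one are among those of the larger one. What is
left are sums over diagonals, which are constant multiples of the product of the two functions
because the functions are homogeneous under the torus actions and \<open>R\<^sub>0 (1 - \<gamma>) h = h\<close>.\<close>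

section \<open>The off-diagonal part of the r-matrix\<close>

text \<open>The obstacle is that an entry of \<open>X\<close> occurs in many blocks of
  \<open>U\<close>, so the bracket calculus for minors of a generic matrix does not apply directly.
  It helps to let the \<open>X\<close> and the \<open>Y\<close> copies vary separately. Adding a row
  of a block to an earlier one adds row j to row i in \<open>Y\<close> and row j + 1 to row i + 1 in
  \<open>X\<close> at once; this offset is the shift behind \<open>\<gamma>\<close>, and the zero
  columns produce the same offset on the other side. So the strictly lower part of
  \<open>A + B\<close> is \<open>1 - shift_adj\<close> applied to that of \<open>B\<close>, the
  strictly upper part of \<open>P + Q\<close> is \<open>1 - shift\<close> applied to that of
  \<open>P\<close>, and the inverses in \<open>R\<^sub>+\<close> have something to cancel. The
  collapse is not symmetric in the two functions: it wants a \<theta> first and otherwise the larger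
  minor first. The opposite order follows from antisymmetry, that is, from \<open>R\<^sub>+\<close>
  plus its adjoint being the identity. On the Cartan part \<open>R\<^sub>0\<close> is prescribed
  only on a hyperplane. The diagonals of \<open>A\<close>, \<open>B\<close>, \<open>P\<close>,
  \<open>Q\<close> are therefore never computed, only split into a part where
  \<open>R\<^sub>0\<close> is known and a fixed vector times the value of the function.\<close>

type_synonym fmat = "nat \<Rightarrow> nat \<Rightarrow> complex"

definition mmul :: "nat \<Rightarrow> fmat \<Rightarrow> fmat \<Rightarrow> fmat" where
  "mmul n M N = (\<lambda>i j. if i < n \<and> j < n then \<Sum>l<n. M i l * N l j else 0)"

definition pairing :: "nat \<Rightarrow> fmat \<Rightarrow> fmat \<Rightarrow> complex" where
  "pairing n M N = (\<Sum>i<n. \<Sum>j<n. M i j * N j i)"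

definition diag_pairing :: "nat \<Rightarrow> fmat \<Rightarrow> fmat \<Rightarrow> complex" where
  "diag_pairing n M N = (\<Sum>i<n. M i i * N i i)"

definition strict_upper :: "nat \<Rightarrow> fmat \<Rightarrow> fmat" where
  "strict_upper n M = (\<lambda>i j. if i < j \<and> j < n then M i j else 0)"

definition strict_lower :: "nat \<Rightarrow> fmat \<Rightarrow> fmat" where
  "strict_lower n M = (\<lambda>i j. if j < i \<and> i < n then M i j else 0)"

text \<open>\<open>shift\<close> and \<open>shift_adj\<close> are \<open>\<gamma>\<close> and \<open>\<gamma>\<^sup>*\<close>, extended to all matrices by the same formula.\<close>

definition shift :: "nat \<Rightarrow> fmat \<Rightarrow> fmat" where
  "shift n M = (\<lambda>i j. if i + 1 < n \<and> j + 1 < n then M (i + 1) (j + 1) else 0)"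

definition shift_adj :: "nat \<Rightarrow> fmat \<Rightarrow> fmat" where
  "shift_adj n M = (\<lambda>i j. if 0 < i \<and> 0 < j \<and> i < n \<and> j < n then M (i - 1) (j - 1) else 0)"

definition rplus_off :: "nat \<Rightarrow> fmat \<Rightarrow> fmat" where
  "rplus_off n E = (\<lambda>i j. (\<Sum>s\<in>{0..n}. (shift n ^^ s) (strict_upper n E) i j) - (\<Sum>s\<in>{1..n}. (shift_adj n ^^ s) (strict_lower n E) i j))"

lemma pairing_commute: "pairing n M N = pairing n N M"
  unfolding pairing_def by (subst sum.swap) (simp add: mult.commute)

lemma pairing_add_left: "pairing n (M + N) K = pairing n M K + pairing n N K"
  and pairing_diff_left: "pairing n (M - N) K = pairing n M K - pairing n N K"
  and pairing_minus_left: "pairing n (- M) K = - pairing n M K"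
  by (simp_all add: pairing_def sum.distrib sum_subtractf sum_negf algebra_simps)

lemma pairing_add_right: "pairing n K (M + N) = pairing n K M + pairing n K N"
  and pairing_diff_right: "pairing n K (M - N) = pairing n K M - pairing n K N"
  and pairing_minus_right: "pairing n K (- M) = - pairing n K M"
  by (simp_all add: pairing_def sum.distrib sum_subtractf sum_negf algebra_simps)

lemmas pairing_linear = pairing_add_left pairing_diff_left pairing_minus_left pairing_add_right pairing_diff_right pairing_minus_right

lemma strict_upper_add: "strict_upper n (M + N) = strict_upper n M + strict_upper n N"
  and strict_lower_add: "strict_lower n (M + N) = strict_lower n M + strict_lower n N"
  by (auto simp: strict_upper_def strict_lower_def fun_eq_iff)

lemma pairing_zero_left: "pairing n 0 N = 0"
  by (simp add: pairing_def)

lemma pairing_strict_upper: "pairing n (strict_upper n M) N = pairing n (strict_upper n M) (strict_lower n N)"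
  unfolding pairing_def by (intro sum.cong refl) (auto simp: strict_upper_def strict_lower_def)

lemma pairing_strict_lower: "pairing n (strict_lower n M) N = pairing n (strict_lower n M) (strict_upper n N)"
  unfolding pairing_def by (intro sum.cong refl) (auto simp: strict_upper_def strict_lower_def)

lemma pairing_split: "pairing n M N = pairing n (strict_upper n M) N + pairing n (strict_lower n M) N + diag_pairing n M N"
proof -
  have "pairing n M N = (\<Sum>i<n. \<Sum>j<n. strict_upper n M i j * N j i + strict_lower n M i j * N j i + (if j = i then M i i * N i i else 0))"
    unfolding pairing_def by (intro sum.cong refl) (auto simp: strict_upper_def strict_lower_def)
  thus ?thesis by (simp add: pairing_def diag_pairing_def sum.distrib)
qed

lemma strict_upper_shift: "strict_upper n (shift n M) = shift n (strict_upper n M)"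
  and strict_lower_shift: "strict_lower n (shift n M) = shift n (strict_lower n M)"
  and strict_lower_shift_adj: "strict_lower n (shift_adj n M) = shift_adj n (strict_lower n M)"
  by (auto simp: strict_upper_def strict_lower_def shift_def shift_adj_def fun_eq_iff)

section \<open>Adjointness of the two shifts and telescoping of their series\<close>

lemma pairing_shift: "pairing n (shift n M) N = pairing n M (shift_adj n N)"
proof (cases n)
  case (Suc n')
  have "pairing n (shift n M) N = (\<Sum>i<n'. \<Sum>j<n'. M (Suc i) (Suc j) * N j i)"
    unfolding pairing_def shift_def Suc by (simp add: if_distrib cong: if_cong)
  also have "\<dots> = pairing n M (shift_adj n N)"
    unfolding pairing_def shift_adj_def Suc sum.lessThan_Suc_shift by simp
  finally show ?thesis .
qed (simp add: pairing_def)

lemma pairing_shift_adj: "pairing n (shift_adj n M) N = pairing n M (shift n N)"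
  using pairing_shift[of n N M] by (simp add: pairing_commute)

lemma shift_pow_strict_upper: "(shift n ^^ s) (strict_upper n M) = strict_upper n ((shift n ^^ s) M)"
  by (induction s) (simp_all add: strict_upper_shift)

lemma shift_adj_pow_strict_lower: "(shift_adj n ^^ s) (strict_lower n M) = strict_lower n ((shift_adj n ^^ s) M)"
  by (induction s) (simp_all add: strict_lower_shift_adj)

text \<open>Power 0 is the identity and does not cut off at \<open>n\<close>, hence
  \<open>s > 0\<close>.\<close>

lemma shift_pow: "s > 0 \<Longrightarrow> (shift n ^^ s) M = (\<lambda>i j. if i + s < n \<and> j + s < n then M (i + s) (j + s) else 0)"
proof (induction s rule: nat_induct_non_zero)
  case 1 show ?case by (auto simp: shift_def)
next
  case (Suc s) thus ?case by (auto simp: shift_def fun_eq_iff)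
qed

lemma shift_pow_zero: "(shift n ^^ Suc n) M = 0"
  by (subst shift_pow) (auto simp: fun_eq_iff)

lemma pairing_shift_pow_shift_adj: "pairing n ((shift n ^^ s) M) (shift_adj n N) = pairing n ((shift n ^^ Suc s) M) N"
  by (simp add: pairing_shift)

lemma pairing_shift_adj_pow_shift: "pairing n ((shift_adj n ^^ s) M) (shift n N) = pairing n ((shift_adj n ^^ Suc s) M) N"
  by (simp add: pairing_shift_adj)

lemma pairing_shift_adj_pow: "pairing n ((shift_adj n ^^ s) M) N = pairing n M ((shift n ^^ s) N)"
proof (induction s arbitrary: N)
  case (Suc s)
  have "pairing n ((shift_adj n ^^ Suc s) M) N = pairing n ((shift_adj n ^^ s) M) (shift n N)" by (simp add: pairing_shift_adj)
  also have "\<dots> = pairing n M ((shift n ^^ Suc s) N)" by (simp add: Suc funpow_swap1)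
  finally show ?case .
qed simp

text \<open>Moving \<open>shift\<close> across the pairing makes each summand a difference of
  consecutive values, and nilpotency kills the last one. Here the telescoping argument is on the
  right; in \<open>shift_series\<close> and \<open>shift_adj_series\<close> it is on the
  left.\<close>

lemma pairing_shift_series:
  assumes "strict_lower n N = strict_lower n K - shift_adj n (strict_lower n K)"
  shows "(\<Sum>s\<in>{0..n}. pairing n ((shift n ^^ s) (strict_upper n M)) N) = pairing n (strict_upper n M) K"
proof -
  have "pairing n ((shift n ^^ s) (strict_upper n M)) N
      = pairing n ((shift n ^^ s) (strict_upper n M)) (strict_lower n K) - pairing n ((shift n ^^ Suc s) (strict_upper n M)) (strict_lower n K)" for s
  proof -
    have "pairing n ((shift n ^^ s) (strict_upper n M)) N = pairing n ((shift n ^^ s) (strict_upper n M)) (strict_lower n N)"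
      unfolding shift_pow_strict_upper by (rule pairing_strict_upper)
    thus ?thesis unfolding assms pairing_diff_right pairing_shift_pow_shift_adj .
  qed
  hence "(\<Sum>s\<in>{0..n}. pairing n ((shift n ^^ s) (strict_upper n M)) N)
     = pairing n (strict_upper n M) (strict_lower n K) - pairing n ((shift n ^^ Suc n) (strict_upper n M)) (strict_lower n K)"
    using sum_telescope[of "\<lambda>s. pairing n ((shift n ^^ s) (strict_upper n M)) (strict_lower n K)" n] by (simp add: atMost_atLeast0 del: funpow.simps)
  thus ?thesis by (simp add: shift_pow_zero pairing_zero_left pairing_strict_upper[of n M K] del: funpow.simps)
qed

lemma pairing_shift_adj_series:
  assumes "strict_upper n N = strict_upper n K - shift n (strict_upper n K)"
  shows "(\<Sum>s\<in>{1..n}. pairing n ((shift_adj n ^^ s) (strict_lower n M)) N) = pairing n (strict_lower n M) (shift n K)"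
proof -
  have eq: "pairing n ((shift_adj n ^^ s) (strict_lower n M)) N
      = pairing n ((shift_adj n ^^ s) (strict_lower n M)) (strict_upper n K) - pairing n ((shift_adj n ^^ Suc s) (strict_lower n M)) (strict_upper n K)" for s
  proof -
    have "pairing n ((shift_adj n ^^ s) (strict_lower n M)) N = pairing n ((shift_adj n ^^ s) (strict_lower n M)) (strict_upper n N)"
      unfolding shift_adj_pow_strict_lower by (rule pairing_strict_lower)
    thus ?thesis unfolding assms pairing_diff_right pairing_shift_adj_pow_shift .
  qed
  have "(\<Sum>s\<in>{1..n}. pairing n ((shift_adj n ^^ s) (strict_lower n M)) N)
     = pairing n ((shift_adj n ^^ 1) (strict_lower n M)) (strict_upper n K) - pairing n ((shift_adj n ^^ Suc n) (strict_lower n M)) (strict_upper n K)"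
    unfolding eq using sum_Suc_diff[of 1 n "\<lambda>s. - pairing n ((shift_adj n ^^ s) (strict_lower n M)) (strict_upper n K)"]
    by (simp del: funpow.simps)
  also have "\<dots> = pairing n (strict_lower n M) (shift n (strict_upper n K))"
    unfolding pairing_shift_adj_pow shift_pow_zero by (simp add: pairing_commute[of n _ 0] pairing_zero_left)
  also have "\<dots> = pairing n (strict_lower n M) (shift n K)"
    unfolding strict_upper_shift[symmetric] by (rule pairing_strict_lower[symmetric])
  finally show ?thesis .
qed

lemma pairing_rplus_off:
  "pairing n (rplus_off n E) N = (\<Sum>s\<in>{0..n}. pairing n ((shift n ^^ s) (strict_upper n E)) N) - (\<Sum>s\<in>{1..n}. pairing n ((shift_adj n ^^ s) (strict_lower n E)) N)"
proof -
  have "pairing n (\<lambda>i j. \<Sum>s\<in>S. F s i j) N = (\<Sum>s\<in>S. pairing n (F s) N)" for S :: "nat set" and F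
    unfolding pairing_def by (simp only: sum_distrib_right sum.swap[where B = S])
  moreover have "rplus_off n E = (\<lambda>i j. \<Sum>s\<in>{0..n}. (shift n ^^ s) (strict_upper n E) i j) - (\<lambda>i j. \<Sum>s\<in>{1..n}. (shift_adj n ^^ s) (strict_lower n E) i j)"
    by (simp add: rplus_off_def fun_eq_iff)
  ultimately show ?thesis by (simp only: pairing_diff_left)
qed

lemma shift_adj_series:
  assumes "strict_lower n E = strict_lower n K - shift_adj n (strict_lower n K)"
  shows "(\<Sum>s\<in>{1..n}. pairing n ((shift_adj n ^^ s) (strict_lower n E)) N) = pairing n (shift_adj n (strict_lower n K)) N"
proof -
  have eq: "pairing n ((shift_adj n ^^ s) (strict_lower n E)) N = pairing n (strict_lower n K) ((shift n ^^ s) N) - pairing n (strict_lower n K) ((shift n ^^ Suc s) N)" for s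
    unfolding pairing_shift_adj_pow assms pairing_diff_left by (simp add: pairing_shift_adj)
  have "(\<Sum>s\<in>{1..n}. pairing n ((shift_adj n ^^ s) (strict_lower n E)) N)
     = pairing n (strict_lower n K) ((shift n ^^ 1) N) - pairing n (strict_lower n K) ((shift n ^^ Suc n) N)"
    unfolding eq using sum_Suc_diff[of 1 n "\<lambda>s. - pairing n (strict_lower n K) ((shift n ^^ s) N)"]
    by (simp del: funpow.simps)
  thus ?thesis unfolding shift_pow_zero by (simp add: pairing_commute[of n _ 0] pairing_zero_left pairing_shift_adj)
qed

lemma shift_series:
  assumes "strict_upper n E = strict_upper n K - shift n (strict_upper n K)"
  shows "(\<Sum>s\<in>{0..n}. pairing n ((shift n ^^ s) (strict_upper n E)) N) = pairing n (strict_upper n K) N"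
proof -
  have "(shift n ^^ s) (M - M') = (shift n ^^ s) M - (shift n ^^ s) M'" for s M M'
    by (induction s) (auto simp: shift_def fun_eq_iff)
  hence eq: "pairing n ((shift n ^^ s) (strict_upper n E)) N = pairing n ((shift n ^^ s) (strict_upper n K)) N - pairing n ((shift n ^^ Suc s) (strict_upper n K)) N" for s
    unfolding assms by (simp add: pairing_diff_left funpow_swap1)
  show ?thesis
    unfolding eq using sum_telescope[of "\<lambda>s. pairing n ((shift n ^^ s) (strict_upper n K)) N" n]
    by (simp add: atMost_atLeast0 shift_pow_zero pairing_zero_left del: funpow.simps)
qed

text \<open>The geometric series in the off-diagonal part of \<open>R\<^sub>+\<close> telescope for functions with the
invariance properties \<open>strict_lower A + shift_adj (strict_lower B) = 0\<close> and \<open>shift (strict_upper P) + strict_upper Q = 0\<close>.\<close>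

lemma rplus_off_difference:
  assumes AB: "strict_lower n A = - shift_adj n (strict_lower n B)" and PQ: "strict_upper n Q = - shift n (strict_upper n P)"
    and AB': "strict_lower n A' = - shift_adj n (strict_lower n B')" and PQ': "strict_upper n Q' = - shift n (strict_upper n P')"
    and col: "\<And>i. B i (n - 1) = 0" and tr: "pairing n A B' = pairing n P Q'"
  shows "pairing n (rplus_off n (A + B)) (A' + B') - pairing n (rplus_off n (P + Q)) (P' + Q')
    = pairing n Q (shift n P') - pairing n (strict_upper n P) (P' + shift_adj n Q') - pairing n (strict_upper n Q) (Q' + shift n P') - pairing n B (shift n A')
      + diag_pairing n P Q' - diag_pairing n Q (shift n P') - diag_pairing n A B' + diag_pairing n B (shift n A')"
proof -
  have L: "strict_lower n (A + B) = strict_lower n B - shift_adj n (strict_lower n B)" "strict_lower n (A' + B') = strict_lower n B' - shift_adj n (strict_lower n B')"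
    by (simp_all add: strict_lower_add AB AB' add.commute)
  have Rr: "strict_upper n (P + Q) = strict_upper n P - shift n (strict_upper n P)" "strict_upper n (P' + Q') = strict_upper n P' - shift n (strict_upper n P')"
    by (simp_all add: strict_upper_add PQ PQ')
  have l: "pairing n (rplus_off n (A + B)) (A' + B') = pairing n (strict_upper n (A + B)) B' - pairing n (shift_adj n (strict_lower n B)) (A' + B')"
    unfolding pairing_rplus_off pairing_shift_series[OF L(2)] shift_adj_series[OF L(1)] ..
  have r: "pairing n (rplus_off n (P + Q)) (P' + Q') = pairing n (strict_upper n P) (P' + Q') - pairing n (strict_lower n (P + Q)) (shift n P')"
    unfolding pairing_rplus_off shift_series[OF Rr(1)] pairing_shift_adj_series[OF Rr(2)] ..
  have stB: "pairing n (shift_adj n (strict_lower n B)) N = - pairing n (strict_lower n A) N" for N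
    by (simp add: AB pairing_minus_left)
  have shP': "pairing n (strict_lower n N) (shift n P') = - pairing n (strict_lower n N) Q'" for N
    using pairing_strict_lower[of n N "shift n P'"] pairing_strict_lower[of n N Q'] by (simp add: strict_upper_shift PQ' pairing_minus_right)
  have e1: "pairing n (strict_upper n P) (shift_adj n Q') = - pairing n (strict_upper n Q) Q'"
    unfolding pairing_shift[symmetric] by (simp add: PQ pairing_minus_left)
  have e2: "pairing n Q (shift n P') = pairing n (strict_upper n Q) (shift n P') - pairing n (strict_lower n Q) Q' + diag_pairing n Q (shift n P')"
    by (subst pairing_split) (simp add: shP')
  have e3: "pairing n (strict_lower n A) A' = - pairing n (strict_lower n B) (shift n A')"
    by (simp add: AB pairing_minus_left pairing_shift_adj)
  have e4: "pairing n B (shift n A') = pairing n (strict_upper n B) (shift n A') + pairing n (strict_lower n B) (shift n A') + diag_pairing n B (shift n A')"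
    by (rule pairing_split)
  have e5: "pairing n (strict_upper n B) (shift n A') = - pairing n (strict_upper n B) B'"
  proof -
    have "pairing n (strict_upper n B) (shift n A') = pairing n (strict_upper n B) (shift n (strict_lower n A'))"
      unfolding strict_lower_shift[symmetric] by (rule pairing_strict_upper)
    also have "\<dots> = - pairing n (strict_upper n B) (shift n (shift_adj n (strict_lower n B')))"
    proof -
      have "shift n (- M) = - shift n M" for M by (simp add: shift_def fun_eq_iff)
      thus ?thesis by (simp add: AB' pairing_minus_right)
    qed
    \<comment> \<open>\<open>shift\<close> undoes \<open>shift_adj\<close> except in the last row
      and column. On the strictly upper support this leaves only \<open>j = n - 1\<close>, where
      \<open>B\<close> vanishes.\<close>
    also have "pairing n (strict_upper n B) (shift n (shift_adj n (strict_lower n B'))) = pairing n (strict_upper n B) (strict_lower n B')"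
      unfolding pairing_def
    proof (intro sum.cong refl)
      fix i j
      show "strict_upper n B i j * shift n (shift_adj n (strict_lower n B')) j i = strict_upper n B i j * strict_lower n B' j i"
      proof (cases "j = n - 1")
        case True thus ?thesis using col by (simp add: strict_upper_def)
      next
        case False thus ?thesis by (auto simp: strict_upper_def shift_def shift_adj_def)
      qed
    qed
    finally show ?thesis unfolding pairing_strict_upper[symmetric] .
  qed
  have e6: "pairing n A B' = pairing n (strict_upper n A) B' + pairing n (strict_lower n A) B' + diag_pairing n A B'" by (rule pairing_split)
  have e7: "pairing n P Q' = pairing n (strict_upper n P) Q' + pairing n (strict_lower n P) Q' + diag_pairing n P Q'" by (rule pairing_split)
  \<comment> \<open>The only place where the left gradients \<open>A\<close>, \<open>B'\<close> meet
    the right gradients \<open>P\<close>, \<open>Q'\<close>: cyclicity of the trace.\<close>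
  have e8: "pairing n (strict_lower n P) Q' = pairing n (strict_upper n A) B' + pairing n (strict_lower n A) B' + diag_pairing n A B' - pairing n (strict_upper n P) Q' - diag_pairing n P Q'"
    using e6 e7 tr by (simp add: eq_diff_eq algebra_simps)
  show ?thesis
    unfolding l r strict_upper_add strict_lower_add
    by (simp add: shP' pairing_linear stB e1 e2 e3 e4 e5 e8)
qed

section \<open>The Cartan part\<close>

definition dot :: "nat \<Rightarrow> (nat \<Rightarrow> complex) \<Rightarrow> (nat \<Rightarrow> complex) \<Rightarrow> complex" where
  "dot n u v = (\<Sum>i<n. u i * v i)"

definition vshift :: "nat \<Rightarrow> (nat \<Rightarrow> complex) \<Rightarrow> nat \<Rightarrow> complex" where
  "vshift n v = (\<lambda>i. if i + 1 < n then v (i + 1) else 0)"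

definition vshift_adj :: "nat \<Rightarrow> (nat \<Rightarrow> complex) \<Rightarrow> nat \<Rightarrow> complex" where
  "vshift_adj n v = (\<lambda>i. if 0 < i \<and> i < n then v (i - 1) else 0)"

definition scale :: "complex \<Rightarrow> (nat \<Rightarrow> complex) \<Rightarrow> nat \<Rightarrow> complex" where
  "scale c v = (\<lambda>i. c * v i)"

definition centred :: "nat \<Rightarrow> (nat \<Rightarrow> complex) \<Rightarrow> nat \<Rightarrow> complex" where
  "centred n v = (\<lambda>i. v i - (\<Sum>j<n. v j) / of_nat n)"

definition e_vec :: "nat \<Rightarrow> nat \<Rightarrow> complex" where
  "e_vec k = (\<lambda>i. if i = k then 1 else 0)"

lemma dot_linear:
  "dot n (u + v) z = dot n u z + dot n v z" "dot n (u - v) z = dot n u z - dot n v z"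
  "dot n (- u) z = - dot n u z" "dot n (scale c u) z = c * dot n u z"
  "dot n z (u + v) = dot n z u + dot n z v" "dot n z (u - v) = dot n z u - dot n z v"
  "dot n z (- u) = - dot n z u" "dot n z (scale c u) = c * dot n z u"
  by (simp_all add: dot_def scale_def sum.distrib sum_subtractf sum_negf sum_distrib_left algebra_simps)

lemma dot_cong: "(\<And>i. i < n \<Longrightarrow> u i = u' i) \<Longrightarrow> (\<And>i. i < n \<Longrightarrow> v i = v' i) \<Longrightarrow> dot n u v = dot n u' v'"
  unfolding dot_def by (intro sum.cong) auto

lemma dot_commute: "dot n u v = dot n v u"
  by (simp add: dot_def mult.commute)

lemma dot_vshift: "dot n (vshift n u) v = dot n u (vshift_adj n v)"
proof (cases n)
  case (Suc n')
  have "dot n (vshift n u) v = (\<Sum>i<n'. u (Suc i) * v i)"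
    unfolding dot_def vshift_def Suc by simp
  also have "\<dots> = dot n u (vshift_adj n v)"
    unfolding dot_def vshift_adj_def Suc sum.lessThan_Suc_shift by simp
  finally show ?thesis .
qed (simp add: dot_def)

lemma dot_e_vec: "dot n (e_vec k) v = (if k < n then v k else 0)" "dot n v (e_vec k) = (if k < n then v k else 0)"
  by (simp_all add: dot_def e_vec_def if_distrib[of "\<lambda>x. x * _"] if_distrib[of "\<lambda>x. _ * x"] cong: if_cong)

lemma vshift_adj_add: "vshift_adj n (u + v) = vshift_adj n u + vshift_adj n v"
  and vshift_adj_scale: "vshift_adj n (scale c u) = scale c (vshift_adj n u)"
  and vshift_add: "vshift n (u + v) = vshift n u + vshift n v"
  and vshift_scale: "vshift n (scale c u) = scale c (vshift n u)"
  by (auto simp: vshift_adj_def vshift_def scale_def fun_eq_iff)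

lemma dot_centred: "(\<Sum>i<n. v i) = 0 \<Longrightarrow> dot n (centred n u) v = dot n u v"
  by (simp add: dot_def centred_def algebra_simps sum_subtractf sum_distrib_right[symmetric] sum_divide_distrib[symmetric])

lemma sum_centred: "n > 0 \<Longrightarrow> (\<Sum>i<n. centred n v i) = 0"
  by (simp add: centred_def sum_subtractf)

lemma centred_add: "centred n (u + v) = centred n u + centred n v"
  and centred_scale: "centred n (scale c u) = scale c (centred n u)"
  by (simp_all add: centred_def scale_def fun_eq_iff sum.distrib add_divide_distrib sum_distrib_left[symmetric] algebra_simps)

lemma centred_id: "(\<Sum>i<n. v i) = 0 \<Longrightarrow> centred n v = v"
  by (simp add: centred_def)

lemma centred_cong: "(\<And>i. i < n \<Longrightarrow> u i = v i) \<Longrightarrow> i < n \<Longrightarrow> centred n u i = centred n v i"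
proof -
  assume "\<And>i. i < n \<Longrightarrow> u i = v i" "i < n"
  moreover from this(1) have "(\<Sum>j<n. u j) = (\<Sum>j<n. v j)" by (intro sum.cong) auto
  ultimately show ?thesis by (simp add: centred_def)
qed

text \<open>Vectors of sum zero stand for the Cartan subalgebra, outside of which nothing is known
  about \<open>R0\<close>; those with \<open>h 0 = 0\<close> in addition stand for the span of the
  coroots of \<open>\<Gamma>\<^sub>1\<close>.\<close>

definition R0_vec :: "nat \<Rightarrow> ((nat \<Rightarrow> complex) \<Rightarrow> nat \<Rightarrow> complex) \<Rightarrow> bool" where
  "R0_vec n \<rho> \<longleftrightarrow>
     (\<forall>u v. (\<forall>i<n. u i = v i) \<longrightarrow> (\<forall>i<n. \<rho> u i = \<rho> v i)) \<and>
     (\<forall>u v. sum u {..<n} = 0 \<longrightarrow> sum v {..<n} = 0 \<longrightarrow> (\<forall>i<n. \<rho> (u + v) i = \<rho> u i + \<rho> v i)) \<and>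
     (\<forall>c u. sum u {..<n} = 0 \<longrightarrow> (\<forall>i<n. \<rho> (scale c u) i = c * \<rho> u i)) \<and>
     (\<forall>u v. sum u {..<n} = 0 \<longrightarrow> sum v {..<n} = 0 \<longrightarrow> dot n (\<rho> u) v + dot n u (\<rho> v) = dot n u v) \<and>
     (\<forall>h. h 0 = 0 \<longrightarrow> sum h {..<n} = 0 \<longrightarrow> (\<forall>i<n. \<rho> (h - vshift n h) i = h i))"

text \<open>The diagonals of \<open>A\<close>, \<open>B\<close>, \<open>P\<close>, \<open>Q\<close> for a function with value \<open>f\<close>; the constants
\<open>c\<close>, \<open>r\<close>, \<open>\<beta>\<close>, \<open>\<pi>\<close> are its weights under the torus actions.\<close>

definition diag_weights :: "nat \<Rightarrow> (nat \<Rightarrow> complex) \<Rightarrow> (nat \<Rightarrow> complex) \<Rightarrow> complex \<Rightarrow> complex \<Rightarrow> complex \<Rightarrow>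
    (nat \<Rightarrow> complex) \<Rightarrow> (nat \<Rightarrow> complex) \<Rightarrow> (nat \<Rightarrow> complex) \<Rightarrow> (nat \<Rightarrow> complex) \<Rightarrow> bool" where
  "diag_weights n c r \<beta> \<pi> f a b p q \<longleftrightarrow>
     a 0 = 0 \<and> b (n - 1) = 0 \<and> (\<forall>i<n - 1. a (i + 1) + b i = f * c i) \<and>
     (\<forall>i<n. q i + vshift n p i = f * r i) \<and> p 0 = f * \<pi> \<and>
     sum b {..<n} = f * \<beta> \<and> sum a {..<n} = sum p {..<n}"

text \<open>Write T for \<open>vshift\<close> and T' for \<open>vshift_adj\<close>. The weights
  allow the splittings b = g + f \<beta> e_0 and p = h + f u, after which the centred sums a + b and
  p + q become f C + (1 - T') g and f D + (1 - T) h with fixed vectors C and D. Here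
  \<open>\<rho>\<close> is known on the second summands: it yields -T' g and h. All terms containing
  g or h then cancel against the explicit dot products, and what remains is a multiple of
  \<open>f * f'\<close>.\<close>

lemma diag_const:
  assumes n: "n \<ge> 2" and \<rho>: "R0_vec n \<rho>"
  shows "\<exists>\<kappa>. \<forall>f a b p q f' a' b' p' q'.
     diag_weights n c r \<beta> \<pi> f a b p q \<longrightarrow> diag_weights n c' r' \<beta>' \<pi>' f' a' b' p' q' \<longrightarrow>
     dot n p q' - dot n q (vshift n p') - dot n a b' + dot n b (vshift n a')
       + dot n (\<rho> (centred n (a + b))) (centred n (a' + b')) - dot n (\<rho> (centred n (p + q))) (centred n (p' + q'))
     = \<kappa> * f * f'"
proof -
  note \<rho>_cong = \<rho>[unfolded R0_vec_def, THEN conjunct1, rule_format]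
  note \<rho>_add = \<rho>[unfolded R0_vec_def, THEN conjunct2, THEN conjunct1, rule_format]
  note \<rho>_scale = \<rho>[unfolded R0_vec_def, THEN conjunct2, THEN conjunct2, THEN conjunct1, rule_format]
  note \<rho>_adj = \<rho>[unfolded R0_vec_def, THEN conjunct2, THEN conjunct2, THEN conjunct2, THEN conjunct1, rule_format]
  note \<rho>_h = \<rho>[unfolded R0_vec_def, THEN conjunct2, THEN conjunct2, THEN conjunct2, THEN conjunct2, rule_format]
  have sum_vshift_adj: "sum (vshift_adj n v) {..<n} = sum v {..<n} - v (n - 1)" for v
  proof -
    obtain n' where n': "n = Suc n'" using n by (cases n) auto
    have "sum (vshift_adj n v) {..<n} = sum v {..<n'}"
      unfolding n' sum.lessThan_Suc_shift by (simp add: vshift_adj_def)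
    thus ?thesis by (simp add: n')
  qed
  have sum_vshift: "sum (vshift n v) {..<n} = sum v {..<n} - v 0" for v
  proof -
    obtain n' where n': "n = Suc n'" using n by (cases n) auto
    have "sum (vshift n v) {..<n} = (\<Sum>i<n'. v (Suc i))"
      unfolding n' by (simp add: vshift_def)
    thus ?thesis unfolding n' sum.lessThan_Suc_shift by simp
  qed
  have vshift_vshift_adj: "vshift n (vshift_adj n g) i = (if i + 1 < n then g i else 0)" for g i
    by (simp add: vshift_def vshift_adj_def)
  \<comment> \<open>(1 - T') g = -(1 - T)(T' g), since T T' g = g when the last entry of g is
    zero.\<close>
  have \<rho>_g: "\<rho> (g - vshift_adj n g) i = - vshift_adj n g i" if "g (n - 1) = 0" "sum g {..<n} = 0" "i < n" for g i
  proof -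
    have s: "sum (vshift_adj n g) {..<n} = 0" using that sum_vshift_adj by simp
    have s': "sum (vshift_adj n g - vshift n (vshift_adj n g)) {..<n} = 0"
      using s sum_vshift[of "vshift_adj n g"] by (simp add: sum_subtractf vshift_adj_def)
    have "\<rho> (g - vshift_adj n g) i = \<rho> (scale (-1) (vshift_adj n g - vshift n (vshift_adj n g))) i"
    proof (rule \<rho>_cong[OF _ that(3)])
      fix i assume "i < n"
      thus "(g - vshift_adj n g) i = scale (- 1) (vshift_adj n g - vshift n (vshift_adj n g)) i"
        using that(1) by (cases "i = n - 1") (auto simp: scale_def vshift_vshift_adj)
    qed
    also have "\<dots> = - vshift_adj n g i"
      using \<rho>_scale[OF s' that(3), of "-1"] \<rho>_h[of "vshift_adj n g" i] s that(3) by (simp add: vshift_adj_def)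
    finally show ?thesis .
  qed
  \<comment> \<open>The \<beta>-term is (1 - T') e_0. The vector \<open>u\<close> below is chosen
    with first entry \<pi> and with the total that p has up to the factor f, so that h = p - f u
    starts with 0 and has sum zero.\<close>
  define C where "C c \<beta> = (\<lambda>i. if i = 0 then 0 else c (i - 1)) + scale \<beta> (e_vec 0 - e_vec 1)" for c :: "nat \<Rightarrow> complex" and \<beta>
  define u where "u c \<beta> \<pi> = scale \<pi> (e_vec 0) + scale (sum c {..<n - 1} - \<beta> - \<pi>) (e_vec 1)" for c :: "nat \<Rightarrow> complex" and \<beta> \<pi>
  define D where "D c r \<beta> \<pi> = r + (u c \<beta> \<pi> - vshift n (u c \<beta> \<pi>))" for c r :: "nat \<Rightarrow> complex" and \<beta> \<pi>
  have left: "\<exists>g. g (n - 1) = 0 \<and> sum g {..<n} = 0 \<and> (\<forall>i<n. b i = (g + scale (f * \<beta>) (e_vec 0)) i) \<and>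
       (\<forall>i<n. centred n (a + b) i = (scale f (centred n (C c \<beta>)) + (g - vshift_adj n g)) i)"
    if "diag_weights n c r \<beta> \<pi> f a b p q" for c r \<beta> \<pi> f a b p q
  proof -
    note W = that[unfolded diag_weights_def]
    define g where "g = b - scale (f * \<beta>) (e_vec 0)"
    have g1: "g (n - 1) = 0" using W n by (simp add: g_def scale_def e_vec_def)
    have g2: "sum g {..<n} = 0"
    proof -
      have "sum (scale (f * \<beta>) (e_vec 0)) {..<n} = f * \<beta>"
        using n by (simp add: scale_def e_vec_def if_distrib cong: if_cong)
      thus ?thesis using W by (simp add: g_def sum_subtractf)
    qed
    have "(a + b) i = (scale f (C c \<beta>) + (g - vshift_adj n g)) i" if i: "i < n" for i
    proof (cases i)
      case 0
      thus ?thesis using W n by (simp add: C_def scale_def g_def vshift_adj_def e_vec_def)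
    next
      case (Suc j)
      hence "a (Suc j) = f * c j - b j" using W i by (simp add: eq_diff_eq)
      thus ?thesis using i Suc by (simp add: C_def scale_def g_def vshift_adj_def e_vec_def algebra_simps)
    qed
    hence "centred n (a + b) i = centred n (scale f (C c \<beta>) + (g - vshift_adj n g)) i" if "i < n" for i
      using centred_cong[of n "a + b" "scale f (C c \<beta>) + (g - vshift_adj n g)" i] that by blast
    moreover have "centred n (g - vshift_adj n g) = g - vshift_adj n g"
      by (rule centred_id) (use g1 g2 sum_vshift_adj[of g] in \<open>simp add: sum_subtractf\<close>)
    ultimately have "centred n (a + b) i = (scale f (centred n (C c \<beta>)) + (g - vshift_adj n g)) i" if "i < n" for i
      using that by (simp add: centred_add centred_scale)
    moreover have "b = g + scale (f * \<beta>) (e_vec 0)" by (simp add: g_def)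
    ultimately show ?thesis using g1 g2 by (intro exI[of _ g]) auto
  qed
  have right: "\<exists>h. h 0 = 0 \<and> sum h {..<n} = 0 \<and> (\<forall>i<n. p i = (h + scale f (u c \<beta> \<pi>)) i) \<and>
       (\<forall>i<n. centred n (p + q) i = (scale f (centred n (D c r \<beta> \<pi>)) + (h - vshift n h)) i)"
    if "diag_weights n c r \<beta> \<pi> f a b p q" for c r \<beta> \<pi> f a b p q
  proof -
    note W = that[unfolded diag_weights_def]
    define h where "h = p - scale f (u c \<beta> \<pi>)"
    have h1: "h 0 = 0" using W by (simp add: h_def scale_def u_def e_vec_def)
    have "sum p {..<n} = f * (sum c {..<n - 1} - \<beta>)"
    proof -
      obtain n' where n': "n = Suc n'" using n by (cases n) auto
      have "sum a {..<n} = (\<Sum>i<n'. a (Suc i))"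
        unfolding n' sum.lessThan_Suc_shift using W by simp
      also have "\<dots> = (\<Sum>i<n'. f * c i - b i)" using W n' by (intro sum.cong) (auto simp: eq_diff_eq)
      also have "\<dots> = f * sum c {..<n'} - sum b {..<n}"
        using W n' by (simp add: sum_subtractf sum_distrib_left)
      finally have "sum a {..<n} = f * sum c {..<n - 1} - sum b {..<n}" by (simp add: n')
      moreover have "sum a {..<n} = sum p {..<n}" "sum b {..<n} = f * \<beta>" using W by blast+
      ultimately show ?thesis by (simp add: algebra_simps)
    qed
    moreover have "sum (scale f (u c \<beta> \<pi>)) {..<n} = f * (sum c {..<n - 1} - \<beta>)"
    proof -
      have "sum (e_vec j) {..<n} = 1" if "j < n" for j using that by (simp add: e_vec_def)
      moreover have "sum (scale c v) {..<n} = c * sum v {..<n}" for c v by (simp add: scale_def sum_distrib_left)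
      moreover have "sum (v + v') {..<n} = sum v {..<n} + sum v' {..<n}" for v v' :: "nat \<Rightarrow> complex"
        by (simp add: sum.distrib)
      ultimately show ?thesis using n by (simp only: u_def) (simp add: algebra_simps)
    qed
    ultimately have h2: "sum h {..<n} = 0" by (simp add: h_def sum_subtractf)
    have pe: "p = h + scale f (u c \<beta> \<pi>)" by (simp add: h_def)
    have "(p + q) i = (scale f (D c r \<beta> \<pi>) + (h - vshift n h)) i" if i: "i < n" for i
    proof -
      have "q i = f * r i - vshift n p i" using W i by (simp add: eq_diff_eq)
      thus ?thesis unfolding pe vshift_add vshift_scale D_def by (simp add: scale_def algebra_simps)
    qed
    hence "centred n (p + q) i = centred n (scale f (D c r \<beta> \<pi>) + (h - vshift n h)) i" if "i < n" for i
      using centred_cong[of n "p + q" "scale f (D c r \<beta> \<pi>) + (h - vshift n h)" i] that by blast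
    moreover have "centred n (h - vshift n h) = h - vshift n h"
      by (rule centred_id) (use h1 h2 sum_vshift[of h] in \<open>simp add: sum_subtractf\<close>)
    ultimately have "centred n (p + q) i = (scale f (centred n (D c r \<beta> \<pi>)) + (h - vshift n h)) i" if "i < n" for i
      using that by (simp add: centred_add centred_scale)
    thus ?thesis using h1 h2 pe by (intro exI[of _ h]) auto
  qed
  have n0: "n > 0" using n by simp
  let ?C = "centred n (C c \<beta>)" and ?C' = "centred n (C c' \<beta>')" and ?D = "centred n (D c r \<beta> \<pi>)" and ?D' = "centred n (D c' r' \<beta>' \<pi>')"
  let ?u = "u c \<beta> \<pi>" and ?u' = "u c' \<beta>' \<pi>'"
  \<comment> \<open>As \<open>\<rho>\<close> is known on G and G' but not on X, the term with
    \<open>\<rho> X\<close> and G' is turned around by the condition that \<open>\<rho>\<close> plus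
    its adjoint is the identity.\<close>
  have pair: "dot n (\<rho> (scale f X + G)) (scale f' X' + G')
      = f * f' * dot n (\<rho> X) X' + f * (dot n X G' - dot n X (\<rho> G')) + f' * dot n (\<rho> G) X' + dot n (\<rho> G) G'"
    if "sum X {..<n} = 0" "sum G {..<n} = 0" "sum X' {..<n} = 0" "sum G' {..<n} = 0" for f f' X X' G G'
  proof -
    have s: "sum (scale f X) {..<n} = 0" using that(1) by (simp add: scale_def sum_distrib_left[symmetric])
    have 1: "dot n (\<rho> (scale f X + G)) z = dot n (scale f (\<rho> X) + \<rho> G) z" for z
      by (rule dot_cong) (use \<rho>_add[OF s that(2)] \<rho>_scale[OF that(1)] in \<open>simp_all add: scale_def[of f "\<rho> X"]\<close>)
    have 2: "dot n (\<rho> X) G' = dot n X G' - dot n X (\<rho> G')"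
      using \<rho>_adj[OF that(1,4)] by (simp add: eq_diff_eq)
    show ?thesis unfolding 1 dot_linear 2 by (simp add: algebra_simps)
  qed
  show ?thesis
  \<comment> \<open>Two Cartan terms, followed by the explicit dot products evaluated at g = g' = h
    = h' = 0.\<close>
  proof (rule exI[of _ "dot n (\<rho> ?C) ?C' - dot n (\<rho> ?D) ?D' + \<beta> * c' 0 - \<beta> * \<beta>'
       + (dot n ?u r' - dot n ?u (vshift n ?u') - dot n r (vshift n ?u') + dot n (vshift n ?u) (vshift n ?u'))"], intro allI impI)
    fix f a b p q f' a' b' p' q'
    assume W: "diag_weights n c r \<beta> \<pi> f a b p q" and W': "diag_weights n c' r' \<beta>' \<pi>' f' a' b' p' q'"
    obtain g where g: "g (n - 1) = 0" "sum g {..<n} = 0" "\<And>i. i < n \<Longrightarrow> b i = (g + scale (f * \<beta>) (e_vec 0)) i"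
       "\<And>i. i < n \<Longrightarrow> centred n (a + b) i = (scale f ?C + (g - vshift_adj n g)) i" using left[OF W] by blast
    obtain g' where g': "g' (n - 1) = 0" "sum g' {..<n} = 0" "\<And>i. i < n \<Longrightarrow> b' i = (g' + scale (f' * \<beta>') (e_vec 0)) i"
       "\<And>i. i < n \<Longrightarrow> centred n (a' + b') i = (scale f' ?C' + (g' - vshift_adj n g')) i" using left[OF W'] by blast
    obtain h where h: "h 0 = 0" "sum h {..<n} = 0" "\<And>i. i < n \<Longrightarrow> p i = (h + scale f ?u) i"
       "\<And>i. i < n \<Longrightarrow> centred n (p + q) i = (scale f ?D + (h - vshift n h)) i" using right[OF W] by blast
    obtain h' where h': "h' 0 = 0" "sum h' {..<n} = 0" "\<And>i. i < n \<Longrightarrow> p' i = (h' + scale f' ?u') i"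
       "\<And>i. i < n \<Longrightarrow> centred n (p' + q') i = (scale f' ?D' + (h' - vshift n h')) i" using right[OF W'] by blast
    have sG: "sum (g - vshift_adj n g) {..<n} = 0" "sum (g' - vshift_adj n g') {..<n} = 0"
      using g g' sum_vshift_adj[of g] sum_vshift_adj[of g'] by (simp_all add: sum_subtractf)
    have sH: "sum (h - vshift n h) {..<n} = 0" "sum (h' - vshift n h') {..<n} = 0"
      using h h' sum_vshift[of h] sum_vshift[of h'] by (simp_all add: sum_subtractf)
    have sC: "sum (centred n v) {..<n} = 0" for v using sum_centred[OF n0] .
    have \<rho>G: "dot n (\<rho> (g - vshift_adj n g)) z = - dot n (vshift_adj n g) z" for z
      unfolding dot_linear(3)[symmetric] by (rule dot_cong) (simp_all add: \<rho>_g[OF g(1,2)])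
    have \<rho>G': "dot n z (\<rho> (g' - vshift_adj n g')) = - dot n z (vshift_adj n g')" for z
      unfolding dot_linear(7)[symmetric] by (rule dot_cong) (simp_all add: \<rho>_g[OF g'(1,2)])
    have \<rho>H: "dot n (\<rho> (h - vshift n h)) z = dot n h z" for z
      by (rule dot_cong) (simp_all add: \<rho>_h[OF h(1,2)])
    have \<rho>H': "dot n z (\<rho> (h' - vshift n h')) = dot n z h'" for z
      by (rule dot_cong) (simp_all add: \<rho>_h[OF h'(1,2)])
    have Lf: "dot n (\<rho> (centred n (a + b))) (centred n (a' + b'))
       = f * f' * dot n (\<rho> ?C) ?C' + f * (dot n ?C (g' - vshift_adj n g') + dot n ?C (vshift_adj n g'))
         - f' * dot n (vshift_adj n g) ?C' - dot n (vshift_adj n g) (g' - vshift_adj n g')"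
    proof -
      have "dot n (\<rho> (centred n (a + b))) (centred n (a' + b')) = dot n (\<rho> (scale f ?C + (g - vshift_adj n g))) (scale f' ?C' + (g' - vshift_adj n g'))"
        by (rule dot_cong[OF \<rho>_cong]) (use g(4) g'(4) in blast)+
      thus ?thesis unfolding pair[OF sC sG(1) sC sG(2)] \<rho>G \<rho>G' by simp
    qed
    have Rt: "dot n (\<rho> (centred n (p + q))) (centred n (p' + q'))
       = f * f' * dot n (\<rho> ?D) ?D' + f * (dot n ?D (h' - vshift n h') - dot n ?D h')
         + f' * dot n h ?D' + dot n h (h' - vshift n h')"
    proof -
      have "dot n (\<rho> (centred n (p + q))) (centred n (p' + q')) = dot n (\<rho> (scale f ?D + (h - vshift n h))) (scale f' ?D' + (h' - vshift n h'))"
        by (rule dot_cong[OF \<rho>_cong]) (use h(4) h'(4) in blast)+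
      thus ?thesis unfolding pair[OF sC sH(1) sC sH(2)] \<rho>H \<rho>H' by simp
    qed
    show "dot n p q' - dot n q (vshift n p') - dot n a b' + dot n b (vshift n a')
       + dot n (\<rho> (centred n (a + b))) (centred n (a' + b')) - dot n (\<rho> (centred n (p + q))) (centred n (p' + q'))
     = (dot n (\<rho> ?C) ?C' - dot n (\<rho> ?D) ?D' + \<beta> * c' 0 - \<beta> * \<beta>'
       + (dot n ?u r' - dot n ?u (vshift n ?u') - dot n r (vshift n ?u') + dot n (vshift n ?u) (vshift n ?u'))) * f * f'"
    proof -
      let ?b = "g + scale (f * \<beta>) (e_vec 0)" and ?b' = "g' + scale (f' * \<beta>') (e_vec 0)"
      let ?p = "h + scale f ?u" and ?p' = "h' + scale f' ?u'"
      note V = W[unfolded diag_weights_def] and V' = W'[unfolded diag_weights_def]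
      define cp where "cp c = (\<lambda>i. if i = 0 then 0 else c (i - 1))" for c :: "nat \<Rightarrow> complex"
      have C_cp: "C c \<beta> = cp c + scale \<beta> (e_vec 0 - e_vec 1)" for c \<beta> by (simp add: C_def cp_def)
      have vshift_adj_e: "vshift_adj n (e_vec 0) = e_vec 1" using n by (auto simp: vshift_adj_def e_vec_def fun_eq_iff)
      have ab: "dot n a b' = dot n (scale f (cp c) - vshift_adj n ?b) ?b'"
      proof (rule dot_cong)
        fix i assume i: "i < n"
        show "b' i = ?b' i" using g'(3)[OF i] .
        show "a i = (scale f (cp c) - vshift_adj n ?b) i"
        proof (cases i)
          case 0 thus ?thesis using V by (simp add: scale_def cp_def vshift_adj_def)
        next
          case (Suc j)
          hence "a (Suc j) = f * c j - b j" using V i by (simp add: eq_diff_eq)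
          thus ?thesis using Suc i g(3)[of j] by (simp add: scale_def cp_def vshift_adj_def)
        qed
      qed
      have ba: "dot n b (vshift n a') = dot n ?b (scale f' c' - ?b')"
        unfolding dot_def
      proof (intro sum.cong refl)
        fix i assume "i \<in> {..<n}"
        hence i: "i < n" by simp
        show "b i * vshift n a' i = ?b i * (scale f' c' - ?b') i"
        proof (cases "i = n - 1")
          case True
          hence "?b i = 0" "b i = 0" using V g(3)[OF i] by auto
          thus ?thesis by simp
        next
          case False
          hence "i < n - 1" using i by simp
          have "a' (Suc i) = f' * c' i - b' i" using \<open>i < n - 1\<close> V' by (simp add: eq_diff_eq)
          moreover have "Suc i < n" using \<open>i < n - 1\<close> by simp
          ultimately show ?thesis using g(3)[OF i] g'(3)[OF i] by (simp add: scale_def vshift_def)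
        qed
      qed
      have pq: "dot n p q' = dot n ?p (scale f' r' - vshift n ?p')"
      proof (rule dot_cong)
        fix i assume i: "i < n"
        show "p i = ?p i" using h(3)[OF i] .
        have "vshift n p' i = vshift n ?p' i" using h'(3)[of "i + 1"] by (simp add: vshift_def)
        moreover have "q' i + vshift n p' i = f' * r' i" using V' i by blast
        ultimately show "q' i = (scale f' r' - vshift n ?p') i" by (simp add: scale_def eq_diff_eq)
      qed
      have qp: "dot n q (vshift n p') = dot n (scale f r - vshift n ?p) (vshift n ?p')"
      proof (rule dot_cong)
        fix i assume i: "i < n"
        show "vshift n p' i = vshift n ?p' i" using h'(3)[of "i + 1"] by (simp add: vshift_def)
        have "vshift n p i = vshift n ?p i" using h(3)[of "i + 1"] by (simp add: vshift_def)
        moreover have "q i + vshift n p i = f * r i" using V i by blast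
        ultimately show "q i = (scale f r - vshift n ?p) i" by (simp add: scale_def eq_diff_eq)
      qed
      have sums: "sum (vshift_adj n g) {..<n} = 0" "sum (vshift n h') {..<n} = 0"
        using g(1,2) h'(1,2) by (simp_all add: sum_vshift_adj sum_vshift)
      have Cg: "dot n ?C g' = dot n (cp c) g' + \<beta> * (g' 0 - g' 1)"
        unfolding dot_centred[OF g'(2)] C_cp dot_linear using n by (simp add: dot_e_vec)
      have cpg: "dot n (vshift_adj n g) (cp c') = dot n g c'"
      proof -
        have "dot n (vshift n (cp c')) g = dot n g c'"
          unfolding dot_def
        proof (intro sum.cong refl)
          fix i assume "i \<in> {..<n}"
          thus "vshift n (cp c') i * g i = g i * c' i"
            using g(1) by (cases "i = n - 1") (auto simp: vshift_def cp_def)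
        qed
        thus ?thesis by (simp add: dot_vshift dot_commute[of n "cp c'"])
      qed
      have gC: "dot n (vshift_adj n g) ?C' = dot n g c' - \<beta>' * g 0"
      proof -
        have "dot n (vshift_adj n g) ?C' = dot n (vshift_adj n g) (C c' \<beta>')"
          using dot_centred[OF sums(1), of "C c' \<beta>'"] by (simp only: dot_commute)
        thus ?thesis unfolding C_cp dot_linear cpg using n by (simp add: dot_e_vec vshift_adj_def)
      qed
      have gg: "dot n (vshift_adj n g) (vshift_adj n g') = dot n g g'"
      proof -
        have "vshift n (vshift_adj n g) i * g' i = g i * g' i" if "i < n" for i
          using g(1) that by (cases "i = n - 1") (auto simp: vshift_vshift_adj)
        hence "dot n (vshift n (vshift_adj n g)) g' = dot n g g'"
          unfolding dot_def by (intro sum.cong) auto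
        thus ?thesis by (simp add: dot_vshift)
      qed
      have hh: "dot n (vshift n h) (vshift n v) = dot n h v" for v
        unfolding dot_vshift unfolding dot_def
      proof (intro sum.cong refl)
        fix i assume "i \<in> {..<n}"
        thus "h i * vshift_adj n (vshift n v) i = h i * v i"
          using h(1) by (cases "i = 0") (auto simp: vshift_adj_def vshift_def)
      qed
      have Dh2: "dot n h ?D' = dot n h (D c' r' \<beta>' \<pi>')"
        using dot_centred[OF h(2), of "D c' r' \<beta>' \<pi>'"] by (simp only: dot_commute)
      have Dh': "dot n ?D h' = dot n (D c r \<beta> \<pi>) h'" "dot n ?D (vshift n h') = dot n (D c r \<beta> \<pi>) (vshift n h')"
        by (simp_all add: dot_centred[OF h'(2)] dot_centred[OF sums(2)])
      have at0: "cp c 0 = 0" "vshift_adj n g 0 = 0" "e_vec (Suc 0) 0 = 0" "e_vec 0 0 = 1" for c g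
        by (simp_all add: cp_def vshift_adj_def e_vec_def)
      have left_eq: "dot n b (vshift n a') - dot n a b' + dot n (\<rho> (centred n (a + b))) (centred n (a' + b'))
         = f * f' * (dot n (\<rho> ?C) ?C' + \<beta> * c' 0 - \<beta> * \<beta>')"
        unfolding ab ba Lf dot_linear vshift_adj_add vshift_adj_scale vshift_adj_e Cg gC gg
        using n by (simp add: dot_e_vec at0 algebra_simps)
      have right_eq: "dot n p q' - dot n q (vshift n p') - dot n (\<rho> (centred n (p + q))) (centred n (p' + q'))
         = f * f' * (dot n ?u r' - dot n ?u (vshift n ?u') - dot n r (vshift n ?u') + dot n (vshift n ?u) (vshift n ?u')
             - dot n (\<rho> ?D) ?D')"
        unfolding pq qp Rt dot_linear vshift_add vshift_scale Dh' Dh2 hh unfolding D_def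
        by (simp add: dot_linear hh algebra_simps)
      have "x1 - x2 - x3 + x4 + x5 - x6 = (x4 - x3 + x5) + (x1 - x2 - x6)" for x1 x2 x3 x4 x5 x6 :: complex
        by simp
      thus ?thesis by (rule trans) (simp only: left_eq right_eq, simp add: algebra_simps)
    qed
  qed
qed

section \<open>The periodic staircase matrix\<close>

text \<open>Row \<open>(t, r)\<close> of the staircase, numbered \<open>t (n - 1) + r\<close>, is row \<open>r\<close> of \<open>x\<close> followed by row \<open>r + 1\<close>
of \<open>x\<close>, starting at column \<open>t (n + 1) + 1\<close>: the zero columns of \<open>calX\<close> and \<open>calY\<close> fall outside
this window. The matrix is infinite in both directions, so it is invariant under block shifts.\<close>

definition wrow :: "nat \<Rightarrow> (nat \<Rightarrow> nat \<Rightarrow> complex) \<Rightarrow> nat \<Rightarrow> nat \<Rightarrow> complex" where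
  "wrow n x r l = (if l < n then x r l else x (r + 1) (l - n))"

definition stair :: "nat \<Rightarrow> (nat \<Rightarrow> nat \<Rightarrow> complex) \<Rightarrow> int \<Rightarrow> int \<Rightarrow> complex" where
  "stair n x a b =
     (let c = b - (a div (int n - 1)) * (int n + 1) - 1
      in if 0 \<le> c \<and> c < 2 * int n then wrow n x (nat (a mod (int n - 1))) (nat c) else 0)"

locale staircase =
  fixes n k :: nat and x :: "nat \<Rightarrow> nat \<Rightarrow> complex" and m w rows cols :: int
  assumes n2: "n \<ge> 2"
  defines "m \<equiv> int n - 1" and "w \<equiv> int n + 1"
    and "rows \<equiv> int k * m" and "cols \<equiv> (int k + 1) * w"
begin

abbreviation U :: "int \<Rightarrow> int \<Rightarrow> complex" where "U \<equiv> stair n x"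

lemma m_pos: "m > 0" using n2 by (simp add: m_def)

lemma w_pos: "w > 0" by (simp add: w_def)

lemma block_bounds: "(a div m) * m \<le> a" "a < (a div m + 1) * m"
proof -
  have "a = (a div m) * m + a mod m" "0 \<le> a mod m" "a mod m < m" using m_pos by simp_all
  thus "(a div m) * m \<le> a" "a < (a div m + 1) * m" unfolding distrib_right by linarith+
qed

lemma U_shift: "U (a + s * m) (b + s * w) = U a b"
proof -
  have 1: "(a + s * m) div m = a div m + s" "(a + s * m) mod m = a mod m"
    using m_pos by simp_all
  show ?thesis
    unfolding stair_def m_def[symmetric] w_def[symmetric] 1 by (simp add: algebra_simps)
qed

lemma U_shift_neg: "U a (b - s * w) = U (a + s * m) b"
  using U_shift[of a s "b - s * w"] by simp

lemma U_shift_neg': "U (a - s * m) b = U a (b + s * w)"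
  using U_shift[of "a - s * m" s b] by simp

lemma U_window:
  assumes "U a b \<noteq> 0"
  shows "(a div m) * w + 1 \<le> b" "b \<le> (a div m) * w + 2 * int n"
  using assms unfolding stair_def m_def[symmetric] w_def[symmetric]
  by (auto simp: Let_def split: if_splits)

lemma U_row_block_le:
  assumes "U a b \<noteq> 0" "t * m \<le> a" shows "t * w + 1 \<le> b"
proof -
  have "t \<le> a div m" using zdiv_mono1[OF assms(2) m_pos] m_pos by simp
  hence "t * w \<le> (a div m) * w" using w_pos by simp
  thus ?thesis using U_window[OF assms(1)] by simp
qed

lemma U_row_block_ge:
  assumes "U a b \<noteq> 0" "a < (t + 1) * m" shows "b \<le> t * w + 2 * int n"
proof -
  have "(a div m) * m < (t + 1) * m" using assms(2) block_bounds(1)[of a] by linarith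
  hence "a div m \<le> t" using m_pos by simp
  hence "(a div m) * w \<le> t * w" using w_pos by simp
  thus ?thesis using U_window[OF assms(1)] by simp
qed

text \<open>The windows of the rows are intervals that move to the right; hence outside the window
of row \<open>a\<close> the two comparisons agree on the support, and the bracket only sees entries of
the pencil.\<close>

lemma U_comparison:
  assumes "U a b = 0 \<and> \<not> ((a div m) * w + 1 \<le> b \<and> b \<le> (a div m) * w + 2 * int n)"
    and "U a d \<noteq> 0" "U c b \<noteq> 0"
  shows "c < a \<longleftrightarrow> b < d"
proof (cases "b < (a div m) * w + 1")
  case True
  have "b < d" using True U_window(1)[OF assms(2)] by simp
  moreover have "c < a"
  proof (rule ccontr)
    assume "\<not> c < a"
    hence "(a div m) * m \<le> c" using block_bounds(1)[of a] by linarith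
    from U_row_block_le[OF assms(3) this] True show False by simp
  qed
  ultimately show ?thesis by simp
next
  case False
  hence b: "b > (a div m) * w + 2 * int n" using assms(1) by linarith
  have "\<not> b < d" using b U_window(2)[OF assms(2)] by simp
  moreover have "\<not> c < a"
  proof
    assume "c < a"
    hence "c < (a div m + 1) * m" using block_bounds(2)[of a] by linarith
    from U_row_block_ge[OF assms(3) this] b show False by simp
  qed
  ultimately show ?thesis by simp
qed

text \<open>Here \<open>H\<close> plays the adjugate of the \<open>p \<times> p\<close> submatrix of \<open>U\<close> formed by the last
rows and the columns ending before \<open>e\<close>, and \<open>f\<close> its determinant.\<close>

definition minor_adj :: "int \<Rightarrow> int \<Rightarrow> (int \<Rightarrow> int \<Rightarrow> complex) \<Rightarrow> complex \<Rightarrow> bool" where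
  "minor_adj p e H f \<longleftrightarrow>
     0 \<le> p \<and> p \<le> rows \<and> p \<le> e \<and> e \<le> cols \<and>
     (\<forall>b a. H b a \<noteq> 0 \<longrightarrow> b \<in> {e - p..<e} \<and> a \<in> {rows - p..<rows}) \<and>
     (\<forall>a\<in>{rows - p..<rows}. \<forall>a'\<in>{rows - p..<rows}.
        (\<Sum>b\<in>{0..<cols}. U a b * H b a') = (if a = a' then f else 0)) \<and>
     (\<forall>b\<in>{e - p..<e}. \<forall>b'\<in>{e - p..<e}.
        (\<Sum>a\<in>{0..<rows}. H b a * U a b') = (if b = b' then f else 0))"

definition UH :: "(int \<Rightarrow> int \<Rightarrow> complex) \<Rightarrow> int \<Rightarrow> int \<Rightarrow> complex" where
  "UH H a a' = (\<Sum>b\<in>{0..<cols}. U a b * H b a')"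

definition HU :: "(int \<Rightarrow> int \<Rightarrow> complex) \<Rightarrow> int \<Rightarrow> int \<Rightarrow> complex" where
  "HU H b b' = (\<Sum>a\<in>{0..<rows}. H b a * U a b')"

lemma minor_adjD:
  assumes "minor_adj p e H f"
  shows "0 \<le> p" "p \<le> rows" "p \<le> e" "e \<le> cols"
    and "\<And>b a. H b a \<noteq> 0 \<Longrightarrow> e - p \<le> b \<and> b < e \<and> rows - p \<le> a \<and> a < rows"
    and "\<And>a a'. \<lbrakk>rows - p \<le> a; a < rows; rows - p \<le> a'; a' < rows\<rbrakk>
          \<Longrightarrow> UH H a a' = (if a = a' then f else 0)"
    and "\<And>b b'. \<lbrakk>e - p \<le> b; b < e; e - p \<le> b'; b' < e\<rbrakk>
          \<Longrightarrow> HU H b b' = (if b = b' then f else 0)"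
  using assms unfolding minor_adj_def UH_def HU_def by (auto simp del: minus_apply)

lemma UH_zero:
  assumes "minor_adj p e H f" "\<not> (rows - p \<le> a' \<and> a' < rows)"
  shows "UH H a a' = 0"
  unfolding UH_def using minor_adjD(5)[OF assms(1)] assms(2)
  by (intro sum.neutral) (metis mult_zero_right)

lemma HU_zero:
  assumes "minor_adj p e H f" "\<not> (e - p \<le> b \<and> b < e)"
  shows "HU H b b' = 0"
  unfolding HU_def using minor_adjD(5)[OF assms(1)] assms(2)
  by (intro sum.neutral) (metis mult_zero_left)

text \<open>\<open>UH H a a'\<close> is the minor with row \<open>a'\<close> replaced by row
  \<open>a\<close>. As the minor occupies the last rows, a later row \<open>a < rows\<close> is
  already present in it.\<close>

lemma UH_lower:
  assumes "minor_adj p e H f" "a' \<le> a" "a < rows"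
  shows "UH H a a' = (if a = a' \<and> rows - p \<le> a then f else 0)"
proof (cases "rows - p \<le> a'")
  case True
  thus ?thesis using minor_adjD(6)[OF assms(1), of a a'] assms by auto
next
  case False
  thus ?thesis using UH_zero[OF assms(1), of a' a] by auto
qed

text \<open>The same with columns, but a minor does not reach the last column, so
  \<open>b' < e\<close> is essential. Beyond \<open>e\<close> the vanishing has to come from the
  shape of \<open>U\<close>, and this is where the kinds of minors differ.\<close>

lemma HU_upper:
  assumes "minor_adj p e H f" "b \<le> b'" "b' < e"
  shows "HU H b b' = (if b = b' \<and> e - p \<le> b then f else 0)"
proof (cases "e - p \<le> b")
  case True
  thus ?thesis using minor_adjD(7)[OF assms(1), of b b'] assms by auto
next
  case False
  thus ?thesis using HU_zero[OF assms(1), of b b'] by auto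
qed

text \<open>Rows from \<open>t * m\<close> on have no entries left of \<open>t * w + 1\<close>.
  Hence the sum is that over all columns from \<open>c\<close> on minus that over all rows from
  \<open>t * m\<close> on, and each of these is a sum of diagonal entries of \<open>HU\<close> or
  \<open>UH\<close>, that is, \<open>f\<close> times a number of columns or rows.\<close>

lemma minor_partial_trace:
  assumes "minor_adj p e H f" "c \<le> t * w + 1"
  shows "(\<Sum>b\<in>{0..<cols}. \<Sum>a\<in>{0..<rows}. if c \<le> b \<and> a < t * m then H b a * U a b else 0)
       = f * (of_nat (card ({e - p..<e} \<inter> {c..})) - of_nat (card ({rows - p..<rows} \<inter> {t * m..})))"
proof -
  note D = minor_adjD[OF assms(1)]
  have z: "(if c \<le> b \<and> a < t * m then H b a * U a b else 0)
     = (if c \<le> b then H b a * U a b else 0) - (if t * m \<le> a then U a b * H b a else 0)" for a b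
  proof (cases "U a b = 0")
    case False
    with U_row_block_le[OF False, of t] assms(2) show ?thesis by auto
  qed simp
  have "(\<Sum>b\<in>{0..<cols}. \<Sum>a\<in>{0..<rows}. if c \<le> b \<and> a < t * m then H b a * U a b else 0)
      = (\<Sum>b\<in>{0..<cols}. \<Sum>a\<in>{0..<rows}. (if c \<le> b then H b a * U a b else 0))
        - (\<Sum>b\<in>{0..<cols}. \<Sum>a\<in>{0..<rows}. (if t * m \<le> a then U a b * H b a else 0))"
    by (simp add: z sum_subtractf)
  also have "(\<Sum>b\<in>{0..<cols}. \<Sum>a\<in>{0..<rows}. (if c \<le> b then H b a * U a b else 0))
      = (\<Sum>b\<in>{0..<cols}. if c \<le> b then HU H b b else 0)"
    by (intro sum.cong refl) (simp add: HU_def)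
  also have "\<dots> = (\<Sum>b\<in>{0..<cols}. if b \<in> {e - p..<e} \<inter> {c..} then f else 0)"
  proof (intro sum.cong refl)
    fix b
    show "(if c \<le> b then HU H b b else 0) = (if b \<in> {e - p..<e} \<inter> {c..} then f else 0)"
      using HU_upper[OF assms(1), of b b] HU_zero[OF assms(1), of b b] by auto
  qed
  also have "\<dots> = (\<Sum>b\<in>{0..<cols} \<inter> ({e - p..<e} \<inter> {c..}). f)"
    by (rule sum.inter_restrict[symmetric]) simp
  also have "{0..<cols} \<inter> ({e - p..<e} \<inter> {c..}) = {e - p..<e} \<inter> {c..}"
    using D(3,4) by auto
  also have "(\<Sum>b\<in>{0..<cols}. \<Sum>a\<in>{0..<rows}. (if t * m \<le> a then U a b * H b a else 0))
      = (\<Sum>a\<in>{0..<rows}. if t * m \<le> a then UH H a a else 0)"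
    by (subst sum.swap, intro sum.cong refl) (simp add: UH_def)
  also have "\<dots> = (\<Sum>a\<in>{0..<rows}. if a \<in> {rows - p..<rows} \<inter> {t * m..} then f else 0)"
  proof (intro sum.cong refl)
    fix a
    show "(if t * m \<le> a then UH H a a else 0) = (if a \<in> {rows - p..<rows} \<inter> {t * m..} then f else 0)"
      using UH_lower[OF assms(1), of a a] UH_zero[OF assms(1), of a a] by auto
  qed
  also have "\<dots> = (\<Sum>a\<in>{0..<rows} \<inter> ({rows - p..<rows} \<inter> {t * m..}). f)"
    by (rule sum.inter_restrict[symmetric]) simp
  also have "{0..<rows} \<inter> ({rows - p..<rows} \<inter> {t * m..}) = {rows - p..<rows} \<inter> {t * m..}"
    using D(1,2) by auto
  finally show ?thesis by (simp add: algebra_simps)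
qed

section \<open>The bracket of the periodic matrix and its collapse on two minors\<close>

text \<open>\<open>H b a\<close> and \<open>H' d c\<close> are the derivatives of the two functions
  in the entries at (a, b) and (c, d). The rest is a quadratic bracket of the first entry with the
  translate of the second by \<open>- s\<close> periods: column indices are exchanged, weighted by
  the difference of a row and a column comparison. The range of \<open>s\<close> suffices for all
  pairs of blocks that interact.\<close>

definition toeplitz_sum :: "(int \<Rightarrow> int \<Rightarrow> complex) \<Rightarrow> (int \<Rightarrow> int \<Rightarrow> complex) \<Rightarrow> complex" where
  "toeplitz_sum H H' = (\<Sum>s\<in>{- int k..int k}. \<Sum>a\<in>{0..<rows}. \<Sum>c\<in>{0..<rows}.
     \<Sum>b\<in>{0..<cols}. \<Sum>d\<in>{0..<cols}. H b a * H' d c *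
       (of_bool (c - s * m < a) - of_bool (b < d - s * w)) * U a (d - s * w) * U (c - s * m) b)"

text \<open>The row comparison does not involve the columns, so these are summed first and give
  \<open>UH\<close>; the column comparison leads to \<open>HU\<close> in the same way. Periodicity
  moves the translation onto the other index.\<close>

lemma toeplitz_sum_split:
  "toeplitz_sum H H' = (\<Sum>s\<in>{- int k..int k}.
     (\<Sum>a\<in>{0..<rows}. \<Sum>c\<in>{0..<rows}. of_bool (c - s * m < a) * UH H (c - s * m) a * UH H' (a + s * m) c)
     - (\<Sum>b\<in>{0..<cols}. \<Sum>d\<in>{0..<cols}. of_bool (b < d - s * w) * HU H b (d - s * w) * HU H' d (b + s * w)))"
proof -
  have L: "(\<Sum>b\<in>{0..<cols}. \<Sum>d\<in>{0..<cols}. H b a * H' d c * of_bool (c - s * m < a) * U a (d - s * w) * U (c - s * m) b)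
     = of_bool (c - s * m < a) * UH H (c - s * m) a * UH H' (a + s * m) c" for a c s
    unfolding UH_def U_shift_neg
    by (simp add: sum_product sum_distrib_left sum_distrib_right mult_ac)
  have R: "(\<Sum>a\<in>{0..<rows}. \<Sum>c\<in>{0..<rows}. H b a * H' d c * of_bool (b < d - s * w) * U a (d - s * w) * U (c - s * m) b)
     = of_bool (b < d - s * w) * HU H b (d - s * w) * HU H' d (b + s * w)" for b d s
    unfolding HU_def U_shift_neg'
    by (simp add: sum_product sum_distrib_left sum_distrib_right mult_ac)
  have R': "(\<Sum>a\<in>{0..<rows}. \<Sum>c\<in>{0..<rows}. \<Sum>b\<in>{0..<cols}. \<Sum>d\<in>{0..<cols}. g a b c d)
      = (\<Sum>b\<in>{0..<cols}. \<Sum>d\<in>{0..<cols}. \<Sum>a\<in>{0..<rows}. \<Sum>c\<in>{0..<rows}. g a b c d)"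
    for g :: "int \<Rightarrow> int \<Rightarrow> int \<Rightarrow> int \<Rightarrow> complex"
  proof -
    have "(\<Sum>a\<in>{0..<rows}. \<Sum>c\<in>{0..<rows}. \<Sum>b\<in>{0..<cols}. \<Sum>d\<in>{0..<cols}. g a b c d)
      = (\<Sum>a\<in>{0..<rows}. \<Sum>b\<in>{0..<cols}. \<Sum>c\<in>{0..<rows}. \<Sum>d\<in>{0..<cols}. g a b c d)"
      by (intro sum.cong refl sum.swap)
    also have "\<dots> = (\<Sum>b\<in>{0..<cols}. \<Sum>a\<in>{0..<rows}. \<Sum>d\<in>{0..<cols}. \<Sum>c\<in>{0..<rows}. g a b c d)"
      by (subst sum.swap) (intro sum.cong refl sum.swap)
    also have "\<dots> = (\<Sum>b\<in>{0..<cols}. \<Sum>d\<in>{0..<cols}. \<Sum>a\<in>{0..<rows}. \<Sum>c\<in>{0..<rows}. g a b c d)"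
      by (intro sum.cong refl sum.swap)
    finally show ?thesis .
  qed
  show ?thesis
    unfolding toeplitz_sum_def
  proof (intro sum.cong refl, goal_cases)
    case (1 s)
    show ?case
      unfolding L[symmetric] R[symmetric] R'[symmetric]
      by (simp add: sum_subtractf[symmetric] algebra_simps)
  qed
qed

text \<open>Rows of the periodic continuation below \<open>rows\<close> start at column
  \<open>k * w + 1\<close> or later, to the right of all columns of the minor.\<close>

lemma UH_strictly_lower:
  assumes "minor_adj p e H f" "e \<le> int k * w + 1" "a' < a"
  shows "UH H a a' = 0"
proof (cases "a < rows")
  case True
  thus ?thesis using UH_lower[OF assms(1), of a' a] assms(3) by simp
next
  case False
  have "U a b * H b a' = 0" for b
  proof (rule ccontr)
    assume "U a b * H b a' \<noteq> 0"
    hence "U a b \<noteq> 0" "H b a' \<noteq> 0" by auto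
    with U_row_block_le[of a b "int k"] minor_adjD(5)[OF assms(1), of b a'] assms(2) False
    show False by (simp add: rows_def)
  qed
  thus ?thesis unfolding UH_def by (intro sum.neutral ballI)
qed

text \<open>The comparison reads \<open>c < a + s * m\<close>, which puts the second factor strictly
  below the diagonal.\<close>

lemma toeplitz_left_zero:
  assumes "minor_adj p' e' H' f'" "e' \<le> int k * w + 1"
  shows "of_bool (c - s * m < a) * UH H (c - s * m) a * UH H' (a + s * m) c = 0"
  using UH_strictly_lower[OF assms, of c "a + s * m"] by auto

text \<open>For two \<theta>'s, whose columns lie too far right for
  \<open>UH_strictly_lower\<close>. If \<open>s \<le> 0\<close>, row \<open>a + s * m\<close> stays
  among the actual rows and triangularity for \<open>H'\<close> applies. If \<open>s > 0\<close>,
  row \<open>c - s * m\<close> lies above the last block, so its window ends before column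
  \<open>k * w\<close>, where the columns of the first minor begin.\<close>

lemma toeplitz_left_zero_last_block:
  assumes "minor_adj p e H f" "minor_adj p' e' H' f'"
    and "p \<le> m" "p' \<le> m" "e - p \<ge> int k * w" 
  shows "of_bool (c - s * m < a) * UH H (c - s * m) a * UH H' (a + s * m) c = 0"
proof (rule ccontr)
  assume nz: "\<not> ?thesis"
  hence lt: "c - s * m < a" and 1: "UH H (c - s * m) a \<noteq> 0" and 2: "UH H' (a + s * m) c \<noteq> 0"
    by auto
  have a: "rows - m \<le> a" "a < rows" using 1 UH_zero[OF assms(1), of a] assms(3) by force+
  have c: "rows - m \<le> c" "c < rows" using 2 UH_zero[OF assms(2), of c] assms(4) by force+
  show False
  proof (cases "s \<le> 0")
    case True
    hence "s * m \<le> 0" using m_pos by (simp add: mult_le_0_iff)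
    hence "a + s * m < rows" using a by linarith
    with UH_lower[OF assms(2), of c "a + s * m"] lt 2 show False by auto
  next
    case False
    hence s: "m \<le> s * m" using m_pos by simp
    have "U (c - s * m) b * H b a = 0" for b
    proof (rule ccontr)
      assume "U (c - s * m) b * H b a \<noteq> 0"
      hence nz: "U (c - s * m) b \<noteq> 0" "H b a \<noteq> 0" by auto
      have "(int k - 2 + 1) * m = rows - m" by (simp add: rows_def algebra_simps)
      hence "c - s * m < (int k - 2 + 1) * m" using c s by linarith
      from U_row_block_ge[OF nz(1) this] have "b \<le> (int k - 2) * w + 2 * int n" .
      moreover have "int k * w \<le> b" using minor_adjD(5)[OF assms(1) nz(2)] assms(5) by simp
      ultimately show False by (simp add: w_def algebra_simps)
    qed
    hence "UH H (c - s * m) a = 0" unfolding UH_def by (intro sum.neutral ballI)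
    with 1 show False by simp
  qed
qed

text \<open>This \<open>e\<close> is exactly where the window of the last block of rows ends: no row
  before \<open>rows\<close> has an entry in column \<open>e\<close> or beyond.\<close>

lemma HU_strictly_upper_last_block:
  assumes "minor_adj p e H f" "e = int k * w + int n" "b < b'"
  shows "HU H b b' = 0"
proof (cases "b' < e")
  case True
  thus ?thesis using HU_upper[OF assms(1), of b b'] assms(3) by simp
next
  case False
  have "H b a * U a b' = 0" for a
  proof (rule ccontr)
    assume "H b a * U a b' \<noteq> 0"
    hence nz: "U a b' \<noteq> 0" "H b a \<noteq> 0" by auto
    have "a < (int k - 1 + 1) * m" using minor_adjD(5)[OF assms(1) nz(2)] by (simp add: rows_def)
    from U_row_block_ge[OF nz(1) this] False assms(2) show False
      by (simp add: w_def algebra_simps)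
  qed
  thus ?thesis unfolding HU_def by (intro sum.neutral ballI)
qed

text \<open>The comparison \<open>b < d - s * w\<close> never cuts a sum in two. If
  \<open>d - s * w < e\<close>, triangularity of \<open>HU H\<close> leaves nothing; otherwise all
  columns of the first minor lie left of \<open>d - s * w\<close> and the comparison holds by
  itself. The sum over \<open>b\<close> is then free and produces \<open>UH H\<close>, which acts as
  \<open>f\<close> on the rows of the second minor because \<open>p' \<le> p\<close>. A partial
  trace of the second minor remains.\<close>

lemma toeplitz_right_sum:
  assumes F: "minor_adj p e H f" and e: "int k * w \<le> e" "e \<le> int k * w + 1"
    and G: "minor_adj p' e' H' f'" and e': "e' \<le> int k * w + 1" and pp: "p' \<le> p"
  shows "(\<Sum>b\<in>{0..<cols}. \<Sum>d\<in>{0..<cols}. of_bool (b < d - s * w) * HU H b (d - s * w) * HU H' d (b + s * w))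
    = (if s \<le> 0 then f * f' *
         (of_nat (card ({e' - p'..<e'} \<inter> {e + s * w..})) - of_nat (card ({rows - p'..<rows} \<inter> {(int k + s) * m..})))
       else 0)"
proof -
  note DF = minor_adjD[OF F] and DG = minor_adjD[OF G]
  have inner: "(\<Sum>b\<in>{0..<cols}. of_bool (b < d - s * w) * HU H b (d - s * w) * HU H' d (b + s * w))
     = (\<Sum>a\<in>{0..<rows}. if s \<le> 0 \<and> e + s * w \<le> d \<and> a < (int k + s) * m then f * (H' d a * U a d) else 0)" for d
  proof (cases "e' - p' \<le> d \<and> d < e'")
    case False
    hence "HU H' d b = 0" for b using HU_zero[OF G] by blast
    moreover have "H' d a = 0" for a using DG(5)[of d a] False by blast
    ultimately show ?thesis by (simp cong: if_cong)
  next
    case d: True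
    show ?thesis
    proof (cases "e + s * w \<le> d")
      case False
      hence z: "of_bool (b < d - s * w) * HU H b (d - s * w) = 0" for b
        using HU_upper[OF F, of b "d - s * w"] by auto
      have "(\<Sum>b\<in>{0..<cols}. of_bool (b < d - s * w) * HU H b (d - s * w) * HU H' d (b + s * w)) = 0"
        by (simp only: z mult_zero_left sum.neutral_const)
      thus ?thesis using False by simp
    next
      case ed: True
      have s: "s \<le> 0"
      proof (rule ccontr)
        assume "\<not> s \<le> 0"
        hence "w \<le> s * w" using w_pos by simp
        with ed d e e' w_pos show False by linarith
      qed
      have sm: "s * m \<le> 0" using s m_pos by (simp add: mult_le_0_iff)
      have "(\<Sum>b\<in>{0..<cols}. of_bool (b < d - s * w) * HU H b (d - s * w) * HU H' d (b + s * w))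
          = (\<Sum>b\<in>{0..<cols}. HU H b (d - s * w) * HU H' d (b + s * w))"
      proof (intro sum.cong refl)
        fix b
        show "of_bool (b < d - s * w) * HU H b (d - s * w) * HU H' d (b + s * w)
          = HU H b (d - s * w) * HU H' d (b + s * w)"
          using HU_zero[OF F, of b "d - s * w"] ed by (cases "b < d - s * w") auto
      qed
      also have "\<dots> = (\<Sum>b\<in>{0..<cols}. \<Sum>a\<in>{0..<rows}. \<Sum>c\<in>{0..<rows}.
          H b a * U a (d - s * w) * (H' d c * U (c - s * m) b))"
        unfolding HU_def U_shift_neg' by (simp add: sum_product)
      also have "\<dots> = (\<Sum>c\<in>{0..<rows}. \<Sum>a\<in>{0..<rows}. \<Sum>b\<in>{0..<cols}.
          H b a * U a (d - s * w) * (H' d c * U (c - s * m) b))"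
        by (subst sum.swap, subst (2) sum.swap, subst sum.swap) (rule refl)
      also have "\<dots> = (\<Sum>c\<in>{0..<rows}. H' d c * (\<Sum>a\<in>{0..<rows}. UH H (c - s * m) a * U a (d - s * w)))"
        unfolding UH_def by (simp add: sum_distrib_left sum_distrib_right mult_ac)
      also have "\<dots> = (\<Sum>c\<in>{0..<rows}. if s \<le> 0 \<and> e + s * w \<le> d \<and> c < (int k + s) * m then f * (H' d c * U c d) else 0)"
      proof (intro sum.cong refl)
        fix c assume c: "c \<in> {0..<rows}"
        show "H' d c * (\<Sum>a\<in>{0..<rows}. UH H (c - s * m) a * U a (d - s * w))
          = (if s \<le> 0 \<and> e + s * w \<le> d \<and> c < (int k + s) * m then f * (H' d c * U c d) else 0)"
        proof (cases "H' d c = 0")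
          case False
          hence c': "rows - p' \<le> c" using DG(5)[of d c] by simp
          show ?thesis
          proof (cases "c - s * m < rows")
            case True
            have "UH H (c - s * m) a * U a (d - s * w)
               = (if a = c - s * m then f * U (c - s * m) (d - s * w) else 0)" for a
            proof (cases "rows - p \<le> a \<and> a < rows")
              case True
              thus ?thesis using DF(6)[of "c - s * m" a] \<open>c - s * m < rows\<close> c' pp sm by auto
            next
              case False
              thus ?thesis using UH_zero[OF F False, of "c - s * m"] \<open>c - s * m < rows\<close> c' pp sm by auto
            qed
            hence "(\<Sum>a\<in>{0..<rows}. UH H (c - s * m) a * U a (d - s * w))
              = (if c - s * m \<in> {0..<rows} then f * U (c - s * m) (d - s * w) else 0)"
              by simp
            also have "\<dots> = f * U c d"
              using True c sm U_shift[of c "- s" d] by simp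
            finally show ?thesis using True s ed by (simp add: rows_def algebra_simps)
          next
            case False
            have "UH H (c - s * m) a = 0" for a
            proof (cases "a < c - s * m")
              case True thus ?thesis using UH_strictly_lower[OF F e(2)] by simp
            next
              case F': False thus ?thesis using UH_zero[OF F, of a] False by simp
            qed
            thus ?thesis using False by (simp add: rows_def algebra_simps)
          qed
        qed simp
      qed
      finally show ?thesis .
    qed
  qed
  have "(\<Sum>b\<in>{0..<cols}. \<Sum>d\<in>{0..<cols}. of_bool (b < d - s * w) * HU H b (d - s * w) * HU H' d (b + s * w))
    = (\<Sum>d\<in>{0..<cols}. \<Sum>a\<in>{0..<rows}. if s \<le> 0 \<and> e + s * w \<le> d \<and> a < (int k + s) * m then f * (H' d a * U a d) else 0)"
    by (subst sum.swap) (simp only: inner)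
  also have "\<dots> = (if s \<le> 0 then f * (\<Sum>d\<in>{0..<cols}. \<Sum>a\<in>{0..<rows}.
       if e + s * w \<le> d \<and> a < (int k + s) * m then H' d a * U a d else 0) else 0)"
    by (simp add: sum_distrib_left if_distrib cong: if_cong)
  also have "\<dots> = (if s \<le> 0 then f * f' *
         (of_nat (card ({e' - p'..<e'} \<inter> {e + s * w..})) - of_nat (card ({rows - p'..<rows} \<inter> {(int k + s) * m..})))
       else 0)"
    by (subst minor_partial_trace[OF G]) (use e in \<open>auto simp: algebra_simps\<close>)
  finally show ?thesis .
qed

section \<open>Summation over blocks\<close>

text \<open>The derivative in entry \<open>l\<close> of the window row \<open>r\<close>, which is
  the same in all \<open>k\<close> blocks.\<close>

definition coef :: "(int \<Rightarrow> int \<Rightarrow> complex) \<Rightarrow> nat \<Rightarrow> nat \<Rightarrow> complex" where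
  "coef H l r = (\<Sum>t<k. H (int t * w + 1 + int l) (int t * m + int r))"

abbreviation R :: "nat \<Rightarrow> nat \<Rightarrow> complex" where "R \<equiv> wrow n x"

lemma U_block:
  assumes "r < n - 1"
  shows "U (t * m + int r) b = (if t * w + 1 \<le> b \<and> b \<le> t * w + 2 * int n then R r (nat (b - t * w - 1)) else 0)"
proof -
  have r: "int r < m" using assms n2 by (simp add: m_def)
  have 1: "(t * m + int r) div m = t" "(t * m + int r) mod m = int r"
    using r by simp_all
  show ?thesis
    unfolding stair_def m_def[symmetric] w_def[symmetric] 1 by (auto simp: Let_def algebra_simps)
qed

lemma sum_block_rows:
  fixes g :: "int \<Rightarrow> complex"
  shows "(\<Sum>a\<in>{0..<rows}. g a) = (\<Sum>t<k. \<Sum>r<n - 1. g (int t * m + int r))"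
proof -
  have m: "m = int (n - 1)" using n2 by (simp add: m_def)
  have "{0..<rows} = int ` {..<k * (n - 1)}"
    unfolding rows_def m using image_int_atLeastLessThan[of 0 "k * (n - 1)"] by (simp add: lessThan_atLeast0)
  hence "(\<Sum>a\<in>{0..<rows}. g a) = (\<Sum>a<k * (n - 1). g (int a))"
    by (simp add: sum.reindex)
  also have "\<dots> = (\<Sum>t<k. \<Sum>a\<in>{t * (n - 1)..<t * (n - 1) + (n - 1)}. g (int a))"
    by (simp add: sum.nat_group)
  also have "\<dots> = (\<Sum>t<k. \<Sum>r<n - 1. g (int t * m + int r))"
  proof (rule sum.cong[OF refl])
    fix t
    have "(\<Sum>r<n - 1. g (int t * m + int r)) = (\<Sum>r\<in>{0..<n - 1}. g (int (r + t * (n - 1))))"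
      by (simp add: m lessThan_atLeast0 add.commute)
    also have "\<dots> = (\<Sum>a\<in>{t * (n - 1)..<t * (n - 1) + (n - 1)}. g (int a))"
      using sum.shift_bounds_nat_ivl[of "\<lambda>a. g (int a)" 0 "t * (n - 1)" "n - 1"] by (simp add: add.commute)
    finally show "(\<Sum>a\<in>{t * (n - 1)..<t * (n - 1) + (n - 1)}. g (int a)) = (\<Sum>r<n - 1. g (int t * m + int r))" ..
  qed
  finally show ?thesis .
qed

lemma sum_window:
  fixes g :: "int \<Rightarrow> complex"
  assumes "t < k" "\<And>b. b < int t * w + 1 \<or> b > int t * w + 2 * int n \<Longrightarrow> g b = 0"
  shows "(\<Sum>b\<in>{0..<cols}. g b) = (\<Sum>l<2 * n. g (int t * w + 1 + int l))"
proof -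
  have tw: "int t * w + 2 * int n < cols" "0 \<le> int t * w"
  proof -
    have "int t + 1 \<le> int k" using assms(1) by simp
    hence "(int t + 2) * w \<le> (int k + 1) * w" using w_pos by simp
    thus "int t * w + 2 * int n < cols" by (simp add: cols_def w_def algebra_simps)
    show "0 \<le> int t * w" using w_pos by simp
  qed
  have im: "{int t * w + 1..int t * w + 2 * int n} = (\<lambda>l. int t * w + 1 + int l) ` {..<2 * n}"
  proof (intro equalityI subsetI)
    fix b assume "b \<in> {int t * w + 1..int t * w + 2 * int n}"
    hence "b = int t * w + 1 + int (nat (b - int t * w - 1))" "nat (b - int t * w - 1) < 2 * n" by auto
    thus "b \<in> (\<lambda>l. int t * w + 1 + int l) ` {..<2 * n}" by blast
  qed auto
  have "(\<Sum>b\<in>{0..<cols}. g b) = (\<Sum>b\<in>{int t * w + 1..int t * w + 2 * int n}. g b)"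
  proof (intro sum.mono_neutral_right)
    show "{int t * w + 1..int t * w + 2 * int n} \<subseteq> {0..<cols}" using tw by auto
    show "\<forall>b\<in>{0..<cols} - {int t * w + 1..int t * w + 2 * int n}. g b = 0"
      using assms(2) by force
  qed simp
  also have "\<dots> = (\<Sum>l<2 * n. g (int t * w + 1 + int l))"
    unfolding im by (subst sum.reindex) (auto simp: inj_on_def)
  finally show ?thesis .
qed

text \<open>Only the relative position of the two blocks matters, so the sum over block pairs
and shifts collapses to the coefficients \<open>coef\<close> and three relative shifts.\<close>

lemma toeplitz_sum_blocks:
  "toeplitz_sum H H' = (\<Sum>\<sigma>\<in>{-1, 0, 1}. \<Sum>i<n - 1. \<Sum>j<n - 1. \<Sum>l<2 * n. \<Sum>l'<2 * n.
     coef H l i * coef H' l' j * (of_bool (int j - \<sigma> * m < int i) - of_bool (int l < int l' - \<sigma> * w))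
       * U (int i) (int l' + 1 - \<sigma> * w) * U (int j - \<sigma> * m) (int l + 1))"
proof -
  define E where "E \<sigma> i j l l' = (of_bool (int j - \<sigma> * m < int i) - of_bool (int l < int l' - \<sigma> * w))
       * U (int i) (int l' + 1 - \<sigma> * w) * U (int j - \<sigma> * m) (int l + 1)" for \<sigma> :: int and i j l l' :: nat
  \<comment> \<open>Outside the window of row \<open>a\<close> the two comparisons agree wherever
    the entries are nonzero, so \<open>b\<close> may be restricted to the window.\<close>
  have off: "(of_bool (c - s * m < a) - of_bool (b < d - s * w)) * U a (d - s * w) * U (c - s * m) b = 0"
    if "b < a div m * w + 1 \<or> b > a div m * w + 2 * int n" for a b c d s
  proof (cases "U a (d - s * w) = 0 \<or> U (c - s * m) b = 0")
    case False
    have "U a b = 0 \<and> \<not> (a div m * w + 1 \<le> b \<and> b \<le> a div m * w + 2 * int n)"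
      using that U_window[of a b] by fastforce
    from U_comparison[OF this, of "d - s * w" "c - s * m"] False show ?thesis by simp
  qed auto
  \<comment> \<open>Here \<open>U_comparison\<close> gives the reversed strict inequalities, so ties
    have to be excluded: a tie would make \<open>U c d\<close> nonzero outside its window.\<close>
  have off': "(of_bool (c - s * m < a) - of_bool (b < d - s * w)) * U a (d - s * w) * U (c - s * m) b = 0"
    if "d < c div m * w + 1 \<or> d > c div m * w + 2 * int n" for a b c d s
  proof (cases "U a (d - s * w) = 0 \<or> U (c - s * m) b = 0")
    case False
    have "U c d = 0 \<and> \<not> (c div m * w + 1 \<le> d \<and> d \<le> c div m * w + 2 * int n)"
      using that U_window[of c d] by fastforce
    moreover have "U c (b + s * w) \<noteq> 0" using False by (simp add: U_shift_neg')
    moreover have "U (a + s * m) d \<noteq> 0" using False by (simp add: U_shift_neg)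
    ultimately have "a + s * m < c \<longleftrightarrow> d < b + s * w" using U_comparison by blast
    moreover have "c - s * m \<noteq> a"
    proof
      assume "c - s * m = a"
      hence "c = a + s * m" by simp
      hence "U c d \<noteq> 0" using \<open>U (a + s * m) d \<noteq> 0\<close> by simp
      thus False using that U_window[of c d] by fastforce
    qed
    moreover have "b \<noteq> d - s * w"
    proof
      assume "b = d - s * w"
      hence "d = b + s * w" by simp
      hence "U c d \<noteq> 0" using \<open>U c (b + s * w) \<noteq> 0\<close> by simp
      thus False using that U_window[of c d] by fastforce
    qed
    ultimately have "c - s * m < a \<longleftrightarrow> b < d - s * w" by linarith
    thus ?thesis by simp
  qed auto
  have shift: "(of_bool (int u * m + int j - s * m < int t * m + int i) - of_bool (int t * w + 1 + int l < int u * w + 1 + int l' - s * w))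
       * U (int t * m + int i) (int u * w + 1 + int l' - s * w) * U (int u * m + int j - s * m) (int t * w + 1 + int l)
       = E (s - (int u - int t)) i j l l'" for s t u i j l l'
  proof -
    have 1: "U (int t * m + int i) (int u * w + 1 + int l' - s * w) = U (int i) (int l' + 1 - (s - (int u - int t)) * w)"
      using U_shift[of "int i" "int t" "int l' + 1 - (s - (int u - int t)) * w"] by (simp add: algebra_simps)
    have 2: "U (int u * m + int j - s * m) (int t * w + 1 + int l) = U (int j - (s - (int u - int t)) * m) (int l + 1)"
      using U_shift[of "int j - (s - (int u - int t)) * m" "int t" "int l + 1"] by (simp add: algebra_simps)
    show ?thesis unfolding 1 2 E_def by (simp add: algebra_simps)
  qed
  have step: "(\<Sum>b\<in>{0..<cols}. \<Sum>d\<in>{0..<cols}. H b a * H' d c *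
       (of_bool (c - s * m < a) - of_bool (b < d - s * w)) * U a (d - s * w) * U (c - s * m) b)
     = (\<Sum>l<2 * n. \<Sum>l'<2 * n. H (int t * w + 1 + int l) a * H' (int u * w + 1 + int l') c * E (s - (int u - int t)) i j l l')"
    if t: "t < k" "u < k" "i < n - 1" "j < n - 1" and ac: "a = int t * m + int i" "c = int u * m + int j" for a c s t u i j
  proof -
    have dv: "a div m = int t" "c div m = int u" using t n2 by (simp_all add: ac m_def)
    have "(\<Sum>b\<in>{0..<cols}. \<Sum>d\<in>{0..<cols}. H b a * H' d c *
       (of_bool (c - s * m < a) - of_bool (b < d - s * w)) * U a (d - s * w) * U (c - s * m) b)
      = (\<Sum>l<2 * n. \<Sum>d\<in>{0..<cols}. H (int t * w + 1 + int l) a * H' d c *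
       (of_bool (c - s * m < a) - of_bool (int t * w + 1 + int l < d - s * w)) * U a (d - s * w) * U (c - s * m) (int t * w + 1 + int l))"
      by (rule sum_window[OF t(1)], intro sum.neutral ballI) (metis (no_types, lifting) off[unfolded dv] dv mult.assoc mult_zero_right)
    also have "\<dots> = (\<Sum>l<2 * n. \<Sum>l'<2 * n. H (int t * w + 1 + int l) a * H' (int u * w + 1 + int l') c *
       (of_bool (c - s * m < a) - of_bool (int t * w + 1 + int l < int u * w + 1 + int l' - s * w)) * U a (int u * w + 1 + int l' - s * w) * U (c - s * m) (int t * w + 1 + int l))"
      by (intro sum.cong refl, rule sum_window[OF t(2)]) (metis (no_types, lifting) off' dv mult.assoc mult_zero_right)
    also have "\<dots> = (\<Sum>l<2 * n. \<Sum>l'<2 * n. H (int t * w + 1 + int l) a * H' (int u * w + 1 + int l') c * E (s - (int u - int t)) i j l l')"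
      unfolding ac shift[symmetric] by (simp add: mult_ac)
    finally show ?thesis .
  qed
  \<comment> \<open>Two periods exceed the window length \<open>2 * n\<close>, so blocks that far
    apart do not interact.\<close>
  have Ez: "E \<sigma> i j l l' = 0" if "\<sigma> \<notin> {-1, 0, 1}" "i < n - 1" "l' < 2 * n" for \<sigma> i j l l'
  proof (rule ccontr)
    assume "E \<sigma> i j l l' \<noteq> 0"
    hence "U (int i) (int l' + 1 - \<sigma> * w) \<noteq> 0" unfolding E_def by auto
    with U_block[OF that(2), of 0 "int l' + 1 - \<sigma> * w"]
    have 1: "1 \<le> int l' + 1 - \<sigma> * w" "int l' + 1 - \<sigma> * w \<le> 2 * int n" by (auto split: if_splits)
    have "\<sigma> \<ge> 2 \<or> \<sigma> \<le> -2" using that(1) by auto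
    thus False
    proof
      assume "\<sigma> \<ge> 2"
      hence "2 * w \<le> \<sigma> * w" using w_pos by simp
      thus False using 1 that(3) by (simp add: w_def)
    next
      assume "\<sigma> \<le> -2"
      hence "\<sigma> * w \<le> (-2) * w" using w_pos by (intro mult_right_mono) auto
      thus False using 1 that(3) by (simp add: w_def)
    qed
  qed
  \<comment> \<open>Block indices differ by at most \<open>k - 1\<close>, so the relative shifts -1,
    0, 1 are all reached by some \<open>s\<close> between \<open>- k\<close> and
    \<open>k\<close>.\<close>
  have collapse: "(\<Sum>s\<in>{- int k..int k}. E (s - (int u - int t)) i j l l') = (\<Sum>\<sigma>\<in>{-1,0,1}. E \<sigma> i j l l')"
    if "t < k" "u < k" "i < n - 1" "l' < 2 * n" for t u i j l l'
  proof -
    have "(\<Sum>\<sigma>\<in>{-1,0,1}. E \<sigma> i j l l') = (\<Sum>\<sigma>\<in>(\<lambda>s. s - (int u - int t)) ` {- int k..int k}. E \<sigma> i j l l')"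
    proof (intro sum.mono_neutral_left)
      show "{-1, 0, 1} \<subseteq> (\<lambda>s. s - (int u - int t)) ` {- int k..int k}"
        using that(1,2) by (simp add: image_iff)
    qed (use Ez that in auto)
    also have "\<dots> = (\<Sum>s\<in>{- int k..int k}. E (s - (int u - int t)) i j l l')"
      by (subst sum.reindex) (auto simp: inj_on_def)
    finally show ?thesis ..
  qed
  have "toeplitz_sum H H' = (\<Sum>s\<in>{- int k..int k}. \<Sum>t<k. \<Sum>i<n - 1. \<Sum>u<k. \<Sum>j<n - 1. \<Sum>l<2 * n. \<Sum>l'<2 * n.
      H (int t * w + 1 + int l) (int t * m + int i) * H' (int u * w + 1 + int l') (int u * m + int j) * E (s - (int u - int t)) i j l l')"
    unfolding toeplitz_sum_def sum_block_rows
    by (intro sum.cong refl step) auto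
  also have "\<dots> = (\<Sum>t<k. \<Sum>i<n - 1. \<Sum>u<k. \<Sum>j<n - 1. \<Sum>l<2 * n. \<Sum>l'<2 * n. \<Sum>s\<in>{- int k..int k}.
      H (int t * w + 1 + int l) (int t * m + int i) * H' (int u * w + 1 + int l') (int u * m + int j) * E (s - (int u - int t)) i j l l')"
    by (simp only: sum.swap[where A = "{- int k..int k}"])
  also have "\<dots> = (\<Sum>t<k. \<Sum>i<n - 1. \<Sum>u<k. \<Sum>j<n - 1. \<Sum>l<2 * n. \<Sum>l'<2 * n. \<Sum>\<sigma>\<in>{-1,0,1}.
      H (int t * w + 1 + int l) (int t * m + int i) * H' (int u * w + 1 + int l') (int u * m + int j) * E \<sigma> i j l l')"
    unfolding sum_distrib_left[symmetric]
    by (intro sum.cong refl arg_cong2[where f = "(*)"] collapse) auto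
  also have "\<dots> = (\<Sum>\<sigma>\<in>{-1,0,1}. \<Sum>i<n - 1. \<Sum>j<n - 1. \<Sum>l<2 * n. \<Sum>l'<2 * n. \<Sum>t<k. \<Sum>u<k.
      H (int t * w + 1 + int l) (int t * m + int i) * H' (int u * w + 1 + int l') (int u * m + int j) * E \<sigma> i j l l')"
    by (simp only: sum.swap[where A = "{..<k}" and B = "{-1,0,1}"] sum.swap[where A = "{..<k}" and B = "{..<n - 1}"]
        sum.swap[where A = "{..<k}" and B = "{..<2 * n}"] sum.swap[where A = "{..<n - 1}" and B = "{-1,0,1}"]
        sum.swap[where A = "{..<2 * n}" and B = "{-1,0,1}"])
  also have "\<dots> = (\<Sum>\<sigma>\<in>{-1,0,1}. \<Sum>i<n - 1. \<Sum>j<n - 1. \<Sum>l<2 * n. \<Sum>l'<2 * n. coef H l i * coef H' l' j * E \<sigma> i j l l')"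
    unfolding coef_def sum_product by (simp only: sum_distrib_right)
  finally show ?thesis unfolding E_def by (simp only: mult.assoc)
qed

section \<open>Gradients of staircase minors\<close>

text \<open>Transposed, as is usual for gradients in the trace form. The last row of
  \<open>Y\<close> does not occur in \<open>U\<close>, nor does the first row of \<open>X\<close>;
  in \<open>gradX\<close>, row \<open>r\<close> of \<open>X\<close> is found in row
  \<open>r - 1\<close> of a block, in the second half of the window.\<close>

definition gradY :: "(int \<Rightarrow> int \<Rightarrow> complex) \<Rightarrow> fmat" where
  "gradY H = (\<lambda>l r. if l < n \<and> r < n - 1 then coef H l r else 0)"

definition gradX :: "(int \<Rightarrow> int \<Rightarrow> complex) \<Rightarrow> fmat" where
  "gradX H = (\<lambda>l r. if l < n \<and> 0 < r \<and> r < n then coef H (n + l) (r - 1) else 0)"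

abbreviation "mA H \<equiv> mmul n x (gradX H)"
abbreviation "mB H \<equiv> mmul n x (gradY H)"
abbreviation "mP H \<equiv> mmul n (gradX H) x"
abbreviation "mQ H \<equiv> mmul n (gradY H) x"

definition row_coef :: "(int \<Rightarrow> int \<Rightarrow> complex) \<Rightarrow> nat \<Rightarrow> nat \<Rightarrow> complex" where
  "row_coef H i j = (\<Sum>l<2 * n. R i l * coef H l j)"

definition coef_row :: "(int \<Rightarrow> int \<Rightarrow> complex) \<Rightarrow> nat \<Rightarrow> nat \<Rightarrow> complex" where
  "coef_row H l l' = (\<Sum>i<n - 1. coef H l i * R i l')"

lemma sum_double:
  fixes g :: "nat \<Rightarrow> complex"
  shows "(\<Sum>l<2 * n. g l) = (\<Sum>l<n. g l) + (\<Sum>l<n. g (n + l))"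
  using sum.atLeastLessThan_concat[of 0 n "2 * n" g] sum.shift_bounds_nat_ivl[of g 0 n n]
  by (simp add: lessThan_atLeast0 mult_2 add.commute)

lemma sum_pred:
  fixes g :: "nat \<Rightarrow> complex"
  shows "(\<Sum>l<n. if 0 < l then g l else 0) = (\<Sum>l<n - 1. g (Suc l))"
  using n2 by (cases n) (simp_all add: sum.lessThan_Suc_shift del: sum.lessThan_Suc)

lemma sum_init:
  fixes g :: "nat \<Rightarrow> complex"
  shows "(\<Sum>l<n. if l < n - 1 then g l else 0) = (\<Sum>l<n - 1. g l)"
  using n2 by (cases n) (simp_all add: sum.lessThan_Suc)

lemma mQ_coef_row: "l < n \<Longrightarrow> l' < n \<Longrightarrow> mQ H l l' = coef_row H l l'"
proof -
  assume "l < n" "l' < n"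
  hence "mQ H l l' = (\<Sum>r<n. if r < n - 1 then coef H l r * R r l' else 0)"
    unfolding mmul_def gradY_def wrow_def by (auto intro!: sum.cong)
  thus ?thesis unfolding coef_row_def sum_init .
qed

lemma mP_coef_row: "l < n \<Longrightarrow> l' < n \<Longrightarrow> mP H l l' = coef_row H (n + l) (n + l')"
proof -
  assume "l < n" "l' < n"
  hence "mP H l l' = (\<Sum>r<n. if 0 < r then coef H (n + l) (r - 1) * R (r - 1) (n + l') else 0)"
    unfolding mmul_def gradX_def wrow_def by (auto intro!: sum.cong)
  thus ?thesis unfolding coef_row_def sum_pred by simp
qed

lemma mB_coef: "i < n - 1 \<Longrightarrow> j < n - 1 \<Longrightarrow> mB H i j = (\<Sum>l<n. R i l * coef H l j)"
  unfolding mmul_def gradY_def wrow_def by (auto simp: mult.commute)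

lemma mA_coef: "i < n - 1 \<Longrightarrow> j < n - 1 \<Longrightarrow> mA H (i + 1) (j + 1) = (\<Sum>l<n. R i (n + l) * coef H (n + l) j)"
  unfolding mmul_def gradX_def wrow_def by (auto simp: mult.commute)

text \<open>A window row consists of row \<open>i\<close> of \<open>Y\<close> and row
  \<open>i + 1\<close> of \<open>X\<close>; this offset is the source of \<open>shift_adj\<close> in
  \<open>strict_lower_AB\<close>.\<close>

lemma row_coef_AB: "i < n - 1 \<Longrightarrow> j < n - 1 \<Longrightarrow> row_coef H i j = mA H (i + 1) (j + 1) + mB H i j"
  unfolding row_coef_def sum_double using mA_coef[of i j H] mB_coef[of i j H] by simp

lemma mA_first_col: "mA H i 0 = 0"
  by (simp add: mmul_def gradX_def)

lemma mB_last_col: "mB H i (n - 1) = 0"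
  by (simp add: mmul_def gradY_def)

lemma row_coef_UH:
  assumes "i < n - 1" "j < n - 1"
  shows "row_coef H i j = (\<Sum>t<k. UH H (int t * m + int i) (int t * m + int j))"
proof -
  have "UH H (int t * m + int i) (int t * m + int j)
     = (\<Sum>l<2 * n. R i l * H (int t * w + 1 + int l) (int t * m + int j))" if "t < k" for t
  proof -
    have "UH H (int t * m + int i) (int t * m + int j)
      = (\<Sum>l<2 * n. U (int t * m + int i) (int t * w + 1 + int l) * H (int t * w + 1 + int l) (int t * m + int j))"
      unfolding UH_def
      by (rule sum_window[OF that]) (auto simp: U_block[OF assms(1)])
    also have "\<dots> = (\<Sum>l<2 * n. R i l * H (int t * w + 1 + int l) (int t * m + int j))"
      by (intro sum.cong refl) (auto simp: U_block[OF assms(1)])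
    finally show ?thesis .
  qed
  hence "(\<Sum>t<k. UH H (int t * m + int i) (int t * m + int j))
     = (\<Sum>t<k. \<Sum>l<2 * n. R i l * H (int t * w + 1 + int l) (int t * m + int j))" by simp
  also have "\<dots> = row_coef H i j"
    unfolding row_coef_def coef_def by (subst sum.swap) (simp add: sum_distrib_left)
  finally show ?thesis ..
qed

section \<open>Triangularity and torus weights of the gradients\<close>

definition row_weight :: "int \<Rightarrow> nat \<Rightarrow> complex" where
  "row_weight p i = of_nat (card {t\<in>{..<k}. rows - p \<le> int t * m + int i})"

lemma row_coef_lower:
  assumes H: "minor_adj p e H f" and ij: "i < n - 1" "j \<le> i"
  shows "row_coef H i j = (if i = j then f * row_weight p i else 0)"
proof -
  have "UH H (int t * m + int i) (int t * m + int j)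
     = (if rows - p \<le> int t * m + int i then (if i = j then f else 0) else 0)" if "t < k" for t
  proof -
    have "int t * m + int i < (int t + 1) * m" using ij(1) by (simp add: m_def algebra_simps)
    also have "\<dots> \<le> rows" unfolding rows_def using that m_pos by (intro mult_right_mono) auto
    finally show ?thesis using UH_lower[OF H, of "int t * m + int j" "int t * m + int i"] ij(2) by auto
  qed
  hence "row_coef H i j = (\<Sum>t<k. if rows - p \<le> int t * m + int i then (if i = j then f else 0) else 0)"
    using row_coef_UH[of i j H] ij by simp
  also have "\<dots> = (\<Sum>t\<in>{t\<in>{..<k}. rows - p \<le> int t * m + int i}. (if i = j then f else 0))"
    by (rule sum.inter_filter[symmetric]) simp
  finally show ?thesis by (simp add: row_weight_def)
qed

text \<open>Position \<open>j\<close> in a block of width \<open>n + 1\<close> carries column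
  \<open>j\<close> of \<open>X\<close> if \<open>j < n\<close> and column \<open>j - 1\<close> of
  \<open>Y\<close> if \<open>j > 0\<close>. The condition \<open>jl\<close> leaves out the cases
  where the zero column of \<open>calY\<close> or \<open>calX\<close> would be paired with a nonzero
  one: the entries of \<open>H\<close> at such positions belong to no gradient.\<close>

lemma HU_blocks:
  assumes "j \<le> n" "l \<le> n" and jl: "0 < j \<or> l = 0" "j < n \<or> l = n"
  shows "(\<Sum>t\<le>k. HU H (int t * w + int j) (int t * w + int l))
    = (if j < n \<and> l < n then mP H j l else 0) + (if 0 < j \<and> 0 < l then mQ H (j - 1) (l - 1) else 0)"
proof -
  define Z where "Z t = (if 0 < t \<and> l < n then \<Sum>r<n - 1. H (int t * w + int j) (int (t - 1) * m + int r) * R r (n + l) else 0)" for t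
  have term1: "U (int u * m + int r) (int t * w + int l)
     = (if u = t \<and> 0 < l then R r (l - 1) else 0) + (if t = Suc u \<and> l < n then R r (n + l) else 0)"
    if r: "r < n - 1" for u t r
  proof -
    consider "u = t" | "t = Suc u" | "u > t" | "t > Suc u" by linarith
    thus ?thesis
    proof cases
      case 1 thus ?thesis using assms n2 by (auto simp: U_block[OF r] nat_diff_distrib')
    next
      case 2
      have eq: "nat (w + int l - 1) = n + l" by (simp add: w_def)
      show ?thesis using 2 assms n2
        by (auto simp: U_block[OF r] eq distrib_right) (auto simp: w_def)
    next
      case 3
      hence "int t + 1 \<le> int u" by simp
      hence "(int t + 1) * w \<le> int u * w" using w_pos by (intro mult_right_mono) auto
      hence "int t * w + w \<le> int u * w" by (simp add: distrib_right)
      hence "\<not> int u * w + 1 \<le> int t * w + int l" using assms by (simp add: w_def)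
      thus ?thesis using 3 by (simp add: U_block[OF r])
    next
      case 4
      hence "int u + 2 \<le> int t" by simp
      hence "(int u + 2) * w \<le> int t * w" using w_pos by (intro mult_right_mono) auto
      hence "\<not> int t * w + int l \<le> int u * w + 2 * int n" by (simp add: w_def algebra_simps)
      thus ?thesis using 4 by (simp add: U_block[OF r])
    qed
  qed
  have HUt: "HU H (int t * w + int j) (int t * w + int l)
     = (if t < k \<and> 0 < l then \<Sum>r<n - 1. H (int t * w + int j) (int t * m + int r) * R r (l - 1) else 0) + Z t" if "t \<le> k" for t
  proof -
    have "HU H (int t * w + int j) (int t * w + int l)
       = (\<Sum>u<k. \<Sum>r<n - 1. H (int t * w + int j) (int u * m + int r) *
            ((if u = t \<and> 0 < l then R r (l - 1) else 0) + (if t = Suc u \<and> l < n then R r (n + l) else 0)))"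
      unfolding HU_def sum_block_rows by (intro sum.cong refl) (simp add: term1)
    also have "\<dots> = (\<Sum>u<k. if u = t then (if 0 < l then \<Sum>r<n - 1. H (int t * w + int j) (int t * m + int r) * R r (l - 1) else 0) else 0)
        + (\<Sum>u<k. if t = Suc u then (if l < n then \<Sum>r<n - 1. H (int t * w + int j) (int u * m + int r) * R r (n + l) else 0) else 0)"
      unfolding sum.distrib[symmetric] by (intro sum.cong refl) (auto simp: distrib_left sum.distrib)
    also have "(\<Sum>u<k. if u = t then (if 0 < l then \<Sum>r<n - 1. H (int t * w + int j) (int t * m + int r) * R r (l - 1) else 0) else 0)
       = (if t < k \<and> 0 < l then \<Sum>r<n - 1. H (int t * w + int j) (int t * m + int r) * R r (l - 1) else 0)"
      by simp
    also have "(\<Sum>u<k. if t = Suc u then (if l < n then \<Sum>r<n - 1. H (int t * w + int j) (int u * m + int r) * R r (n + l) else 0) else 0) = Z t"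
    proof (cases t)
      case (Suc u')
      thus ?thesis using that by (simp add: Z_def)
    qed (simp add: Z_def)
    finally show ?thesis .
  qed
  have "(\<Sum>t\<le>k. HU H (int t * w + int j) (int t * w + int l))
     = (\<Sum>t\<le>k. if t < k \<and> 0 < l then \<Sum>r<n - 1. H (int t * w + int j) (int t * m + int r) * R r (l - 1) else 0) + (\<Sum>t\<le>k. Z t)"
    by (simp add: HUt sum.distrib)
  also have "(\<Sum>t\<le>k. if t < k \<and> 0 < l then \<Sum>r<n - 1. H (int t * w + int j) (int t * m + int r) * R r (l - 1) else 0)
     = (if 0 < l then \<Sum>t<k. \<Sum>r<n - 1. H (int t * w + int j) (int t * m + int r) * R r (l - 1) else 0)"
    by (simp add: lessThan_Suc_atMost[symmetric])
  also have "\<dots> = (if 0 < j \<and> 0 < l then mQ H (j - 1) (l - 1) else 0)"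
  proof (cases "0 < l")
    case True
    hence j: "0 < j" using jl by auto
    have "mQ H (j - 1) (l - 1) = coef_row H (j - 1) (l - 1)" using assms True j by (intro mQ_coef_row) auto
    also have "\<dots> = (\<Sum>r<n - 1. \<Sum>t<k. H (int t * w + int j) (int t * m + int r) * R r (l - 1))"
    proof -
      have "int t * w + 1 + int (j - 1) = int t * w + int j" for t using j by simp
      thus ?thesis unfolding coef_row_def coef_def sum_distrib_right by simp
    qed
    also have "\<dots> = (\<Sum>t<k. \<Sum>r<n - 1. H (int t * w + int j) (int t * m + int r) * R r (l - 1))"
      by (rule sum.swap)
    finally show ?thesis using True j by simp
  qed simp
  also have "(\<Sum>t\<le>k. Z t) = (\<Sum>t<k. Z (Suc t))"
  proof -
    have "Z 0 = 0" by (simp add: Z_def)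
    thus ?thesis by (simp add: sum.lessThan_Suc_shift lessThan_Suc_atMost[symmetric] del: sum.lessThan_Suc)
  qed
  also have "\<dots> = (if j < n \<and> l < n then mP H j l else 0)"
  proof (cases "l < n")
    case True
    hence j: "j < n" using jl by auto
    have "mP H j l = coef_row H (n + j) (n + l)" using True j by (intro mP_coef_row) auto
    also have "\<dots> = (\<Sum>r<n - 1. \<Sum>t<k. H (int (Suc t) * w + int j) (int t * m + int r) * R r (n + l))"
    proof -
      have "int t * w + 1 + int (n + j) = int (Suc t) * w + int j" for t by (simp add: w_def algebra_simps)
      thus ?thesis unfolding coef_row_def coef_def sum_distrib_right by (simp only:)
    qed
    also have "\<dots> = (\<Sum>t<k. Z (Suc t))"
      unfolding Z_def using True by (subst sum.swap) simp
    finally show ?thesis using True j by simp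
  qed (simp add: Z_def)
  finally show ?thesis by simp
qed

text \<open>The three possible right ends are those of the \<open>\<phi>\<^sub>p\<close>, the \<open>\<psi>\<^sub>q\<close> and the \<open>\<theta>\<^sub>i\<close>; the latter
are minors of the last block \<open>calX\<close>.\<close>

definition admissible :: "int \<Rightarrow> int \<Rightarrow> bool" where
  "admissible p e \<longleftrightarrow> e = int k * w \<or> e = int k * w + 1 \<or> (e = int k * w + int n \<and> p \<le> m)"

definition col_weight :: "int \<Rightarrow> int \<Rightarrow> nat \<Rightarrow> complex" where
  "col_weight p e j = of_nat (card {t\<in>{..k}. e - p \<le> int t * w + int j \<and> int t * w + int j < e})"

text \<open>Columns from \<open>e\<close> on do no harm. For a \<theta> they are empty; otherwise
  only the block \<open>t = k\<close> reaches \<open>e\<close>, and there a position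
  \<open>j > 0\<close> is already outside the minor. Position 0 of that block may be inside, hence
  the restriction to \<open>j = l\<close> when \<open>j = 0\<close>.\<close>

lemma HU_in_block:
  assumes H: "minor_adj p e H f" and adm: "admissible p e"
    and j: "j \<le> l" "l \<le> n" "0 < j \<or> j = l" and t: "t \<le> k"
  shows "HU H (int t * w + int j) (int t * w + int l)
    = (if e - p \<le> int t * w + int j \<and> int t * w + int j < e then (if j = l then f else 0) else 0)"
proof (cases "j = l")
  case True
  thus ?thesis
    using HU_upper[OF H, of "int t * w + int j" "int t * w + int j"] HU_zero[OF H, of "int t * w + int j"] by auto
next
  case False
  hence jl: "j < l" "0 < j" using j by auto
  have "HU H (int t * w + int j) (int t * w + int l) = 0"
  proof (cases "int t * w + int l < e")
    case True
    thus ?thesis using HU_upper[OF H, of "int t * w + int j" "int t * w + int l"] jl by simp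
  next
    case False
    show ?thesis
    proof (cases "e = int k * w + int n")
      case True
      thus ?thesis using HU_strictly_upper_last_block[OF H True] jl by simp
    next
      case e: False
      have "t = k"
      proof (rule ccontr)
        assume "t \<noteq> k"
        hence "int t + 1 \<le> int k" using t by simp
        hence "(int t + 1) * w \<le> int k * w" using w_pos by (intro mult_right_mono) auto
        hence "int t * w + int l < int k * w" using j by (simp add: w_def algebra_simps)
        thus False using False adm e by (auto simp: admissible_def)
      qed
      hence "\<not> int t * w + int j < e" using adm e jl by (auto simp: admissible_def)
      thus ?thesis using HU_zero[OF H] by auto
    qed
  qed
  thus ?thesis using False by simp
qed

lemma HU_blocks_sum:
  assumes H: "minor_adj p e H f" and adm: "admissible p e"
    and j: "j \<le> l" "l \<le> n" "0 < j \<or> j = l"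
  shows "(if j < n \<and> l < n then mP H j l else 0) + (if 0 < j \<and> 0 < l then mQ H (j - 1) (l - 1) else 0)
    = (if j = l then f * col_weight p e j else 0)"
proof -
  have "(if j < n \<and> l < n then mP H j l else 0) + (if 0 < j \<and> 0 < l then mQ H (j - 1) (l - 1) else 0)
    = (\<Sum>t\<le>k. HU H (int t * w + int j) (int t * w + int l))"
    by (rule HU_blocks[symmetric]) (use j in auto)
  also have "\<dots> = (\<Sum>t\<le>k. if e - p \<le> int t * w + int j \<and> int t * w + int j < e then (if j = l then f else 0) else 0)"
    by (intro sum.cong refl HU_in_block[OF H adm j]) simp
  also have "\<dots> = (\<Sum>t\<in>{t\<in>{..k}. e - p \<le> int t * w + int j \<and> int t * w + int j < e}. (if j = l then f else 0))"
    by (rule sum.inter_filter[symmetric]) simp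
  finally show ?thesis by (simp add: col_weight_def)
qed

lemma strict_lower_AB:
  assumes H: "minor_adj p e H f"
  shows "strict_lower n (mA H) = - shift_adj n (strict_lower n (mB H))"
proof (intro ext)
  fix i j
  show "strict_lower n (mA H) i j = (- shift_adj n (strict_lower n (mB H))) i j"
  proof (cases "j < i \<and> i < n \<and> 0 < j")
    case True
    then obtain i' j' where ij: "i = Suc i'" "j = Suc j'" by (cases i; cases j) auto
    have "mA H (i' + 1) (j' + 1) + mB H i' j' = 0"
    proof -
      have "i' < n - 1" "j' < n - 1" "j' \<le> i'" "i' \<noteq> j'" using True ij by auto
      thus ?thesis using row_coef_AB[of i' j' H] row_coef_lower[OF H, of i' j'] by simp
    qed
    thus ?thesis using True ij by (simp add: strict_lower_def shift_adj_def add_eq_0_iff2)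
  next
    case False
    thus ?thesis by (cases "j = 0") (auto simp: strict_lower_def shift_adj_def mA_first_col)
  qed
qed

lemma strict_upper_PQ:
  assumes H: "minor_adj p e H f" and adm: "admissible p e"
  shows "strict_upper n (mQ H) = - shift n (strict_upper n (mP H))"
proof (intro ext)
  fix i j
  show "strict_upper n (mQ H) i j = (- shift n (strict_upper n (mP H))) i j"
  proof (cases "i < j \<and> j < n")
    case True
    have "(if i + 1 < n \<and> j + 1 < n then mP H (i + 1) (j + 1) else 0) + mQ H i j = 0"
      using HU_blocks_sum[OF H adm, of "i + 1" "j + 1"] True by simp
    thus ?thesis using True by (auto simp: strict_upper_def shift_def add_eq_0_iff2 split: if_splits)
  qed (auto simp: strict_upper_def shift_def)
qed

text \<open>The degree of the minor in the entries of \<open>X\<close>.\<close>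

definition x_weight :: "int \<Rightarrow> int \<Rightarrow> complex" where
  "x_weight p e = (\<Sum>t<k. of_nat (card ({e - p..<e} \<inter> {(int t + 1) * w..}))
     - of_nat (card ({rows - p..<rows} \<inter> {(int t + 1) * m..})))"

text \<open>Among the rows before \<open>(t + 1) * m\<close>, the entries in columns from
  \<open>(t + 1) * w\<close> on are exactly the \<open>X\<close> half of block \<open>t\<close>,
  because the windows of earlier blocks end before that column. So every block contributes one
  partial trace, and the total is Euler's formula for the degree in \<open>X\<close>.\<close>

lemma trace_A:
  assumes H: "minor_adj p e H f"
  shows "(\<Sum>i<n. mA H i i) = f * x_weight p e"
proof -
  have "(\<Sum>i<n. mA H i i) = (\<Sum>i<n - 1. mA H (Suc i) (Suc i))"
  proof -
    obtain n' where n': "n = Suc n'" using n2 by (cases n) auto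
    show ?thesis unfolding n' sum.lessThan_Suc_shift using mA_first_col[of H 0] by (simp add: n')
  qed
  also have "\<dots> = (\<Sum>i<n - 1. \<Sum>l<n. \<Sum>t<k. R i (n + l) * H (int t * w + 1 + int (n + l)) (int t * m + int i))"
    using mA_coef[of _ _ H] by (intro sum.cong refl) (simp add: coef_def sum_distrib_left)
  also have "\<dots> = (\<Sum>t<k. \<Sum>i<n - 1. \<Sum>l<n. R i (n + l) * H (int t * w + 1 + int (n + l)) (int t * m + int i))"
    by (simp only: sum.swap[where B = "{..<k}"])
  also have "\<dots> = (\<Sum>t<k. f * (of_nat (card ({e - p..<e} \<inter> {(int t + 1) * w..}))
     - of_nat (card ({rows - p..<rows} \<inter> {(int t + 1) * m..}))))"
  proof (intro sum.cong refl)
    fix t assume "t \<in> {..<k}"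
    hence t: "t < k" by simp
    let ?F = "\<lambda>b a. if (int t + 1) * w \<le> b \<and> a < (int t + 1) * m then H b a * U a b else 0"
    have inner: "(\<Sum>b\<in>{0..<cols}. ?F b (int u * m + int i))
       = (if u = t then \<Sum>l<n. R i (n + l) * H (int t * w + 1 + int (n + l)) (int t * m + int i) else 0)"
      if i: "i < n - 1" for u i
    proof -
      consider "u > t" | "u < t" | "u = t" by linarith
      thus ?thesis
      proof cases
        case 1
        hence "int t + 1 \<le> int u" by simp
        hence "(int t + 1) * m \<le> int u * m" using m_pos by (intro mult_right_mono) auto
        hence "\<not> int u * m + int i < (int t + 1) * m" by linarith
        thus ?thesis using 1 by simp
      next
        case 2
        have "?F b (int u * m + int i) = 0" for b
        proof (cases "(int t + 1) * w \<le> b")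
          case True
          have "(int u + 2) * w \<le> (int t + 1) * w" using 2 w_pos by (intro mult_right_mono) auto
          hence "int u * w + 2 * int n < b" using True by (simp add: w_def algebra_simps)
          thus ?thesis by (simp add: U_block[OF i])
        qed simp
        thus ?thesis using 2 by simp
      next
        case 3
        have "int t * m + int i < (int t + 1) * m" using i by (simp add: m_def algebra_simps)
        hence "(\<Sum>b\<in>{0..<cols}. ?F b (int t * m + int i))
          = (\<Sum>b\<in>{0..<cols}. if (int t + 1) * w \<le> b then H b (int t * m + int i) * U (int t * m + int i) b else 0)"
          by simp
        also have "\<dots> = (\<Sum>l<2 * n. if (int t + 1) * w \<le> int t * w + 1 + int l then H (int t * w + 1 + int l) (int t * m + int i) * U (int t * m + int i) (int t * w + 1 + int l) else 0)"
          by (rule sum_window[OF t]) (auto simp: U_block[OF i])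
        also have "\<dots> = (\<Sum>l<2 * n. if n \<le> l then R i l * H (int t * w + 1 + int l) (int t * m + int i) else 0)"
        proof (rule sum.cong[OF refl])
          fix l assume "l \<in> {..<2 * n}"
          hence "U (int t * m + int i) (int t * w + 1 + int l) = R i l" by (simp add: U_block[OF i])
          moreover have "(int t + 1) * w \<le> int t * w + 1 + int l \<longleftrightarrow> n \<le> l"
            by (auto simp: w_def distrib_right)
          ultimately show "(if (int t + 1) * w \<le> int t * w + 1 + int l then H (int t * w + 1 + int l) (int t * m + int i) * U (int t * m + int i) (int t * w + 1 + int l) else 0)
            = (if n \<le> l then R i l * H (int t * w + 1 + int l) (int t * m + int i) else 0)"
            by (simp only: mult.commute)
        qed
        also have "\<dots> = (\<Sum>l<n. R i (n + l) * H (int t * w + 1 + int (n + l)) (int t * m + int i))"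
          unfolding sum_double by simp
        finally show ?thesis unfolding 3 by simp
      qed
    qed
    have "(\<Sum>i<n - 1. \<Sum>l<n. R i (n + l) * H (int t * w + 1 + int (n + l)) (int t * m + int i))
      = (\<Sum>u<k. if u = t then \<Sum>i<n - 1. \<Sum>l<n. R i (n + l) * H (int t * w + 1 + int (n + l)) (int t * m + int i) else 0)"
      using t by simp
    also have "\<dots> = (\<Sum>u<k. \<Sum>i<n - 1. \<Sum>b\<in>{0..<cols}. ?F b (int u * m + int i))"
      by (intro sum.cong refl) (auto simp: inner)
    also have "\<dots> = (\<Sum>a\<in>{0..<rows}. \<Sum>b\<in>{0..<cols}. ?F b a)"
      unfolding sum_block_rows ..
    also have "\<dots> = (\<Sum>b\<in>{0..<cols}. \<Sum>a\<in>{0..<rows}. ?F b a)" by (rule sum.swap)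
    also have "\<dots> = f * (of_nat (card ({e - p..<e} \<inter> {(int t + 1) * w..}))
     - of_nat (card ({rows - p..<rows} \<inter> {(int t + 1) * m..})))"
      by (rule minor_partial_trace[OF H]) simp
    finally show "(\<Sum>i<n - 1. \<Sum>l<n. R i (n + l) * H (int t * w + 1 + int (n + l)) (int t * m + int i))
      = f * (of_nat (card ({e - p..<e} \<inter> {(int t + 1) * w..}))
     - of_nat (card ({rows - p..<rows} \<inter> {(int t + 1) * m..})))" .
  qed
  also have "\<dots> = f * x_weight p e" by (simp add: x_weight_def sum_distrib_left)
  finally show ?thesis .
qed

lemma trace_AP: "(\<Sum>i<n. mA H i i) = (\<Sum>i<n. mP H i i)"
proof -
  have "(\<Sum>i<n. mA H i i) = (\<Sum>i<n. \<Sum>l<n. x i l * gradX H l i)" by (simp add: mmul_def)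
  also have "\<dots> = (\<Sum>l<n. \<Sum>i<n. gradX H l i * x i l)" by (subst sum.swap) (simp add: mult.commute)
  finally show ?thesis by (simp add: mmul_def)
qed

text \<open>Only those combinations of diagonal entries that come from a torus action are claimed to
  be multiples of \<open>f\<close>; single entries need not be. The trace of \<open>B\<close> is the
  total degree minus the degree in \<open>X\<close>.\<close>

lemma minor_diag_weights:
  assumes H: "minor_adj p e H f" and adm: "admissible p e"
  shows "diag_weights n (row_weight p) (\<lambda>i. col_weight p e (i + 1))
     (sum (row_weight p) {..<n - 1} - x_weight p e) (col_weight p e 0) f
     (\<lambda>i. mA H i i) (\<lambda>i. mB H i i) (\<lambda>i. mP H i i) (\<lambda>i. mQ H i i)"
  unfolding diag_weights_def
proof (intro conjI allI impI)
  have ab: "mA H (i + 1) (i + 1) + mB H i i = f * row_weight p i" if "i < n - 1" for i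
    using row_coef_AB[of i i H] row_coef_lower[OF H, of i i] that by simp
  show "mA H (i + 1) (i + 1) + mB H i i = f * row_weight p i" if "i < n - 1" for i using ab[OF that] .
  show "mQ H i i + vshift n (\<lambda>i. mP H i i) i = f * col_weight p e (i + 1)" if "i < n" for i
    using HU_blocks_sum[OF H adm, of "i + 1" "i + 1"] that by (simp add: vshift_def add.commute)
  show "mP H 0 0 = f * col_weight p e 0"
    using HU_blocks_sum[OF H adm, of 0 0] n2 by simp
  show "(\<Sum>i<n. mB H i i) = f * (sum (row_weight p) {..<n - 1} - x_weight p e)"
  proof -
    obtain n' where n': "n = Suc n'" using n2 by (cases n) auto
    have "(\<Sum>i<n. mB H i i) = (\<Sum>i<n - 1. mB H i i)"
      using mB_last_col[of H "n - 1"] by (simp add: n')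
    also have "\<dots> = (\<Sum>i<n - 1. f * row_weight p i - mA H (Suc i) (Suc i))"
      using ab by (intro sum.cong) (auto simp: eq_diff_eq add.commute)
    also have "\<dots> = f * sum (row_weight p) {..<n - 1} - (\<Sum>i<n - 1. mA H (Suc i) (Suc i))"
      by (simp add: sum_subtractf sum_distrib_left)
    also have "(\<Sum>i<n - 1. mA H (Suc i) (Suc i)) = (\<Sum>i<n. mA H i i)"
      unfolding n' sum.lessThan_Suc_shift using mA_first_col[of H 0] by (simp add: n')
    finally show ?thesis unfolding trace_A[OF H] by (simp add: algebra_simps)
  qed
qed (use mA_first_col mB_last_col trace_AP in auto)

section \<open>The Toeplitz sum in terms of \<open>A\<close>, \<open>B\<close>, \<open>P\<close>,
  \<open>Q\<close>\<close>

lemma sum_init_init: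
  fixes g :: "nat \<Rightarrow> nat \<Rightarrow> complex"
  shows "(\<Sum>i<n. \<Sum>j<n. if i < n - 1 \<and> j < n - 1 then g i j else 0) = (\<Sum>i<n - 1. \<Sum>j<n - 1. g i j)"
proof -
  have "(\<Sum>i<n. \<Sum>j<n. if i < n - 1 \<and> j < n - 1 then g i j else 0)
     = (\<Sum>i<n. if i < n - 1 then (\<Sum>j<n. if j < n - 1 then g i j else 0) else 0)"
    by (intro sum.cong refl) auto
  thus ?thesis unfolding sum_init .
qed

lemma sum_product_scaled:
  fixes c :: complex
  shows "(\<Sum>l\<in>S. \<Sum>l'\<in>T. c * g l * h l') = c * sum g S * sum h T"
  unfolding sum_distrib_left[of c g S] sum_product ..

lemma sum_quadrant:
  fixes F :: "nat \<Rightarrow> nat \<Rightarrow> complex"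
  assumes "\<And>l l'. l' < n \<Longrightarrow> F l l' = 0" "\<And>l l'. F (n + l) l' = 0"
  shows "(\<Sum>l<2 * n. \<Sum>l'<2 * n. F l l') = (\<Sum>l<n. \<Sum>l'<n. F l (n + l'))"
  unfolding sum_double by (simp add: assms)

lemma sum_product_scaled_if:
  fixes c :: complex
  shows "(\<Sum>l\<in>S. \<Sum>l'\<in>T. if b then c * g l * h l' else 0) = (if b then c * sum g S * sum h T else 0)"
  by (simp add: sum_product_scaled)

text \<open>The column comparison runs over two window positions, which split into quadrants. Both
  in the \<open>Y\<close> half give \<open>Q\<close>, both in the \<open>X\<close> half give
  \<open>P\<close>; \<open>l\<close> in the \<open>Y\<close> half and \<open>l'\<close> in the
  \<open>X\<close> half always satisfy \<open>l < l'\<close>, and regrouping this product gives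
  \<open>B\<close> and \<open>A'\<close>.\<close>

lemma toeplitz_shift0:
  "(\<Sum>i<n - 1. \<Sum>j<n - 1. \<Sum>l<2 * n. \<Sum>l'<2 * n.
     coef H l i * coef H' l' j * (of_bool (int j < int i) - of_bool (int l < int l'))
       * U (int i) (int l' + 1) * U (int j) (int l + 1))
   = (\<Sum>i<n - 1. \<Sum>j<n - 1. of_bool (j < i) * row_coef H j i * row_coef H' i j)
     - pairing n (strict_upper n (mQ H)) (mQ H') - pairing n (strict_upper n (mP H)) (mP H') - pairing n (mB H) (shift n (mA H'))"
proof -
  have UR: "U (int i) (int l + 1) = R i l" if "i < n - 1" "l < 2 * n" for i l
    using U_block[OF that(1), of 0 "int l + 1"] that(2) by simp
  have "(\<Sum>i<n - 1. \<Sum>j<n - 1. \<Sum>l<2 * n. \<Sum>l'<2 * n.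
     coef H l i * coef H' l' j * (of_bool (int j < int i) - of_bool (int l < int l'))
       * U (int i) (int l' + 1) * U (int j) (int l + 1))
    = (\<Sum>i<n - 1. \<Sum>j<n - 1. \<Sum>l<2 * n. \<Sum>l'<2 * n.
        of_bool (j < i) * (R j l * coef H l i) * (R i l' * coef H' l' j))
      - (\<Sum>i<n - 1. \<Sum>j<n - 1. \<Sum>l<2 * n. \<Sum>l'<2 * n.
        of_bool (l < l') * (coef H l i * R i l') * (coef H' l' j * R j l))"
    unfolding sum_subtractf[symmetric]
  proof (intro sum.cong refl, goal_cases)
    case (1 i j l l')
    hence "U (int i) (int l' + 1) = R i l'" "U (int j) (int l + 1) = R j l" using UR by auto
    thus ?case by (simp only:) (simp add: algebra_simps)
  qed
  also have "(\<Sum>i<n - 1. \<Sum>j<n - 1. \<Sum>l<2 * n. \<Sum>l'<2 * n.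
        of_bool (j < i) * (R j l * coef H l i) * (R i l' * coef H' l' j))
     = (\<Sum>i<n - 1. \<Sum>j<n - 1. of_bool (j < i) * row_coef H j i * row_coef H' i j)"
    unfolding row_coef_def sum_product_scaled ..
  also have "(\<Sum>i<n - 1. \<Sum>j<n - 1. \<Sum>l<2 * n. \<Sum>l'<2 * n.
        of_bool (l < l') * (coef H l i * R i l') * (coef H' l' j * R j l))
     = (\<Sum>l<2 * n. \<Sum>l'<2 * n. \<Sum>i<n - 1. \<Sum>j<n - 1.
        of_bool (l < l') * (coef H l i * R i l') * (coef H' l' j * R j l))"
    by (simp only: sum.swap[where A = "{..<n - 1}" and B = "{..<2 * n}"])
  also have "\<dots> = (\<Sum>l<2 * n. \<Sum>l'<2 * n. of_bool (l < l') * coef_row H l l' * coef_row H' l' l)"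
    unfolding coef_row_def sum_product_scaled ..
  also have "\<dots> = (\<Sum>l<n. \<Sum>l'<n. of_bool (l < l') * coef_row H l l' * coef_row H' l' l)
      + (\<Sum>l<n. \<Sum>l'<n. coef_row H l (n + l') * coef_row H' (n + l') l)
      + (\<Sum>l<n. \<Sum>l'<n. of_bool (l < l') * coef_row H (n + l) (n + l') * coef_row H' (n + l') (n + l))"
    unfolding sum_double by (simp add: sum.distrib)
  also have "(\<Sum>l<n. \<Sum>l'<n. of_bool (l < l') * coef_row H l l' * coef_row H' l' l) = pairing n (strict_upper n (mQ H)) (mQ H')"
    unfolding pairing_def by (intro sum.cong refl) (auto simp: strict_upper_def mQ_coef_row)
  also have "(\<Sum>l<n. \<Sum>l'<n. of_bool (l < l') * coef_row H (n + l) (n + l') * coef_row H' (n + l') (n + l)) = pairing n (strict_upper n (mP H)) (mP H')"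
    unfolding pairing_def by (intro sum.cong refl) (auto simp: strict_upper_def mP_coef_row)
  also have "(\<Sum>l<n. \<Sum>l'<n. coef_row H l (n + l') * coef_row H' (n + l') l) = pairing n (mB H) (shift n (mA H'))"
  proof -
    have "(\<Sum>l<n. \<Sum>l'<n. coef_row H l (n + l') * coef_row H' (n + l') l)
       = (\<Sum>l<n. \<Sum>l'<n. \<Sum>i<n - 1. \<Sum>j<n - 1. (R j l * coef H l i) * (R i (n + l') * coef H' (n + l') j))"
      unfolding coef_row_def sum_product by (intro sum.cong refl) (simp add: mult_ac)
    also have "\<dots> = (\<Sum>i<n - 1. \<Sum>j<n - 1. \<Sum>l<n. \<Sum>l'<n. (R j l * coef H l i) * (R i (n + l') * coef H' (n + l') j))"
      by (simp only: sum.swap[where A = "{..<n}" and B = "{..<n - 1}"])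
    also have "\<dots> = (\<Sum>i<n - 1. \<Sum>j<n - 1. mB H j i * mA H' (i + 1) (j + 1))"
      by (intro sum.cong refl) (simp only: mA_coef mB_coef lessThan_iff sum_product)
    also have "\<dots> = (\<Sum>j<n - 1. \<Sum>i<n - 1. mB H j i * mA H' (i + 1) (j + 1))" by (rule sum.swap)
    also have "\<dots> = pairing n (mB H) (shift n (mA H'))"
      unfolding pairing_def sum_init_init[symmetric] by (intro sum.cong refl) (auto simp: shift_def)
    finally show ?thesis .
  qed
  finally show ?thesis by simp
qed

text \<open>Neighbouring blocks overlap only in the \<open>X\<close> half of one and the
  \<open>Y\<close> half of the other. The row comparison always holds here, so the weight is the
  negated column comparison and selects the lower triangle including the diagonal.\<close>

lemma toeplitz_shift1:
  "(\<Sum>i<n - 1. \<Sum>j<n - 1. \<Sum>l<2 * n. \<Sum>l'<2 * n.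
     coef H l i * coef H' l' j * (of_bool (int j - m < int i) - of_bool (int l < int l' - w))
       * U (int i) (int l' + 1 - w) * U (int j - m) (int l + 1))
   = pairing n (mQ H) (shift n (mP H')) - pairing n (strict_upper n (mQ H)) (shift n (mP H'))"
proof -
  have U1: "U (int i) (int l' + 1 - w) = (if n + 1 \<le> l' then R i (l' - (n + 1)) else 0)" if "i < n - 1" "l' < 2 * n" for i l'
  proof -
    have "nat (int l' + 1 - w - 0 * w - 1) = l' - (n + 1)" by (simp add: w_def)
    thus ?thesis using U_block[OF that(1), of 0 "int l' + 1 - w"] that(2) by (auto simp: w_def)
  qed
  have U2: "U (int j - m) (int l + 1) = (if l < n - 1 then R j (n + (l + 1)) else 0)" if "j < n - 1" "l < 2 * n" for j l
  proof -
    have "nat (int l + 1 - (-1) * w - 1) = n + (l + 1)" by (simp add: w_def)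
    thus ?thesis using U_block[OF that(1), of "-1" "int l + 1"] that(2) n2 by (auto simp: w_def add.commute[of "- m"])
  qed
  have "(\<Sum>i<n - 1. \<Sum>j<n - 1. \<Sum>l<2 * n. \<Sum>l'<2 * n.
     coef H l i * coef H' l' j * (of_bool (int j - m < int i) - of_bool (int l < int l' - w))
       * U (int i) (int l' + 1 - w) * U (int j - m) (int l + 1))
    = (\<Sum>i<n - 1. \<Sum>j<n - 1. \<Sum>l<2 * n. \<Sum>l'<2 * n. if l < n - 1 \<and> n + 1 \<le> l' then
        of_bool (l' - (n + 1) \<le> l) * (coef H l i * R i (l' - (n + 1))) * (coef H' l' j * R j (n + (l + 1))) else 0)"
  proof (intro sum.cong refl, goal_cases)
    case (1 i j l l')
    hence ij: "i < n - 1" "j < n - 1" "l < 2 * n" "l' < 2 * n" by auto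
    show ?case
      unfolding U1[OF ij(1,4)] U2[OF ij(2,3)]
      using ij by (auto simp: m_def w_def of_bool_def)
  qed
  also have "\<dots> = (\<Sum>l<2 * n. \<Sum>l'<2 * n. \<Sum>i<n - 1. \<Sum>j<n - 1. if l < n - 1 \<and> n + 1 \<le> l' then
        of_bool (l' - (n + 1) \<le> l) * (coef H l i * R i (l' - (n + 1))) * (coef H' l' j * R j (n + (l + 1))) else 0)"
    by (simp only: sum.swap[where A = "{..<n - 1}" and B = "{..<2 * n}"])
  also have "\<dots> = (\<Sum>l<2 * n. \<Sum>l'<2 * n. if l < n - 1 \<and> n + 1 \<le> l' then
        of_bool (l' - (n + 1) \<le> l) * coef_row H l (l' - (n + 1)) * coef_row H' l' (n + (l + 1)) else 0)"
    unfolding coef_row_def sum_product_scaled_if ..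
  also have "\<dots> = (\<Sum>l<n. \<Sum>l'<n. if l < n - 1 \<and> 0 < l' then
        of_bool (l' - 1 \<le> l) * coef_row H l (l' - 1) * coef_row H' (n + l') (n + (l + 1)) else 0)"
    by (subst sum_quadrant) (auto intro!: sum.cong)
  also have "\<dots> = (\<Sum>l<n. if l < n - 1 then (\<Sum>l'<n. if 0 < l' then
        of_bool (l' - 1 \<le> l) * coef_row H l (l' - 1) * coef_row H' (n + l') (n + (l + 1)) else 0) else 0)"
    by (intro sum.cong refl) auto
  also have "\<dots> = (\<Sum>l<n - 1. \<Sum>l'<n - 1. of_bool (l' \<le> l) * coef_row H l l' * coef_row H' (n + Suc l') (n + (l + 1)))"
    unfolding sum_init sum_pred by simp
  also have "\<dots> = pairing n (mQ H) (shift n (mP H')) - pairing n (strict_upper n (mQ H)) (shift n (mP H'))"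
    unfolding pairing_def sum_subtractf[symmetric] sum_init_init[symmetric]
    by (intro sum.cong refl) (auto simp: strict_upper_def shift_def mQ_coef_row mP_coef_row)
  finally show ?thesis .
qed

text \<open>The opposite neighbour: the row comparison never holds, and only the strict column
  comparison remains, with a minus sign.\<close>

lemma toeplitz_shift_minus1:
  "(\<Sum>i<n - 1. \<Sum>j<n - 1. \<Sum>l<2 * n. \<Sum>l'<2 * n.
     coef H l i * coef H' l' j * (of_bool (int j + m < int i) - of_bool (int l < int l' + w))
       * U (int i) (int l' + 1 + w) * U (int j + m) (int l + 1))
   = - pairing n (strict_upper n (mP H)) (shift_adj n (mQ H'))"
proof -
  have U1: "U (int j + m) (int l + 1) = (if n + 1 \<le> l then R j (l - (n + 1)) else 0)" if "j < n - 1" "l < 2 * n" for j l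
  proof -
    have "nat (int l + 1 - 1 * w - 1) = l - (n + 1)" by (simp add: w_def)
    thus ?thesis using U_block[OF that(1), of 1 "int l + 1"] that(2) by (auto simp: w_def add.commute[of m])
  qed
  have U2: "U (int i) (int l' + 1 + w) = (if l' < n - 1 then R i (n + (l' + 1)) else 0)" if "i < n - 1" "l' < 2 * n" for i l'
  proof -
    have "nat (int l' + 1 + w - 0 * w - 1) = n + (l' + 1)" by (simp add: w_def)
    thus ?thesis using U_block[OF that(1), of 0 "int l' + 1 + w"] that(2) n2 by (auto simp: w_def)
  qed
  have "(\<Sum>i<n - 1. \<Sum>j<n - 1. \<Sum>l<2 * n. \<Sum>l'<2 * n.
     coef H l i * coef H' l' j * (of_bool (int j + m < int i) - of_bool (int l < int l' + w))
       * U (int i) (int l' + 1 + w) * U (int j + m) (int l + 1))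
    = (\<Sum>i<n - 1. \<Sum>j<n - 1. \<Sum>l<2 * n. \<Sum>l'<2 * n. if l' < n - 1 \<and> n + 1 \<le> l then
        - of_bool (l - (n + 1) < l') * (coef H l i * R i (n + (l' + 1))) * (coef H' l' j * R j (l - (n + 1))) else 0)"
  proof (intro sum.cong refl, goal_cases)
    case (1 i j l l')
    hence ij: "i < n - 1" "j < n - 1" "l < 2 * n" "l' < 2 * n" by auto
    show ?case
      unfolding U1[OF ij(2,3)] U2[OF ij(1,4)]
      using ij by (auto simp: m_def w_def of_bool_def)
  qed
  also have "\<dots> = (\<Sum>l'<2 * n. \<Sum>l<2 * n. \<Sum>i<n - 1. \<Sum>j<n - 1. if l' < n - 1 \<and> n + 1 \<le> l then
        - of_bool (l - (n + 1) < l') * (coef H l i * R i (n + (l' + 1))) * (coef H' l' j * R j (l - (n + 1))) else 0)"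
    by (subst sum.swap) (simp only: sum.swap[where A = "{..<n - 1}" and B = "{..<2 * n}"])
  also have "\<dots> = (\<Sum>l'<2 * n. \<Sum>l<2 * n. if l' < n - 1 \<and> n + 1 \<le> l then
        - of_bool (l - (n + 1) < l') * coef_row H l (n + (l' + 1)) * coef_row H' l' (l - (n + 1)) else 0)"
    unfolding coef_row_def sum_product_scaled_if ..
  also have "\<dots> = (\<Sum>l'<n. \<Sum>l<n. if l' < n - 1 \<and> 0 < l then
        - of_bool (l - 1 < l') * coef_row H (n + l) (n + (l' + 1)) * coef_row H' l' (l - 1) else 0)"
    by (subst sum_quadrant) (auto intro!: sum.cong)
  also have "\<dots> = (\<Sum>l'<n. if l' < n - 1 then (\<Sum>l<n. if 0 < l then
        - of_bool (l - 1 < l') * coef_row H (n + l) (n + (l' + 1)) * coef_row H' l' (l - 1) else 0) else 0)"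
    by (intro sum.cong refl) auto
  also have "\<dots> = (\<Sum>l'<n - 1. \<Sum>l<n - 1. - of_bool (l < l') * coef_row H (n + Suc l) (n + (l' + 1)) * coef_row H' l' l)"
    unfolding sum_init sum_pred by simp
  also have "\<dots> = (\<Sum>l<n - 1. \<Sum>l'<n - 1. - of_bool (l < l') * coef_row H (n + Suc l) (n + (l' + 1)) * coef_row H' l' l)"
    by (rule sum.swap)
  also have "\<dots> = - pairing n (shift n (strict_upper n (mP H))) (mQ H')"
    unfolding pairing_def sum_negf[symmetric] sum_init_init[symmetric]
    by (intro sum.cong refl) (auto simp: strict_upper_def shift_def mQ_coef_row mP_coef_row)
  finally show ?thesis by (simp add: pairing_shift)
qed

text \<open>The right-hand side consists of the terms of \<open>rplus_off_difference\<close> without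
  \<open>diag_pairing\<close>; this is the bridge from the bracket on the group to the periodic
  matrix. The row term of relative shift 0 disappears because it only involves strictly lower
  entries of \<open>row_coef H'\<close>.\<close>

lemma toeplitz_sum_pairing:
  assumes H': "minor_adj p' e' H' f'"
  shows "toeplitz_sum H H' = pairing n (mQ H) (shift n (mP H')) - pairing n (strict_upper n (mP H)) (mP H' + shift_adj n (mQ H'))
     - pairing n (strict_upper n (mQ H)) (mQ H' + shift n (mP H')) - pairing n (mB H) (shift n (mA H'))"
proof -
  have "of_bool (j < i) * row_coef H j i * row_coef H' i j = 0" if "i < n - 1" for i j
    using row_coef_lower[OF H', of i j] that by auto
  hence z: "(\<Sum>i<n - 1. \<Sum>j<n - 1. of_bool (j < i) * row_coef H j i * row_coef H' i j) = 0"
    by (intro sum.neutral ballI) auto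
  show ?thesis
    unfolding toeplitz_sum_blocks
    using toeplitz_shift0[of H H'] toeplitz_shift1[of H H'] toeplitz_shift_minus1[of H H'] z
    by (simp add: pairing_linear)
qed

end

section \<open>Minors as functions of matrices\<close>

text \<open>Jacobi's formula: differentiating the Leibniz expansion gives determinants with one row
  replaced by a row of \<open>v\<close>, and these are expanded along that row.\<close>

lemma deriv_det:
  fixes u v :: "nat \<Rightarrow> nat \<Rightarrow> complex"
  shows "deriv (\<lambda>t. det (mat p p (\<lambda>(i,j). u i j + t * v i j))) 0
     = (\<Sum>i<p. \<Sum>j<p. v i j * adj_mat (mat p p (\<lambda>(i,j). u i j)) $$ (j, i))"
proof -
  let ?P = "{\<pi>. \<pi> permutes {0..<p}}"
  define Mr where "Mr i = mat p p (\<lambda>(r,c). if r = i then v r c else u r c)" for i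
  have perm: "\<pi> i < p" if "\<pi> \<in> ?P" "i < p" for \<pi> i
    using that permutes_in_image[of \<pi> "{0..<p}" i] by auto
  have fin: "finite ?P" by (simp add: finite_permutations)
  have "(\<lambda>t. det (mat p p (\<lambda>(i,j). u i j + t * v i j)))
     = (\<lambda>t. \<Sum>\<pi>\<in>?P. signof \<pi> * (\<Prod>i\<in>{0..<p}. u i (\<pi> i) + t * v i (\<pi> i)))"
    by (intro ext, subst det_def'[of _ p]) (auto intro!: sum.cong prod.cong simp: perm)
  moreover have "((\<lambda>t. \<Sum>\<pi>\<in>?P. signof \<pi> * (\<Prod>i\<in>{0..<p}. u i (\<pi> i) + t * v i (\<pi> i))) has_field_derivative
      (\<Sum>\<pi>\<in>?P. signof \<pi> * (\<Sum>i\<in>{0..<p}. v i (\<pi> i) * (\<Prod>y\<in>{0..<p} - {i}. u y (\<pi> y) + 0 * v y (\<pi> y))))) (at 0)"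
    by (intro DERIV_sum DERIV_cmult has_field_derivative_prod) (auto intro!: derivative_eq_intros)
  ultimately have "deriv (\<lambda>t. det (mat p p (\<lambda>(i,j). u i j + t * v i j))) 0
      = (\<Sum>\<pi>\<in>?P. signof \<pi> * (\<Sum>i\<in>{0..<p}. v i (\<pi> i) * (\<Prod>y\<in>{0..<p} - {i}. u y (\<pi> y))))"
    by (simp add: DERIV_imp_deriv)
  also have "\<dots> = (\<Sum>i\<in>{0..<p}. \<Sum>\<pi>\<in>?P. signof \<pi> * (v i (\<pi> i) * (\<Prod>y\<in>{0..<p} - {i}. u y (\<pi> y))))"
    unfolding sum_distrib_left by (rule sum.swap)
  also have "\<dots> = (\<Sum>i<p. det (Mr i))"
  proof (intro sum.cong)
    fix i assume "i \<in> {..<p}"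
    hence i: "i < p" by simp
    have "det (Mr i) = (\<Sum>\<pi>\<in>?P. signof \<pi> * (\<Prod>y\<in>{0..<p}. Mr i $$ (y, \<pi> y)))"
      by (rule det_def') (simp add: Mr_def)
    also have "\<dots> = (\<Sum>\<pi>\<in>?P. signof \<pi> * (v i (\<pi> i) * (\<Prod>y\<in>{0..<p} - {i}. u y (\<pi> y))))"
    proof (intro sum.cong refl arg_cong2[where f = "(*)"])
      fix \<pi> assume \<pi>: "\<pi> \<in> ?P"
      have "(\<Prod>y\<in>{0..<p}. Mr i $$ (y, \<pi> y)) = Mr i $$ (i, \<pi> i) * (\<Prod>y\<in>{0..<p} - {i}. Mr i $$ (y, \<pi> y))"
        using i by (intro prod.remove) auto
      also have "\<dots> = v i (\<pi> i) * (\<Prod>y\<in>{0..<p} - {i}. u y (\<pi> y))"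
        using i perm[OF \<pi>] by (auto simp: Mr_def intro!: arg_cong2[where f = "(*)"] prod.cong)
      finally show "(\<Prod>y\<in>{0..<p}. Mr i $$ (y, \<pi> y)) = v i (\<pi> i) * (\<Prod>y\<in>{0..<p} - {i}. u y (\<pi> y))" .
    qed
    finally show "(\<Sum>\<pi>\<in>?P. signof \<pi> * (v i (\<pi> i) * (\<Prod>y\<in>{0..<p} - {i}. u y (\<pi> y)))) = det (Mr i)" ..
  qed auto
  also have "\<dots> = (\<Sum>i<p. \<Sum>j<p. v i j * adj_mat (mat p p (\<lambda>(i,j). u i j)) $$ (j, i))"
  proof (intro sum.cong refl)
    fix i assume "i \<in> {..<p}"
    hence i: "i < p" by simp
    have "det (Mr i) = (\<Sum>j<p. Mr i $$ (i, j) * cofactor (Mr i) i j)"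
      by (rule laplace_expansion_row[OF _ i]) (simp add: Mr_def)
    also have "\<dots> = (\<Sum>j<p. v i j * adj_mat (mat p p (\<lambda>(i,j). u i j)) $$ (j, i))"
    proof (intro sum.cong refl)
      fix j assume j: "j \<in> {..<p}"
      have "mat_delete (Mr i) i j = mat_delete (mat p p (\<lambda>(i,j). u i j)) i j"
        by (rule eq_matI) (auto simp: mat_delete_def Mr_def)
      thus "Mr i $$ (i, j) * cofactor (Mr i) i j = v i j * adj_mat (mat p p (\<lambda>(i,j). u i j)) $$ (j, i)"
        using i j by (simp add: adj_mat_def cofactor_def Mr_def)
    qed
    finally show "det (Mr i) = (\<Sum>j<p. v i j * adj_mat (mat p p (\<lambda>(i,j). u i j)) $$ (j, i))" .
  qed
  finally show ?thesis .
qed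

definition stair_mat :: "nat \<Rightarrow> nat \<Rightarrow> nat \<Rightarrow> int \<Rightarrow> fmat \<Rightarrow> complex mat" where
  "stair_mat n k p e x = mat p p (\<lambda>(i,j). stair n x (int k * (int n - 1) - int p + int i) (e - int p + int j))"

definition stair_adj :: "nat \<Rightarrow> nat \<Rightarrow> nat \<Rightarrow> int \<Rightarrow> fmat \<Rightarrow> int \<Rightarrow> int \<Rightarrow> complex" where
  "stair_adj n k p e x b a =
     (let i = b - (e - int p); j = a - (int k * (int n - 1) - int p)
      in if 0 \<le> i \<and> i < int p \<and> 0 \<le> j \<and> j < int p then adj_mat (stair_mat n k p e x) $$ (nat i, nat j) else 0)"

lemma sum_int_window:
  fixes g :: "int \<Rightarrow> complex"
  assumes "0 \<le> c" "c + int p \<le> hi" "\<And>b. b < c \<or> b \<ge> c + int p \<Longrightarrow> g b = 0"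
  shows "(\<Sum>b\<in>{0..<hi}. g b) = (\<Sum>j<p. g (c + int j))"
proof -
  have im: "{c..<c + int p} = (\<lambda>j. c + int j) ` {..<p}"
  proof (intro equalityI subsetI)
    fix b assume "b \<in> {c..<c + int p}"
    hence "b = c + int (nat (b - c))" "nat (b - c) < p" by auto
    thus "b \<in> (\<lambda>j. c + int j) ` {..<p}" by blast
  qed auto
  have "(\<Sum>b\<in>{0..<hi}. g b) = (\<Sum>b\<in>{c..<c + int p}. g b)"
    by (intro sum.mono_neutral_right) (use assms in \<open>auto simp: not_le not_less\<close>)
  also have "\<dots> = (\<Sum>j<p. g (c + int j))"
    unfolding im by (subst sum.reindex) (auto simp: inj_on_def)
  finally show ?thesis .
qed

lemma last_interval:
  fixes a c :: int
  assumes "a \<in> {c - int p..<c}"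
  obtains i where "a = c - int p + int i" "i < p"
  using assms by (intro that[of "nat (a - (c - int p))"]) auto

context staircase
begin

lemma stair_adj_minor:
  assumes p: "int p \<le> rows" "int p \<le> e" "e \<le> cols"
  shows "minor_adj (int p) e (stair_adj n k p e x) (det (stair_mat n k p e x))"
proof -
  let ?L = "stair_mat n k p e x" and ?H = "stair_adj n k p e x"
  have L: "?L \<in> carrier_mat p p" by (simp add: stair_mat_def)
  note adj = adj_mat[OF L]
  have rows_eq: "int k * (int n - 1) = rows" by (simp add: rows_def m_def)
  have Hz: "?H b a = 0" if "\<not> (e - int p \<le> b \<and> b < e \<and> rows - int p \<le> a \<and> a < rows)" for b a
    using that by (auto simp: stair_adj_def Let_def rows_eq)
  have Hj: "?H (e - int p + int j) (rows - int p + int i) = adj_mat ?L $$ (j, i)" if "i < p" "j < p" for i j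
    using that by (simp add: stair_adj_def Let_def rows_eq)
  have Uj: "U (rows - int p + int i) (e - int p + int j) = ?L $$ (i, j)" if "i < p" "j < p" for i j
    using that by (simp add: stair_mat_def rows_eq)
  show ?thesis
    unfolding minor_adj_def
  proof (intro conjI allI impI ballI)
    fix b a assume "?H b a \<noteq> 0"
    thus "b \<in> {e - int p..<e}" "a \<in> {rows - int p..<rows}" using Hz[of b a] by auto
  next
    fix a a' assume "a \<in> {rows - int p..<rows}" "a' \<in> {rows - int p..<rows}"
    then obtain i i' where i: "a = rows - int p + int i" "i < p" "a' = rows - int p + int i'" "i' < p"
      by (elim last_interval)
    have "(\<Sum>b\<in>{0..<cols}. U a b * ?H b a') = (\<Sum>j<p. U a (e - int p + int j) * ?H (e - int p + int j) a')"
      by (rule sum_int_window) (use p Hz in auto)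
    also have "\<dots> = (\<Sum>j<p. ?L $$ (i, j) * adj_mat ?L $$ (j, i'))"
      using i by (intro sum.cong refl) (simp add: Hj Uj)
    also have "\<dots> = (?L * adj_mat ?L) $$ (i, i')"
      using i L adj(1) by (simp add: scalar_prod_def lessThan_atLeast0)
    also have "\<dots> = (if a = a' then det ?L else 0)" using i by (simp add: adj(2))
    finally show "(\<Sum>b\<in>{0..<cols}. U a b * ?H b a') = (if a = a' then det ?L else 0)" .
  next
    fix b b' assume "b \<in> {e - int p..<e}" "b' \<in> {e - int p..<e}"
    then obtain i i' where i: "b = e - int p + int i" "i < p" "b' = e - int p + int i'" "i' < p"
      by (elim last_interval)
    have "(\<Sum>a\<in>{0..<rows}. ?H b a * U a b') = (\<Sum>j<p. ?H b (rows - int p + int j) * U (rows - int p + int j) b')"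
      by (rule sum_int_window) (use p Hz in auto)
    also have "\<dots> = (\<Sum>j<p. adj_mat ?L $$ (i, j) * ?L $$ (j, i'))"
      using i by (intro sum.cong refl) (simp add: Hj Uj)
    also have "\<dots> = (adj_mat ?L * ?L) $$ (i, i')"
      using i L adj(1) by (simp add: scalar_prod_def lessThan_atLeast0)
    also have "\<dots> = (if b = b' then det ?L else 0)" using i by (simp add: adj(3))
    finally show "(\<Sum>a\<in>{0..<rows}. ?H b a * U a b') = (if b = b' then det ?L else 0)" .
  qed (use p in auto)
qed

text \<open>No relation between \<open>H\<close> and \<open>x\<close> is assumed, so
  \<open>x\<close> may be a direction of differentiation while \<open>H\<close> is the adjugate at
  another point.\<close>

lemma sum_UH_gradient:
  "(\<Sum>a\<in>{0..<rows}. UH H a a) = (\<Sum>i<n. \<Sum>l<n. x i l * (gradX H l i + gradY H l i))"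
proof -
  obtain n' where n': "n = Suc n'" using n2 by (cases n) auto
  have "(\<Sum>a\<in>{0..<rows}. UH H a a) = (\<Sum>i<n - 1. row_coef H i i)"
    unfolding sum_block_rows by (subst sum.swap) (simp add: row_coef_UH)
  also have "\<dots> = (\<Sum>i<n - 1. mA H (Suc i) (Suc i)) + (\<Sum>i<n - 1. mB H i i)"
    by (simp add: row_coef_AB sum.distrib)
  also have "(\<Sum>i<n - 1. mA H (Suc i) (Suc i)) = (\<Sum>i<n. mA H i i)"
    unfolding n' sum.lessThan_Suc_shift using mA_first_col[of H 0] by (simp add: n')
  also have "(\<Sum>i<n - 1. mB H i i) = (\<Sum>i<n. mB H i i)"
    using mB_last_col[of H "n - 1"] by (simp add: n')
  finally show ?thesis by (simp add: mmul_def sum.distrib distrib_left)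
qed

end

lemma stair_linear:
  "stair n (\<lambda>i j. x i j + t * y i j) a b = stair n x a b + t * stair n y a b"
  by (simp add: stair_def wrow_def Let_def)

lemma stair_cong:
  assumes "n \<ge> 2" "\<And>i j. i < n \<Longrightarrow> j < n \<Longrightarrow> x i j = y i j"
  shows "stair n x a b = stair n y a b"
proof -
  define r where "r = nat (a mod (int n - 1))"
  define c where "c = b - a div (int n - 1) * (int n + 1) - 1"
  have "a mod (int n - 1) < int n - 1" "0 \<le> a mod (int n - 1)" using assms(1) by simp_all
  hence r: "r < n - 1" using assms(1) unfolding r_def by linarith
  have "wrow n x r (nat c) = wrow n y r (nat c)" if "0 \<le> c" "c < 2 * int n"
    using that r assms(2) unfolding wrow_def by (auto intro!: assms(2))
  thus ?thesis unfolding stair_def r_def[symmetric] c_def[symmetric] by (simp add: Let_def)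
qed

lemma (in staircase) deriv_stair_minor:
  assumes p: "int p \<le> rows" "int p \<le> e" "e \<le> cols"
  shows "deriv (\<lambda>t. det (stair_mat n k p e (\<lambda>i j. x i j + t * y i j))) 0
     = (\<Sum>i<n. \<Sum>l<n. y i l * (gradX (stair_adj n k p e x) l i + gradY (stair_adj n k p e x) l i))"
proof -
  let ?H = "stair_adj n k p e x"
  \<comment> \<open>The staircase is linear in its matrix, so the derivative in direction
    \<open>y\<close> pairs the staircase of \<open>y\<close> with the adjugate at
    \<open>x\<close>.\<close>
  interpret y: staircase n k y m w rows cols
    by unfold_locales (use n2 in \<open>simp_all add: m_def w_def rows_def cols_def\<close>)
  have rows_eq: "int k * (int n - 1) = rows" by (simp add: rows_def m_def)
  have Hz: "?H b a = 0" if "\<not> (e - int p \<le> b \<and> b < e \<and> rows - int p \<le> a \<and> a < rows)" for b a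
    using that by (auto simp: stair_adj_def Let_def rows_eq)
  have Hj: "?H (e - int p + int j) (rows - int p + int i) = adj_mat (stair_mat n k p e x) $$ (j, i)" if "i < p" "j < p" for i j
    using that by (simp add: stair_adj_def Let_def rows_eq)
  have "deriv (\<lambda>t. det (stair_mat n k p e (\<lambda>i j. x i j + t * y i j))) 0
     = (\<Sum>i<p. \<Sum>j<p. stair n y (rows - int p + int i) (e - int p + int j) * adj_mat (stair_mat n k p e x) $$ (j, i))"
    unfolding stair_mat_def stair_linear rows_eq by (rule deriv_det)
  also have "\<dots> = (\<Sum>i<p. \<Sum>j<p. stair n y (rows - int p + int i) (e - int p + int j) * ?H (e - int p + int j) (rows - int p + int i))"
    by (intro sum.cong refl) (simp add: Hj)
  also have "\<dots> = (\<Sum>i<p. \<Sum>b\<in>{0..<cols}. stair n y (rows - int p + int i) b * ?H b (rows - int p + int i))"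
    by (intro sum.cong refl sum_int_window[symmetric]) (use p Hz in auto)
  also have "\<dots> = (\<Sum>a\<in>{0..<rows}. \<Sum>b\<in>{0..<cols}. stair n y a b * ?H b a)"
    by (rule sum_int_window[symmetric]) (use p Hz in auto)
  also have "\<dots> = (\<Sum>a\<in>{0..<rows}. y.UH ?H a a)" by (simp add: y.UH_def)
  also have "\<dots> = (\<Sum>i<n. \<Sum>l<n. y i l * (gradX ?H l i + gradY ?H l i))"
    by (rule y.sum_UH_gradient)
  finally show ?thesis .
qed

definition diag_vec :: "fmat \<Rightarrow> nat \<Rightarrow> complex" where "diag_vec M = (\<lambda>i. M i i)"

section \<open>The bracket of two minors\<close>

text \<open>The projection to trace zero affects diagonals only; hence \<open>centred\<close> on the
  Cartan part and no correction elsewhere.\<close>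

definition half_bracket :: "nat \<Rightarrow> ((nat \<Rightarrow> complex) \<Rightarrow> nat \<Rightarrow> complex) \<Rightarrow> fmat \<Rightarrow> fmat \<Rightarrow> complex" where
  "half_bracket n \<rho> E E' = pairing n (rplus_off n E) E' + dot n (\<rho> (centred n (diag_vec E))) (centred n (diag_vec E'))"

definition fun_bracket :: "nat \<Rightarrow> ((nat \<Rightarrow> complex) \<Rightarrow> nat \<Rightarrow> complex) \<Rightarrow> fmat \<Rightarrow> fmat \<Rightarrow> fmat \<Rightarrow> complex" where
  "fun_bracket n \<rho> x g g' = half_bracket n \<rho> (mmul n x g) (mmul n x g') - half_bracket n \<rho> (mmul n g x) (mmul n g' x)"

lemma mmul_add_right: "mmul n x (M + N) = mmul n x M + mmul n x N"
  and mmul_add_left: "mmul n (M + N) x = mmul n M x + mmul n N x"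
  by (auto simp: mmul_def fun_eq_iff distrib_left distrib_right sum.distrib)

lemma diag_vec_add: "diag_vec (M + N) = diag_vec M + diag_vec N"
  by (simp add: diag_vec_def fun_eq_iff)

lemma pairing_mmul: "pairing n (mmul n x g) (mmul n x g') = pairing n (mmul n g x) (mmul n g' x)"
proof -
  have "pairing n (mmul n x g) (mmul n x g') = (\<Sum>i<n. \<Sum>j<n. \<Sum>l<n. \<Sum>s<n. x i l * g l j * (x j s * g' s i))"
    unfolding pairing_def mmul_def by (simp add: sum_product)
  also have "\<dots> = (\<Sum>l<n. \<Sum>s<n. \<Sum>j<n. \<Sum>i<n. x i l * g l j * (x j s * g' s i))"
    by (subst (2) sum.swap, subst sum.swap, subst (3) sum.swap, subst (2) sum.swap, subst (3) sum.swap) (rule refl)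
  also have "\<dots> = pairing n (mmul n g x) (mmul n g' x)"
    unfolding pairing_def mmul_def by (simp add: sum_product mult_ac)
  finally show ?thesis .
qed

lemma sum_diag_vec_mmul: "sum (diag_vec (mmul n x g)) {..<n} = sum (diag_vec (mmul n g x)) {..<n}"
  unfolding diag_vec_def mmul_def by (simp, subst sum.swap) (simp add: mult.commute)

text \<open>The two geometric series are adjoint to each other except for the term of exponent 0,
  which occurs once for each of \<open>E\<close> and \<open>E'\<close> and restores the off-diagonal
  trace form. On the diagonal this is the adjointness condition on \<open>\<rho>\<close>, with the
  product of traces lost by centring.\<close>

lemma half_bracket_symmetric:
  assumes n: "n > 0" and \<rho>: "R0_vec n \<rho>"
  shows "half_bracket n \<rho> E E' + half_bracket n \<rho> E' E
    = pairing n E E' - sum (diag_vec E) {..<n} * sum (diag_vec E') {..<n} / of_nat n"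
proof -
  have *: "pairing n ((shift n ^^ s) (strict_upper n M)) N = pairing n ((shift_adj n ^^ s) (strict_lower n N)) M" for s M N
  proof -
    have "pairing n ((shift n ^^ s) (strict_upper n M)) N = pairing n ((shift n ^^ s) (strict_upper n M)) (strict_lower n N)"
      unfolding shift_pow_strict_upper by (rule pairing_strict_upper)
    also have "\<dots> = pairing n ((shift_adj n ^^ s) (strict_lower n N)) (strict_upper n M)"
      by (simp only: pairing_shift_adj_pow pairing_commute[of n "(shift n ^^ s) (strict_upper n M)"])
    also have "\<dots> = pairing n ((shift_adj n ^^ s) (strict_lower n N)) M"
      unfolding shift_adj_pow_strict_lower by (rule pairing_strict_lower[symmetric])
    finally show ?thesis .
  qed
  have off: "pairing n (rplus_off n E) E' + pairing n (rplus_off n E') E = pairing n (strict_upper n E) E' + pairing n (strict_lower n E) E'"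
  proof -
    have split0: "(\<Sum>s\<in>{0..n}. F s) = F 0 + (\<Sum>s\<in>{1..n}. F s)" for F :: "nat \<Rightarrow> complex"
      by (simp add: sum.atLeast_Suc_atMost)
    show ?thesis
      unfolding pairing_rplus_off split0 * using *[of 0 E' E] *[of 0 E E'] by simp
  qed
  have s: "sum (centred n v) {..<n} = 0" for v by (rule sum_centred[OF n])
  have "dot n (\<rho> (centred n (diag_vec E))) (centred n (diag_vec E')) + dot n (\<rho> (centred n (diag_vec E'))) (centred n (diag_vec E))
     = dot n (centred n (diag_vec E)) (centred n (diag_vec E'))"
    using \<rho> s by (simp add: R0_vec_def dot_commute[of n "\<rho> (centred n (diag_vec E'))"])
  also have "\<dots> = diag_pairing n E E' - sum (diag_vec E) {..<n} * sum (diag_vec E') {..<n} / of_nat n"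
  proof -
    have "dot n (centred n (diag_vec E)) (centred n (diag_vec E')) = dot n (diag_vec E) (centred n (diag_vec E'))"
      by (rule dot_centred[OF s])
    also have "\<dots> = dot n (diag_vec E) (diag_vec E') - (\<Sum>i<n. diag_vec E i * (sum (diag_vec E') {..<n} / of_nat n))"
      unfolding dot_def centred_def by (simp add: sum_subtractf right_diff_distrib)
    finally show ?thesis by (simp add: sum_distrib_right[symmetric] sum_divide_distrib[symmetric] dot_def diag_pairing_def diag_vec_def)
  qed
  finally have diag: "dot n (\<rho> (centred n (diag_vec E))) (centred n (diag_vec E')) + dot n (\<rho> (centred n (diag_vec E'))) (centred n (diag_vec E))
     = diag_pairing n E E' - sum (diag_vec E) {..<n} * sum (diag_vec E') {..<n} / of_nat n" .
  have "a + b + (c + d) = (a + c) + (b + d)" for a b c d :: complex by simp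
  thus ?thesis unfolding half_bracket_def
    by (rule trans) (simp only: off diag pairing_split[of n E E'], simp)
qed

lemma fun_bracket_antisymmetric:
  assumes "n > 0" "R0_vec n \<rho>"
  shows "fun_bracket n \<rho> x g g' = - fun_bracket n \<rho> x g' g"
proof -
  have "fun_bracket n \<rho> x g g' + fun_bracket n \<rho> x g' g
     = (half_bracket n \<rho> (mmul n x g) (mmul n x g') + half_bracket n \<rho> (mmul n x g') (mmul n x g))
       - (half_bracket n \<rho> (mmul n g x) (mmul n g' x) + half_bracket n \<rho> (mmul n g' x) (mmul n g x))"
    by (simp add: fun_bracket_def)
  also have "\<dots> = 0"
    unfolding half_bracket_symmetric[OF assms] by (simp add: pairing_mmul sum_diag_vec_mmul)
  finally show ?thesis by (simp add: add_eq_0_iff2)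
qed

context staircase
begin

definition toeplitz_weight :: "int \<Rightarrow> int \<Rightarrow> int \<Rightarrow> int \<Rightarrow> complex" where
  "toeplitz_weight p e p' e' = (if e = int k * w + int n then 0 else
     - (\<Sum>s\<in>{- int k..int k}. if s \<le> 0 then of_nat (card ({e' - p'..<e'} \<inter> {e + s * w..}))
          - of_nat (card ({rows - p'..<rows} \<inter> {(int k + s) * m..})) else 0))"

text \<open>If the first minor is a \<theta>, the column part vanishes since nothing lies to its
  right, and the row part vanishes for either kind of second minor. Otherwise the column part is
  evaluated by \<open>toeplitz_right_sum\<close>, which needs the larger minor first.\<close>

lemma toeplitz_sum_minors:
  assumes F: "minor_adj p e H f" "admissible p e" and G: "minor_adj p' e' H' f'" "admissible p' e'"
    and cond: "e = int k * w + int n \<or> e' \<noteq> int k * w + int n \<and> p' \<le> p"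
  shows "toeplitz_sum H H' = toeplitz_weight p e p' e' * f * f'"
proof -
  have left: "of_bool (c - s * m < a) * UH H (c - s * m) a * UH H' (a + s * m) c = 0" for a c s
  proof (cases "e' = int k * w + int n")
    case False
    hence "e' \<le> int k * w + 1" using G(2) by (auto simp: admissible_def)
    thus ?thesis by (rule toeplitz_left_zero[OF G(1)])
  next
    case True
    hence e: "e = int k * w + int n" using cond by simp
    have "p' \<le> m" "p \<le> m" using F(2) G(2) True e n2 by (auto simp: admissible_def m_def)
    moreover have "int k * w \<le> e - p" using \<open>p \<le> m\<close> e by (simp add: m_def)
    ultimately show ?thesis by (intro toeplitz_left_zero_last_block[OF F(1) G(1)])
  qed
  have split: "toeplitz_sum H H' = - (\<Sum>s\<in>{- int k..int k}.
     \<Sum>b\<in>{0..<cols}. \<Sum>d\<in>{0..<cols}. of_bool (b < d - s * w) * HU H b (d - s * w) * HU H' d (b + s * w))"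
    unfolding toeplitz_sum_split left by (simp add: sum_negf)
  show ?thesis
  proof (cases "e = int k * w + int n")
    case True
    have z: "of_bool (b < d - s * w) * HU H b (d - s * w) = 0" for b d s
      using HU_strictly_upper_last_block[OF F(1) True, of b "d - s * w"] by auto
    show ?thesis unfolding split z using True by (simp add: toeplitz_weight_def)
  next
    case False
    have e: "int k * w \<le> e" "e \<le> int k * w + 1" using False F(2) by (auto simp: admissible_def)
    have e': "e' \<le> int k * w + 1" "p' \<le> p" using False cond G(2) by (auto simp: admissible_def)
    have "(\<Sum>s\<in>S. if s \<le> 0 then f * f' * X s else 0) = f * f' * (\<Sum>s\<in>S. if s \<le> 0 then X s else 0)"
      for S :: "int set" and X by (simp add: sum_distrib_left if_distrib cong: if_cong)
    thus ?thesis unfolding split toeplitz_right_sum[OF F(1) e G(1) e'] using False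
      by (simp add: toeplitz_weight_def)
  qed
qed

lemma fun_bracket_minors:
  assumes F: "minor_adj p e H f" "admissible p e" and G: "minor_adj p' e' H' f'" "admissible p' e'"
    and cond: "e = int k * w + int n \<or> e' \<noteq> int k * w + int n \<and> p' \<le> p"
  shows "fun_bracket n \<rho> x (gradX H + gradY H) (gradX H' + gradY H')
    = toeplitz_weight p e p' e' * f * f'
      + (dot n (diag_vec (mP H)) (diag_vec (mQ H')) - dot n (diag_vec (mQ H)) (vshift n (diag_vec (mP H')))
         - dot n (diag_vec (mA H)) (diag_vec (mB H')) + dot n (diag_vec (mB H)) (vshift n (diag_vec (mA H')))
         + dot n (\<rho> (centred n (diag_vec (mA H) + diag_vec (mB H)))) (centred n (diag_vec (mA H') + diag_vec (mB H')))
         - dot n (\<rho> (centred n (diag_vec (mP H) + diag_vec (mQ H)))) (centred n (diag_vec (mP H') + diag_vec (mQ H'))))"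
proof -
  have diag_pairing: "diag_pairing n M N = dot n (diag_vec M) (diag_vec N)" for M N
    by (simp add: diag_pairing_def dot_def diag_vec_def)
  have diag_vec_shift: "diag_vec (shift n N) = vshift n (diag_vec N)" for N
    by (simp add: diag_vec_def shift_def vshift_def fun_eq_iff)
  have "pairing n (rplus_off n (mA H + mB H)) (mA H' + mB H') - pairing n (rplus_off n (mP H + mQ H)) (mP H' + mQ H')
    = toeplitz_sum H H' + (dot n (diag_vec (mP H)) (diag_vec (mQ H')) - dot n (diag_vec (mQ H)) (vshift n (diag_vec (mP H')))
         - dot n (diag_vec (mA H)) (diag_vec (mB H')) + dot n (diag_vec (mB H)) (vshift n (diag_vec (mA H'))))"
    unfolding toeplitz_sum_pairing[OF G(1)]
      rplus_off_difference[OF strict_lower_AB[OF F(1)] strict_upper_PQ[OF F] strict_lower_AB[OF G(1)] strict_upper_PQ[OF G] mB_last_col pairing_mmul] diag_pairing diag_vec_shift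
    by simp
  thus ?thesis
    unfolding fun_bracket_def half_bracket_def mmul_add_left mmul_add_right diag_vec_add
      toeplitz_sum_minors[OF F G cond] by (simp add: algebra_simps)
qed

end

text \<open>Every pair satisfies the ordering condition \<open>cond\<close> in at least one of its
  two orders, and antisymmetry supplies the other.\<close>

lemma fun_bracket_log_canonical:
  fixes n k p p' :: nat and e e' rows cols K :: int
  defines "rows \<equiv> int k * (int n - 1)" and "cols \<equiv> (int k + 1) * (int n + 1)" and "K \<equiv> int k * (int n + 1)"
  assumes n: "n \<ge> 2" and \<rho>: "R0_vec n \<rho>"
    and p: "int p \<le> rows" "int p \<le> e" "e \<le> cols" "e = K \<or> e = K + 1 \<or> e = K + int n \<and> int p \<le> int n - 1"
    and p': "int p' \<le> rows" "int p' \<le> e'" "e' \<le> cols" "e' = K \<or> e' = K + 1 \<or> e' = K + int n \<and> int p' \<le> int n - 1"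
  shows "\<exists>c. \<forall>x. fun_bracket n \<rho> x
      (staircase.gradX n k (stair_adj n k p e x) + staircase.gradY n k (stair_adj n k p e x))
      (staircase.gradX n k (stair_adj n k p' e' x) + staircase.gradY n k (stair_adj n k p' e' x))
    = c * det (stair_mat n k p e x) * det (stair_mat n k p' e' x)"
proof -
  have main: "\<exists>c. \<forall>x. fun_bracket n \<rho> x
      (staircase.gradX n k (stair_adj n k p e x) + staircase.gradY n k (stair_adj n k p e x))
      (staircase.gradX n k (stair_adj n k p' e' x) + staircase.gradY n k (stair_adj n k p' e' x))
    = c * det (stair_mat n k p e x) * det (stair_mat n k p' e' x)"
    if p: "int p \<le> rows" "int p \<le> e" "e \<le> cols" "e = K \<or> e = K + 1 \<or> e = K + int n \<and> int p \<le> int n - 1"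
      and p': "int p' \<le> rows" "int p' \<le> e'" "e' \<le> cols" "e' = K \<or> e' = K + 1 \<or> e' = K + int n \<and> int p' \<le> int n - 1"
      and cond: "e = K + int n \<or> e' \<noteq> K + int n \<and> p' \<le> p"
    for p p' e e'
  proof -
    \<comment> \<open>The weights depend only on positions. Naming them through the zero matrix
      fixes the constant before \<open>x\<close> is chosen.\<close>
    interpret S: staircase n k "\<lambda>_ _. 0" "int n - 1" "int n + 1" rows cols
      by unfold_locales (use n in \<open>simp_all add: rows_def cols_def\<close>)
    obtain \<kappa> where \<kappa>: "\<And>f a b u v f' a' b' u' v'.
       diag_weights n (S.row_weight (int p)) (\<lambda>i. S.col_weight (int p) e (i + 1))
         (sum (S.row_weight (int p)) {..<n - 1} - S.x_weight (int p) e) (S.col_weight (int p) e 0) f a b u v \<Longrightarrow>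
       diag_weights n (S.row_weight (int p')) (\<lambda>i. S.col_weight (int p') e' (i + 1))
         (sum (S.row_weight (int p')) {..<n - 1} - S.x_weight (int p') e') (S.col_weight (int p') e' 0) f' a' b' u' v' \<Longrightarrow>
       dot n u v' - dot n v (vshift n u') - dot n a b' + dot n b (vshift n a')
       + dot n (\<rho> (centred n (a + b))) (centred n (a' + b')) - dot n (\<rho> (centred n (u + v))) (centred n (u' + v'))
       = \<kappa> * f * f'"
      using diag_const[OF n \<rho>] by meson
    show ?thesis
    proof (intro exI[of _ "S.toeplitz_weight (int p) e (int p') e' + \<kappa>"] allI)
      fix x :: fmat
      interpret T: staircase n k x "int n - 1" "int n + 1" rows cols
        by unfold_locales (use n in \<open>simp_all add: rows_def cols_def\<close>)
      have adm: "T.admissible (int p) e" "T.admissible (int p') e'"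
        using p(4) p'(4) by (auto simp: T.admissible_def K_def)
      note M = T.stair_adj_minor[OF p(1-3)] and M' = T.stair_adj_minor[OF p'(1-3)]
      have cond': "e = int k * (int n + 1) + int n \<or> e' \<noteq> int k * (int n + 1) + int n \<and> int p' \<le> int p"
        using cond by (simp add: K_def)
      show "fun_bracket n \<rho> x (T.gradX (stair_adj n k p e x) + T.gradY (stair_adj n k p e x))
          (T.gradX (stair_adj n k p' e' x) + T.gradY (stair_adj n k p' e' x))
        = (S.toeplitz_weight (int p) e (int p') e' + \<kappa>) * det (stair_mat n k p e x) * det (stair_mat n k p' e' x)"
        unfolding T.fun_bracket_minors[OF M adm(1) M' adm(2) cond']
          \<kappa>[OF T.minor_diag_weights[OF M adm(1), folded diag_vec_def] T.minor_diag_weights[OF M' adm(2), folded diag_vec_def]]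
        by (simp add: algebra_simps)
    qed
  qed
  show ?thesis
  proof (cases "e = K + int n \<or> e' \<noteq> K + int n \<and> p' \<le> p")
    case True
    thus ?thesis by (rule main[OF p p'])
  next
    case False
    hence "e' = K + int n \<or> e \<noteq> K + int n \<and> p \<le> p'" by auto
    from main[OF p' p this] obtain c where c: "\<And>x. fun_bracket n \<rho> x
      (staircase.gradX n k (stair_adj n k p' e' x) + staircase.gradY n k (stair_adj n k p' e' x))
      (staircase.gradX n k (stair_adj n k p e x) + staircase.gradY n k (stair_adj n k p e x))
      = c * det (stair_mat n k p' e' x) * det (stair_mat n k p e x)" by blast
    show ?thesis
    proof (intro exI[of _ "- c"] allI)
      fix x :: fmat
      show "fun_bracket n \<rho> x
      (staircase.gradX n k (stair_adj n k p e x) + staircase.gradY n k (stair_adj n k p e x))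
      (staircase.gradX n k (stair_adj n k p' e' x) + staircase.gradY n k (stair_adj n k p' e' x))
    = - c * det (stair_mat n k p e x) * det (stair_mat n k p' e' x)"
        using n by (subst fun_bracket_antisymmetric[OF _ \<rho>]) (simp_all add: c mult_ac)
    qed
  qed
qed

section \<open>Passage from entry functions and diagonal vectors to matrices\<close>

definition diag_of_vec :: "nat \<Rightarrow> (nat \<Rightarrow> complex) \<Rightarrow> complex mat" where
  "diag_of_vec n u = mat n n (\<lambda>(i,j). if i = j then u i else 0)"

definition R0_diag :: "nat \<Rightarrow> (complex mat \<Rightarrow> complex mat) \<Rightarrow> (nat \<Rightarrow> complex) \<Rightarrow> nat \<Rightarrow> complex" where
  "R0_diag n R0 u = (\<lambda>i. R0 (diag_of_vec n u) $$ (i, i))"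

lemma diag_of_vec_cartan: "sum u {..<n} = 0 \<Longrightarrow> diag_of_vec n u \<in> cartan n"
  by (auto simp: cartan_def diag_of_vec_def diagonal_mat_def mtrace_def)

lemma cartan_diag: "A \<in> cartan n \<Longrightarrow> i < n \<Longrightarrow> j < n \<Longrightarrow> i \<noteq> j \<Longrightarrow> A $$ (i, j) = 0"
  by (auto simp: cartan_def diagonal_mat_def)

lemma mtrace_mult:
  assumes "A \<in> carrier_mat n n" "B \<in> carrier_mat n n"
  shows "mtrace (A * B) = (\<Sum>i<n. \<Sum>j<n. A $$ (i, j) * B $$ (j, i))"
  using assms by (simp add: mtrace_def scalar_prod_def lessThan_atLeast0)

lemma mtrace_cartan_diag_of_vec:
  assumes "A \<in> cartan n"
  shows "mtrace (A * diag_of_vec n u) = (\<Sum>i<n. A $$ (i, i) * u i)" "mtrace (diag_of_vec n u * A) = (\<Sum>i<n. u i * A $$ (i, i))"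
proof -
  have A: "A \<in> carrier_mat n n" using assms by (simp add: cartan_def)
  have D: "diag_of_vec n u \<in> carrier_mat n n" by (simp add: diag_of_vec_def)
  have e: "(\<Sum>j<n. A $$ (i, j) * diag_of_vec n u $$ (j, i)) = A $$ (i, i) * u i"
    "(\<Sum>j<n. diag_of_vec n u $$ (i, j) * A $$ (j, i)) = u i * A $$ (i, i)" if "i < n" for i
  proof -
    have "(\<Sum>j<n. A $$ (i, j) * diag_of_vec n u $$ (j, i)) = (\<Sum>j<n. if j = i then A $$ (i, i) * u i else 0)"
      using that by (intro sum.cong refl) (auto simp: diag_of_vec_def)
    thus "(\<Sum>j<n. A $$ (i, j) * diag_of_vec n u $$ (j, i)) = A $$ (i, i) * u i" using that by simp
    have "(\<Sum>j<n. diag_of_vec n u $$ (i, j) * A $$ (j, i)) = (\<Sum>j<n. if j = i then u i * A $$ (i, i) else 0)"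
      using that by (intro sum.cong refl) (auto simp: diag_of_vec_def)
    thus "(\<Sum>j<n. diag_of_vec n u $$ (i, j) * A $$ (j, i)) = u i * A $$ (i, i)" using that by simp
  qed
  show "mtrace (A * diag_of_vec n u) = (\<Sum>i<n. A $$ (i, i) * u i)"
    unfolding mtrace_mult[OF A D] by (intro sum.cong refl) (simp add: e)
  show "mtrace (diag_of_vec n u * A) = (\<Sum>i<n. u i * A $$ (i, i))"
    unfolding mtrace_mult[OF D A] by (intro sum.cong refl) (simp add: e)
qed

text \<open>The assumption on \<open>R0\<close> speaks of single coroots of
  \<open>\<Gamma>\<^sub>1\<close>; linearity extends it to their span, the vectors of sum zero with
  first entry zero.\<close>

lemma R0_vec_R0_diag:
  assumes n: "n \<ge> 2" and R0: "CG_R0 n R0"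
  shows "R0_vec n (R0_diag n R0)"
proof -
  have clos: "R0 a \<in> cartan n" if "a \<in> cartan n" for a using R0 that by (simp add: CG_R0_def)
  have carr: "R0 a \<in> carrier_mat n n" if "a \<in> cartan n" for a using clos[OF that] by (simp add: cartan_def)
  have add: "R0_diag n R0 (u + v) i = R0_diag n R0 u i + R0_diag n R0 v i"
    if "sum u {..<n} = 0" "sum v {..<n} = 0" "i < n" for u v i
  proof -
    have "diag_of_vec n (u + v) = diag_of_vec n u + diag_of_vec n v" by (rule eq_matI) (auto simp: diag_of_vec_def)
    hence "R0 (diag_of_vec n (u + v)) = R0 (diag_of_vec n u) + R0 (diag_of_vec n v)"
      using R0 diag_of_vec_cartan[OF that(1)] diag_of_vec_cartan[OF that(2)] by (simp add: CG_R0_def)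
    thus ?thesis using carr[OF diag_of_vec_cartan[OF that(1)]] carr[OF diag_of_vec_cartan[OF that(2)]] that(3)
      by (simp add: R0_diag_def)
  qed
  have scale: "R0_diag n R0 (scale c u) i = c * R0_diag n R0 u i" if "sum u {..<n} = 0" "i < n" for c u i
  proof -
    have "diag_of_vec n (scale c u) = c \<cdot>\<^sub>m diag_of_vec n u" by (rule eq_matI) (auto simp: diag_of_vec_def scale_def)
    hence "R0 (diag_of_vec n (scale c u)) = c \<cdot>\<^sub>m R0 (diag_of_vec n u)"
      using R0 diag_of_vec_cartan[OF that(1)] by (simp add: CG_R0_def)
    thus ?thesis using carr[OF diag_of_vec_cartan[OF that(1)]] that(2) by (simp add: R0_diag_def)
  qed
  have adj: "dot n (R0_diag n R0 u) v + dot n u (R0_diag n R0 v) = dot n u v"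
    if "sum u {..<n} = 0" "sum v {..<n} = 0" for u v
  proof -
    note c = diag_of_vec_cartan[OF that(1)] diag_of_vec_cartan[OF that(2)]
    have "mtrace (R0 (diag_of_vec n u) * diag_of_vec n v) + mtrace (diag_of_vec n u * R0 (diag_of_vec n v)) = mtrace (diag_of_vec n u * diag_of_vec n v)"
      using R0 c by (simp add: CG_R0_def)
    moreover have "(\<Sum>i<n. diag_of_vec n u $$ (i, i) * v i) = dot n u v"
      unfolding dot_def by (intro sum.cong refl) (simp add: diag_of_vec_def)
    ultimately show ?thesis
      unfolding mtrace_cartan_diag_of_vec(1)[OF clos[OF c(1)]] mtrace_cartan_diag_of_vec(2)[OF clos[OF c(2)]] mtrace_cartan_diag_of_vec(1)[OF c(1)]
      by (simp add: dot_def R0_diag_def)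
  qed
  have sum_vshift: "sum (vshift n v) {..<n} = sum v {..<n} - v 0" for v
  proof -
    obtain n' where n': "n = Suc n'" using n by (cases n) auto
    have "sum (vshift n v) {..<n} = (\<Sum>i<n'. v (Suc i))"
      unfolding n' by (simp add: vshift_def)
    thus ?thesis unfolding n' sum.lessThan_Suc_shift by simp
  qed
  have root: "R0_diag n R0 ((e_vec N - e_vec (Suc N)) - vshift n (e_vec N - e_vec (Suc N))) i = (e_vec N - e_vec (Suc N)) i"
    if N: "1 \<le> N" "Suc N < n" "i < n" for N i
  proof -
    have "diag_of_vec n ((e_vec N - e_vec (Suc N)) - vshift n (e_vec N - e_vec (Suc N)))
        = coroot n (Suc N) - coroot n (Suc N - 1)"
      by (rule eq_matI) (use N in \<open>auto simp: diag_of_vec_def coroot_def Eu_def e_vec_def vshift_def\<close>)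
    moreover have "R0 (coroot n (Suc N) - coroot n (Suc N - 1)) = coroot n (Suc N)"
    proof -
      have "\<forall>i\<in>{2..n - 1}. R0 (coroot n i - coroot n (i - 1)) = coroot n i"
        using R0 unfolding CG_R0_def by blast
      moreover have "Suc N \<in> {2..n - 1}" using N by auto
      ultimately show ?thesis by blast
    qed
    ultimately show ?thesis
      using N by (simp add: R0_diag_def coroot_def Eu_def e_vec_def)
  qed
  \<comment> \<open>Induction on a bound \<open>N\<close> for the last nonzero entry.\<close>
  have h: "\<forall>i<n. R0_diag n R0 (h - vshift n h) i = h i"
    if "h 0 = 0" "sum h {..<n} = 0" "N < n" "\<And>i. N < i \<Longrightarrow> i < n \<Longrightarrow> h i = 0" for h N
    using that
  proof (induction N arbitrary: h)
    case 0
    have z: "h i = 0" if "i < n" for i using 0(1) 0(4)[of i] that by (cases i) auto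
    have "diag_of_vec n (h - vshift n h) = diag_of_vec n (scale 0 0)"
      by (rule eq_matI) (auto simp: diag_of_vec_def scale_def vshift_def z)
    hence "R0_diag n R0 (h - vshift n h) i = R0_diag n R0 (scale 0 0) i" for i by (simp only: R0_diag_def)
    thus ?case using scale[of 0 _ 0] z by (simp only:) simp
  next
    case (Suc N)
    show ?case
    proof (cases "N = 0")
      case True
      have "sum h {..<n} = (\<Sum>i<n. if i = 1 then h 1 else 0)"
      proof (intro sum.cong refl)
        fix i assume "i \<in> {..<n}"
        thus "h i = (if i = 1 then h 1 else 0)" using Suc.prems(1) Suc.prems(4)[of i] True by (cases i) auto
      qed
      hence h1: "h 1 = 0" using Suc.prems(2) n by simp
      show ?thesis
      proof (rule Suc.IH)
        fix i assume "N < i" "i < n"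
        thus "h i = 0" using h1 Suc.prems(4)[of i] True by (cases "i = 1") auto
      qed (use Suc.prems in auto)
    next
      case False
      let ?c = "e_vec N - e_vec (Suc N) :: nat \<Rightarrow> complex"
      \<comment> \<open>Clears the entry at \<open>Suc N\<close> by a multiple of a coroot; since
        \<open>N > 0\<close>, the first entry stays zero.\<close>
      define h' where "h' = h + scale (h (Suc N)) ?c"
      have sumc: "sum ?c {..<n} = 0"
        using Suc.prems(3) by (simp add: sum_subtractf) (simp add: e_vec_def)
      have c0: "?c 0 = 0" using False by (simp add: e_vec_def)
      have h'0: "h' 0 = 0" using Suc.prems(1) c0 by (simp add: h'_def scale_def)
      have sumh': "sum h' {..<n} = 0"
        using Suc.prems(2) sumc by (simp add: h'_def scale_def sum.distrib sum_distrib_left[symmetric] del: minus_apply)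
      have IH: "\<forall>i<n. R0_diag n R0 (h' - vshift n h') i = h' i"
      proof (rule Suc.IH[OF h'0 sumh'])
        fix i assume i: "N < i" "i < n"
        show "h' i = 0"
        proof (cases "i = Suc N")
          case True thus ?thesis by (simp add: h'_def scale_def e_vec_def)
        next
          case False thus ?thesis using i Suc.prems(4)[of i] by (simp add: h'_def scale_def e_vec_def)
        qed
      qed (use Suc.prems(3) in simp)
      have s1: "sum (h' - vshift n h') {..<n} = 0" using sumh' h'0 sum_vshift[of h'] by (simp add: sum_subtractf)
      have s2: "sum (?c - vshift n ?c) {..<n} = 0" using sumc c0 sum_vshift[of ?c] by (simp add: sum_subtractf del: minus_apply) (simp add: sum_subtractf)
      have s3: "sum (scale (- h (Suc N)) (?c - vshift n ?c)) {..<n} = 0"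
      proof -
        have "sum (scale q v) {..<n} = q * sum v {..<n}" for q v by (simp add: scale_def sum_distrib_left)
        thus ?thesis using s2 by (simp only: mult_zero_right)
      qed
      have eq: "h - vshift n h = (h' - vshift n h') + scale (- h (Suc N)) (?c - vshift n ?c)"
        unfolding h'_def by (auto simp: scale_def vshift_def fun_eq_iff algebra_simps)
      show ?thesis
      proof (intro allI impI)
        fix i assume i: "i < n"
        have "R0_diag n R0 (h - vshift n h) i = h' i - h (Suc N) * ?c i"
          unfolding eq using add[OF s1 s3 i] scale[OF s2 i, of "- h (Suc N)"] IH root[of N i] False Suc.prems(3) i
          by (simp del: minus_apply)
        thus "R0_diag n R0 (h - vshift n h) i = h i" by (simp add: h'_def scale_def)
      qed
    qed
  qed
  show ?thesis
    unfolding R0_vec_def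
  proof (intro conjI allI impI)
    fix u v :: "nat \<Rightarrow> complex" and i assume "\<forall>i<n. u i = v i"
    hence "diag_of_vec n u = diag_of_vec n v" by (intro eq_matI) (auto simp: diag_of_vec_def)
    thus "R0_diag n R0 u i = R0_diag n R0 v i" by (simp add: R0_diag_def)
  qed (use add scale adj h[where N = "n - 1"] n in auto)
qed

definition entries :: "complex mat \<Rightarrow> fmat" where "entries A = (\<lambda>i j. A $$ (i, j))"

lemma gammaU_pow:
  assumes "\<And>i j. i < n \<Longrightarrow> j < n \<Longrightarrow> A $$ (i, j) = M i j" "A \<in> carrier_mat n n"
  shows "i < n \<Longrightarrow> j < n \<Longrightarrow> (gammaU n ^^ s) A $$ (i, j) = (shift n ^^ s) M i j"
proof (induction s arbitrary: i j)
  case (Suc s) thus ?case by (simp add: gammaU_def shift_def)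
qed (simp add: assms)

lemma gammaT_pow:
  assumes "\<And>i j. i < n \<Longrightarrow> j < n \<Longrightarrow> A $$ (i, j) = M i j" "A \<in> carrier_mat n n"
  shows "i < n \<Longrightarrow> j < n \<Longrightarrow> (gammaT n ^^ s) A $$ (i, j) = (shift_adj n ^^ s) M i j"
proof (induction s arbitrary: i j)
  case (Suc s) thus ?case by (simp add: gammaT_def shift_adj_def)
qed (simp add: assms)

lemma rplus_off_diag: "rplus_off n E i i = 0"
proof -
  have "strict_upper n M i i = 0" "strict_lower n M i i = 0" for M by (simp_all add: strict_upper_def strict_lower_def)
  thus ?thesis by (simp add: rplus_off_def shift_pow_strict_upper shift_adj_pow_strict_lower)
qed

lemma mtrace_Rplus:
  assumes n: "n \<ge> 2" and R0: "CG_R0 n R0"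
    and A: "A \<in> carrier_mat n n" "\<And>i j. i < n \<Longrightarrow> j < n \<Longrightarrow> A $$ (i, j) = E i j"
    and A': "A' \<in> carrier_mat n n" "\<And>i j. i < n \<Longrightarrow> j < n \<Longrightarrow> A' $$ (i, j) = E' i j"
  shows "mtrace (Rplus n R0 (pr_sl n A) * pr_sl n A') = half_bracket n (R0_diag n R0) E E'"
proof -
  have tr: "mtrace B = sum (diag_vec F) {..<n}" if "B \<in> carrier_mat n n" "\<And>i j. i < n \<Longrightarrow> j < n \<Longrightarrow> B $$ (i, j) = F i j" for B F
    using that by (simp add: mtrace_def diag_vec_def)
  have pr: "pr_sl n B \<in> carrier_mat n n"
     "\<And>i j. i < n \<Longrightarrow> j < n \<Longrightarrow> pr_sl n B $$ (i, j) = (if i = j then centred n (diag_vec F) i else F i j)"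
    if "B \<in> carrier_mat n n" "\<And>i j. i < n \<Longrightarrow> j < n \<Longrightarrow> B $$ (i, j) = F i j" for B F
    using that tr[OF that] by (auto simp: pr_sl_def centred_def diag_vec_def)
  have diag: "diag_part n (pr_sl n A) = diag_of_vec n (centred n (diag_vec E))"
    by (rule eq_matI) (auto simp: diag_part_def diag_of_vec_def pr(2)[OF A])
  have n0: "n > 0" using n by simp
  have cart: "diag_of_vec n (centred n (diag_vec E)) \<in> cartan n" by (rule diag_of_vec_cartan[OF sum_centred[OF n0]])
  have R0c: "R0 (diag_of_vec n (centred n (diag_vec E))) \<in> cartan n" using R0 cart by (simp add: CG_R0_def)
  hence R0carr: "R0 (diag_of_vec n (centred n (diag_vec E))) \<in> carrier_mat n n" by (simp add: cartan_def)
  have uE: "(gammaU n ^^ s) (upper_part n (pr_sl n A)) $$ (i, j) = (shift n ^^ s) (strict_upper n E) i j" if "i < n" "j < n" for i j s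
    by (rule gammaU_pow[OF _ _ that]) (auto simp: upper_part_def strict_upper_def pr(2)[OF A])
  have lE: "(gammaT n ^^ s) (lower_part n (pr_sl n A)) $$ (i, j) = (shift_adj n ^^ s) (strict_lower n E) i j" if "i < n" "j < n" for i j s
    by (rule gammaT_pow[OF _ _ that]) (auto simp: lower_part_def strict_lower_def pr(2)[OF A])
  have Rcarr: "Rplus n R0 (pr_sl n A) \<in> carrier_mat n n"
    unfolding Rplus_def diag using R0carr by simp
  have Rent: "Rplus n R0 (pr_sl n A) $$ (i, j) = rplus_off n E i j + (if i = j then R0_diag n R0 (centred n (diag_vec E)) i else 0)"
    if "i < n" "j < n" for i j
    unfolding Rplus_def diag using that R0carr cartan_diag[OF R0c that]
    by (auto simp: uE lE rplus_off_def R0_diag_def)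
  have "mtrace (Rplus n R0 (pr_sl n A) * pr_sl n A')
     = (\<Sum>i<n. \<Sum>j<n. Rplus n R0 (pr_sl n A) $$ (i, j) * pr_sl n A' $$ (j, i))"
    by (rule mtrace_mult[OF Rcarr pr(1)[OF A']])
  also have "\<dots> = (\<Sum>i<n. \<Sum>j<n. rplus_off n E i j * E' j i
      + (if j = i then R0_diag n R0 (centred n (diag_vec E)) i * centred n (diag_vec E') i else 0))"
    by (intro sum.cong refl) (auto simp: Rent pr(2)[OF A'] rplus_off_diag)
  also have "\<dots> = half_bracket n (R0_diag n R0) E E'"
    by (simp add: half_bracket_def pairing_def dot_def sum.distrib)
  finally show ?thesis .
qed

lemma CG_bracket_fun_bracket:
  assumes n: "n \<ge> 2" and R0: "CG_R0 n R0" and X: "X \<in> carrier_mat n n"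
    and g: "\<And>i j. i < n \<Longrightarrow> j < n \<Longrightarrow> grad n f X $$ (i, j) = g i j"
    and g': "\<And>i j. i < n \<Longrightarrow> j < n \<Longrightarrow> grad n f' X $$ (i, j) = g' i j"
  shows "CG_bracket n R0 f f' X = fun_bracket n (R0_diag n R0) (entries X) g g'"
proof -
  have G: "grad n f X \<in> carrier_mat n n" for f by (simp add: grad_def)
  have L: "(X * grad n f X) $$ (i, j) = mmul n (entries X) g i j"
    "(grad n f X * X) $$ (i, j) = mmul n g (entries X) i j"
    if "i < n" "j < n" "\<And>i j. i < n \<Longrightarrow> j < n \<Longrightarrow> grad n f X $$ (i, j) = g i j" for i j f g
    using that X G[of f] by (simp_all add: scalar_prod_def mmul_def entries_def lessThan_atLeast0)
  have c: "X * grad n f X \<in> carrier_mat n n" "grad n f X * X \<in> carrier_mat n n" for f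
    using mult_carrier_mat[OF X G] mult_carrier_mat[OF G X] .
  have "mtrace (Rplus n R0 (gradL n f X) * gradL n f' X)
     = half_bracket n (R0_diag n R0) (mmul n (entries X) g) (mmul n (entries X) g')"
    unfolding gradL_def
    by (rule mtrace_Rplus[OF n R0 c(1) _ c(1)]) (rule L(1); use g g' in blast)+
  moreover have "mtrace (Rplus n R0 (gradR n f X) * gradR n f' X)
     = half_bracket n (R0_diag n R0) (mmul n g (entries X)) (mmul n g' (entries X))"
    unfolding gradR_def
    by (rule mtrace_Rplus[OF n R0 c(2) _ c(2)]) (rule L(2); use g g' in blast)+
  ultimately show ?thesis by (simp add: CG_bracket_def fun_bracket_def)
qed

section \<open>The family as minors of the staircase, and its gradients\<close>

lemma stair_mat_cong:
  assumes "n \<ge> 2" "\<And>i j. i < n \<Longrightarrow> j < n \<Longrightarrow> x i j = y i j"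
  shows "stair_mat n k p e x = stair_mat n k p e y"
  unfolding stair_mat_def using stair_cong[OF assms] by (intro eq_matI) auto

lemma grad_stair_minor:
  fixes n k p :: nat and e :: int
  assumes n: "n \<ge> 2" and X: "X \<in> carrier_mat n n"
    and f: "\<And>X. X \<in> carrier_mat n n \<Longrightarrow> f X = det (stair_mat n k p e (entries X))"
    and p: "int p \<le> int k * (int n - 1)" "int p \<le> e" "e \<le> (int k + 1) * (int n + 1)"
    and ij: "i < n" "j < n"
  defines "H \<equiv> stair_adj n k p e (entries X)"
  shows "grad n f X $$ (i, j) = (staircase.gradX n k H + staircase.gradY n k H) i j"
proof -
  interpret staircase n k "entries X" "int n - 1" "int n + 1" "int k * (int n - 1)" "(int k + 1) * (int n + 1)"
    by unfold_locales (use n in simp_all)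
  define y :: fmat where "y = (\<lambda>a b. if a = j \<and> b = i then 1 else 0)"
  have "f (X + t \<cdot>\<^sub>m Eu n j i) = det (stair_mat n k p e (\<lambda>a b. entries X a b + t * y a b))" for t
  proof -
    have "X + t \<cdot>\<^sub>m Eu n j i \<in> carrier_mat n n" using X by (simp add: Eu_def)
    hence "f (X + t \<cdot>\<^sub>m Eu n j i) = det (stair_mat n k p e (entries (X + t \<cdot>\<^sub>m Eu n j i)))" by (rule f)
    also have "stair_mat n k p e (entries (X + t \<cdot>\<^sub>m Eu n j i)) = stair_mat n k p e (\<lambda>a b. entries X a b + t * y a b)"
      using X by (intro stair_mat_cong[OF n]) (simp add: entries_def Eu_def y_def)
    finally show ?thesis .
  qed
  hence "grad n f X $$ (i, j) = deriv (\<lambda>t. det (stair_mat n k p e (\<lambda>a b. entries X a b + t * y a b))) 0"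
    using ij by (simp add: grad_def)
  also have "\<dots> = (\<Sum>a<n. \<Sum>l<n. y a l * (gradX H l a + gradY H l a))"
    unfolding H_def by (rule deriv_stair_minor[OF p])
  also have "\<dots> = (\<Sum>a<n. if a = j then gradX H i a + gradY H i a else 0)"
  proof (intro sum.cong refl)
    fix a
    have "(\<Sum>l<n. y a l * (gradX H l a + gradY H l a)) = (\<Sum>l<n. if l = i then (if a = j then gradX H i a + gradY H i a else 0) else 0)"
      by (intro sum.cong refl) (simp add: y_def)
    thus "(\<Sum>l<n. y a l * (gradX H l a + gradY H l a)) = (if a = j then gradX H i a + gradY H i a else 0)"
      using ij by simp
  qed
  finally show ?thesis using ij by simp
qed

lemma UU_stair:
  assumes n: "n \<ge> 2" and X: "X \<in> carrier_mat n n" and a: "a < kk n * (n - 1)" and b: "b < (kk n + 1) * (n + 1)"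
  shows "UU n X X $$ (a, b) = stair n (entries X) (int a) (int b)"
proof -
  define t r t' c where "t = a div (n - 1)" and "r = a mod (n - 1)" and "t' = b div (n + 1)" and "c = b mod (n + 1)"
  have r: "r < n - 1" using n by (simp add: r_def)
  have c: "c < n + 1" by (simp add: c_def)
  have a_eq: "int a = int t * (int n - 1) + int r"
  proof -
    have "a = t * (n - 1) + r" unfolding t_def r_def by (rule div_mult_mod_eq[symmetric])
    hence "int a = int t * int (n - 1) + int r" by (metis of_nat_add of_nat_mult)
    thus ?thesis using n by (simp add: of_nat_diff)
  qed
  have b_eq: "int b = int t' * (int n + 1) + int c"
  proof -
    have "b = t' * (n + 1) + c" unfolding t'_def c_def by (rule div_mult_mod_eq[symmetric])
    hence "int b = int t' * int (n + 1) + int c" by (metis of_nat_add of_nat_mult)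
    thus ?thesis by (simp add: add.commute)
  qed
  interpret staircase n "kk n" "entries X" "int n - 1" "int n + 1" "int (kk n) * (int n - 1)" "(int (kk n) + 1) * (int n + 1)"
    by unfold_locales (use n in simp_all)
  have lhs: "UU n X X $$ (a, b) = (if t' = t then (if c = 0 then 0 else X $$ (r, c - 1))
      else if t' = t + 1 then (if c < n then X $$ (r + 1, c) else 0) else 0)"
    using a b r c by (simp add: UU_def t_def r_def t'_def c_def Let_def calX_def calY_def)
  have rhs: "stair n (entries X) (int a) (int b)
     = (if int t * (int n + 1) + 1 \<le> int b \<and> int b \<le> int t * (int n + 1) + 2 * int n
        then wrow n (entries X) r (nat (int b - int t * (int n + 1) - 1)) else 0)"
    unfolding a_eq by (rule U_block[OF r])
  consider "t' < t" | "t' = t" | "t' = t + 1" | "t' > t + 1" by linarith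
  thus ?thesis
  proof cases
    case 1
    hence "int t' + 1 \<le> int t" by simp
    hence "(int t' + 1) * (int n + 1) \<le> int t * (int n + 1)" by (intro mult_right_mono) auto
    hence "(int t' + 1) * (int n + 1) = int t' * (int n + 1) + (int n + 1)" "\<not> int t * (int n + 1) + 1 \<le> int b"
      using c b_eq by (simp_all add: distrib_right)
    thus ?thesis unfolding lhs rhs using 1 by simp
  next
    case 2
    have "int b - int t * (int n + 1) - 1 = int c - 1" using 2 b_eq by simp
    have "nat (int c - 1) = c - 1" by simp
    have "wrow n (entries X) r (nat (int b - int t * (int n + 1) - 1)) = X $$ (r, c - 1)"
    proof -
      have "c - 1 < n" using c n by simp
      thus ?thesis using \<open>int b - int t * (int n + 1) - 1 = int c - 1\<close> \<open>nat (int c - 1) = c - 1\<close>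
        by (simp only: wrow_def entries_def if_True)
    qed
    moreover have "int t * (int n + 1) + 1 \<le> int b \<and> int b \<le> int t * (int n + 1) + 2 * int n \<longleftrightarrow> c \<noteq> 0"
      using 2 b_eq c n by auto
    ultimately show ?thesis unfolding lhs rhs using 2 by simp
  next
    case 3
    have eq: "int b = int t * (int n + 1) + (int n + 1 + int c)" using 3 b_eq by (simp add: distrib_right)
    hence "nat (int b - int t * (int n + 1) - 1) = n + c" by simp
    hence "wrow n (entries X) r (nat (int b - int t * (int n + 1) - 1)) = X $$ (r + 1, c)"
      by (simp add: wrow_def entries_def)
    moreover have "int t * (int n + 1) + 1 \<le> int b \<and> int b \<le> int t * (int n + 1) + 2 * int n \<longleftrightarrow> c < n"
      using eq by auto
    ultimately show ?thesis unfolding lhs rhs using 3 by simp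
  next
    case 4
    hence "int t + 2 \<le> int t'" by simp
    hence "(int t + 2) * (int n + 1) \<le> int t' * (int n + 1)" by (intro mult_right_mono) auto
    moreover have "(int t + 2) * (int n + 1) = int t * (int n + 1) + 2 * int n + 2" by (simp add: algebra_simps)
    ultimately have "\<not> int b \<le> int t * (int n + 1) + 2 * int n" using b_eq by linarith
    thus ?thesis unfolding lhs rhs using 4 by simp
  qed
qed

text \<open>A \<theta> lies in the copy of \<open>calX\<close> in the last block row, whose columns
  stop before its zero column: this gives the end \<open>k * w + n\<close>, and size at most
  \<open>n - 1\<close>. The \<phi>'s end where block column \<open>k\<close> begins, the \<psi>'s
  one column later.\<close>

lemma CG_family_stair:
  assumes n: "n \<ge> 2" and f: "f \<in> CG_family n"
  shows "\<exists>p e. int p \<le> int (kk n) * (int n - 1) \<and> int p \<le> e \<and> e \<le> (int (kk n) + 1) * (int n + 1) \<and>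
     (e = int (kk n) * (int n + 1) \<or> e = int (kk n) * (int n + 1) + 1 \<or>
        e = int (kk n) * (int n + 1) + int n \<and> int p \<le> int n - 1) \<and>
     (\<forall>X\<in>carrier_mat n n. f X = det (stair_mat n (kk n) p e (entries X)))"
proof -
  have k: "kk n \<ge> 1" using n by (simp add: kk_def)
  have NN: "int (NN n) = int (kk n) * (int n - 1)" using n by (simp add: NN_def of_nat_diff)
  have MM: "MM n \<le> NN n"
  proof (cases "even n")
    case False
    hence "n \<ge> 3" using n by (cases "n = 2") auto
    hence "kk n \<ge> 2" by (simp add: kk_def)
    \<comment> \<open>This also gives \<open>NN n \<ge> n\<close>, so the subtraction in
      \<open>MM\<close> is not truncated.\<close>
    hence "2 * (n - 1) \<le> NN n" unfolding NN_def by (intro mult_right_mono) auto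
    thus ?thesis using False n by (simp add: MM_def)
  qed (simp add: MM_def)
  have K: "int (kk n) * (int n - 1) \<le> int (kk n) * (int n + 1)" by (intro mult_left_mono) auto
  have minor: "det (csub (UU n X X) (NN n - p) c0 p) = det (stair_mat n (kk n) p (int c0 + int p) (entries X))"
    if p: "p \<le> NN n" and c0: "c0 + p \<le> (kk n + 1) * (n + 1)" and X: "X \<in> carrier_mat n n" for p c0 X
  proof (intro arg_cong[of _ _ det] eq_matI)
    fix i j assume "i < dim_row (stair_mat n (kk n) p (int c0 + int p) (entries X))"
      "j < dim_col (stair_mat n (kk n) p (int c0 + int p) (entries X))"
    hence ij: "i < p" "j < p" by (simp_all add: stair_mat_def)
    have "UU n X X $$ (NN n - p + i, c0 + j) = stair n (entries X) (int (NN n - p + i)) (int (c0 + j))"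
      by (rule UU_stair[OF n X]) (use ij p c0 in \<open>simp_all add: NN_def\<close>)
    moreover have "int (NN n - p + i) = int (kk n) * (int n - 1) - int p + int i"
      using p NN by (simp add: of_nat_diff)
    ultimately show "csub (UU n X X) (NN n - p) c0 p $$ (i, j) = stair_mat n (kk n) p (int c0 + int p) (entries X) $$ (i, j)"
      using ij by (simp add: csub_def stair_mat_def)
  qed (simp_all add: csub_def stair_mat_def)
  from f consider i where "1 \<le> i" "i \<le> n - 1" "f = theta n i" | p where "1 \<le> p" "p \<le> NN n" "f = (\<lambda>X. phi n p X X)"
    | p where "1 \<le> p" "p \<le> MM n" "f = (\<lambda>X. psi n p X X)"
    unfolding CG_family_def by auto
  thus ?thesis
  proof cases
    case (1 i)
    let ?e = "int (kk n) * (int n + 1) + int n"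
    interpret staircase n "kk n" x "int n - 1" "int n + 1" "int (kk n) * (int n - 1)" "(int (kk n) + 1) * (int n + 1)" for x
      by unfold_locales (use n in simp_all)
    have ii: "int i \<le> int n - 1" using 1 n by linarith
    have le: "1 * (int n - 1) \<le> int (kk n) * (int n - 1)" using k n by (intro mult_right_mono) auto
    have "f X = det (stair_mat n (kk n) i ?e (entries X))" if X: "X \<in> carrier_mat n n" for X
      unfolding 1 theta_def
    proof (intro arg_cong[of _ _ det] eq_matI)
      fix r c assume "r < dim_row (stair_mat n (kk n) i ?e (entries X))" "c < dim_col (stair_mat n (kk n) i ?e (entries X))"
      hence rc: "r < i" "c < i" by (simp_all add: stair_mat_def)
      let ?r = "n - 1 - i + r"
      have r: "?r < n - 1" using rc 1 by simp
      have row: "int (kk n) * (int n - 1) - int i + int r = (int (kk n) - 1) * (int n - 1) + int ?r"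
        using 1 n by (simp add: of_nat_diff algebra_simps)
      \<comment> \<open>The summand \<open>n\<close> skips the \<open>Y\<close> half of the window.
        The row offset \<open>?r\<close> is one less than the row of \<open>X\<close>, because
        \<open>calX\<close> drops the first row.\<close>
      define z where "z = n + (n - i + c)"
      have z: "z < 2 * n" using rc 1 n by (simp add: z_def)
      have col: "?e - int i + int c = (int (kk n) - 1) * (int n + 1) + 1 + int z"
        using 1 n by (simp add: z_def of_nat_diff algebra_simps)
      have "stair n (entries X) (int (kk n) * (int n - 1) - int i + int r) (?e - int i + int c)
         = wrow n (entries X) ?r z"
        unfolding row col U_block[OF r] using z by simp
      also have "\<dots> = X $$ (n - i + r, n - i + c)"
      proof -
        have "?r + 1 = n - i + r" "\<not> z < n" "z - n = n - i + c" using 1 n by (simp_all add: z_def)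
        thus ?thesis by (simp only: wrow_def entries_def if_False)
      qed
      finally show "csub X (n - i) (n - i) i $$ (r, c) = stair_mat n (kk n) i ?e (entries X) $$ (r, c)"
        using rc by (simp add: csub_def stair_mat_def)
    qed (simp_all add: csub_def stair_mat_def)
    moreover have iR: "int i \<le> int (kk n) * (int n - 1)" using order_trans[OF ii] le by simp
    moreover have "int i \<le> ?e" using order_trans[OF iR K] by simp
    moreover have "?e \<le> (int (kk n) + 1) * (int n + 1)" by (simp add: distrib_right)
    ultimately show ?thesis using ii by blast
  next
    case (2 p)
    have pK: "p \<le> kk n * (n + 1)" using 2(2) unfolding NN_def by (rule order_trans) (rule mult_le_mono2, simp)
    have "f X = det (stair_mat n (kk n) p (int (kk n) * (int n + 1)) (entries X))" if X: "X \<in> carrier_mat n n" for X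
      using minor[OF 2(2) _ X, of "kk n * (n + 1) - p"] pK unfolding 2(3) phi_def by (simp add: of_nat_diff algebra_simps)
    moreover have "int p \<le> int (kk n) * (int n - 1)" using 2(2) NN by linarith
    ultimately show ?thesis using K
      by (intro exI[of _ p] exI[of _ "int (kk n) * (int n + 1)"]) (auto simp: distrib_right)
  next
    case (3 p)
    have p: "p \<le> NN n" using 3 MM by simp
    have pK: "p \<le> kk n * (n + 1)" using p unfolding NN_def by (rule order_trans) (rule mult_le_mono2, simp)
    have "f X = det (stair_mat n (kk n) p (int (kk n) * (int n + 1) + 1) (entries X))" if X: "X \<in> carrier_mat n n" for X
      using minor[OF p _ X, of "kk n * (n + 1) + 1 - p"] pK unfolding 3(3) psi_def by (simp add: of_nat_diff algebra_simps)
    moreover have "int p \<le> int (kk n) * (int n - 1)" using p NN by linarith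
    ultimately show ?thesis using K
      by (intro exI[of _ p] exI[of _ "int (kk n) * (int n + 1) + 1"]) (auto simp: distrib_right)
  qed
qed

theorem theorem3:
  fixes n :: nat and R0 :: "complex mat \<Rightarrow> complex mat"
  assumes "n \<ge> 2"
    and "CG_R0 n R0"
  shows "\<forall>f\<in>CG_family n. \<forall>g\<in>CG_family n. \<exists>c::complex.
           \<forall>X\<in>carrier_mat n n. det X = 1 \<longrightarrow>
             CG_bracket n R0 f g X = c * f X * g X"
proof (intro ballI)
  fix f g assume fg: "f \<in> CG_family n" "g \<in> CG_family n"
  from CG_family_stair[OF assms(1) fg(1)] obtain p e where
    p: "int p \<le> int (kk n) * (int n - 1)" "int p \<le> e" "e \<le> (int (kk n) + 1) * (int n + 1)"
     "e = int (kk n) * (int n + 1) \<or> e = int (kk n) * (int n + 1) + 1 \<or>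
        e = int (kk n) * (int n + 1) + int n \<and> int p \<le> int n - 1"
    and f: "\<And>X. X \<in> carrier_mat n n \<Longrightarrow> f X = det (stair_mat n (kk n) p e (entries X))"
    by blast
  from CG_family_stair[OF assms(1) fg(2)] obtain p' e' where
    p': "int p' \<le> int (kk n) * (int n - 1)" "int p' \<le> e'" "e' \<le> (int (kk n) + 1) * (int n + 1)"
     "e' = int (kk n) * (int n + 1) \<or> e' = int (kk n) * (int n + 1) + 1 \<or>
        e' = int (kk n) * (int n + 1) + int n \<and> int p' \<le> int n - 1"
    and g: "\<And>X. X \<in> carrier_mat n n \<Longrightarrow> g X = det (stair_mat n (kk n) p' e' (entries X))"
    by blast
  obtain c where c: "\<And>x. fun_bracket n (R0_diag n R0) x
      (staircase.gradX n (kk n) (stair_adj n (kk n) p e x) + staircase.gradY n (kk n) (stair_adj n (kk n) p e x))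
      (staircase.gradX n (kk n) (stair_adj n (kk n) p' e' x) + staircase.gradY n (kk n) (stair_adj n (kk n) p' e' x))
    = c * det (stair_mat n (kk n) p e x) * det (stair_mat n (kk n) p' e' x)"
    using fun_bracket_log_canonical[OF assms(1) R0_vec_R0_diag[OF assms] p p'] by blast
  have "CG_bracket n R0 f g X = c * f X * g X" if X: "X \<in> carrier_mat n n" for X
    using CG_bracket_fun_bracket[OF assms X grad_stair_minor[OF assms(1) X f p(1-3)] grad_stair_minor[OF assms(1) X g p'(1-3)]]
    by (simp only: c f[OF X] g[OF X])
  thus "\<exists>c. \<forall>X\<in>carrier_mat n n. det X = 1 \<longrightarrow> CG_bracket n R0 f g X = c * f X * g X" by blast
qed

end
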